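(* Let $\mathbf d=(d_1,d_2)\in\mathbb Z^2_{>0}$. The following two assertions are equivalent. (i) There is a nonempty open set in the space of coefficients of triples $\mathbf f=(f_0,f_1,f_2)$ of polynomials of bidegree $\mathbf d$ such that every $\mathbf f$ in it is generic, and hence $\dim_{\mathbb K}(H_1)_{\mathbf a}=n_{\mathbf d}(\mathbf a)$ for all $\mathbf a\in\mathbb Z^2_{\ge0}$. (ii) There is a nonempty open set in the space of coefficients of triples $\mathbf f=(f_0,f_1,f_2)$ of polynomials of bidegree $\mathbf d$ such that every $\mathbf f$ in it satisfies $\dim_{\mathbb K}(R/I_W)_{\mathbf a}=\chi(\mathbf a)_+$ for all $\mathbf a\in\mathbb Z^2_{\ge 0}$.
   Context: $\mathbb K$ is a field and $R=\mathbb K[s,t;u,v]$ is $\mathbb Z^2$-graded with $\deg s=\deg t=(1,0)$, $\deg u=\deg v=(0,1)$; $R_{(p,q)}=0$ if $p<0$ or $q<0$. $B=\langle s,t\rangle\cap\langle u,v\rangle$, $I_W=\langle f_0,f_1,f_2\rangle$, and $H_1$ is the first Koszul homology of $\mathbf f$ on $R$, that is, the homology at $R(-\mathbf d)^3$ of the bigraded Koszul complex $0\to R(-3\mathbf d)\to R(-2\mathbf d)^3\to R(-\mathbf d)^3\to R\to0$. Open means Zariski open. For a real number $c$, $c_+=\max(c,0)$. Euler characteristic: $\chi(\mathbf a)=\dim R_{\mathbf a}-3\dim R_{\mathbf a-\mathbf d}+3\dim R_{\mathbf a-2\mathbf d}-\dim R_{\mathbf a-3\mathbf d}$. Maps $\phi_1,\phi_2$: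 for $\mathbf a=(a_1,a_2)$, let $$\phi_1:R_{(-3d_1+a_1,\,3d_2-a_2-2)}\to R_{(-2d_1+a_1,\,2d_2-a_2-2)}^3,\qquad \phi_2:R_{(3d_1-a_1-2,\,-3d_2+a_2)}\to R_{(2d_1-a_1-2,\,-2d_2+a_2)}^3 .$$ $\phi_1$ sends $h$ to $(f_0\cdot h,f_1\cdot h,f_2\cdot h)$ (up to signs of the components), where $f\cdot h$ is the $\mathbb K$-bilinear operation given on monomials by $(s^\alpha t^\beta u^\gamma v^\epsilon)\cdot(s^it^ju^kv^l)=s^{i+\alpha}t^{j+\beta}u^{k-\gamma}v^{l-\epsilon}$, read as $0$ if an exponent is negative (multiplication in $s,t$, contraction in $u,v$). $\phi_2$ is defined in the same way with contraction in $s,t$ and multiplication in $u,v$. These are the components of the map induced by the Koszul differential on $H^2_B$ in bidegree $\mathbf a$. Generic: $\mathbf f$ is generic if $\sqrt{I_W}=B$ and $\phi_1,\phi_2$ have full (maximal) rank for every $\mathbf a\in\mathbb Z_{\ge0}^2$. $n_{\mathbf d}(\mathbf a)=(\mathrm{dom}_{\mathbf d}(\mathbf a)-3\,\mathrm{cod}_{\mathbf d}(\mathbf a))_+$, where $\mathrm{dom}_{\mathbf d}(\mathbf a)=(-3d_1+a_1+1)_+(3d_2-a_2-1)_++(3d_1-a_1-1)_+(-3d_2+a_2+1)_+$ and $\mathrm{cod}_{\mathbf d}(\mathbf a)=(-2d_1+a_1+1)_+(2d_2-a_2-1)_++(2d_1-a_1-1)_+(-2d_2+a_2+1)_+$. 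*)

theory Defs
  imports Complex_Main "HOL-Library.Poly_Mapping" "HOL-Library.Product_Plus" "HOL-Library.FuncSet"
begin

section \<open>Linear algebra\<close>

text \<open>A basis of the quotient space \<open>V / W\<close>, given by representatives in \<open>V\<close>.\<close>

definition quotient_basis ::
    "('k::field \<Rightarrow> 'v::ab_group_add \<Rightarrow> 'v) \<Rightarrow> 'v set \<Rightarrow> 'v set \<Rightarrow> 'v set \<Rightarrow> bool" where
  "quotient_basis scale V W B \<longleftrightarrow> finite B \<and> B \<subseteq> V \<and>
     (\<forall>v\<in>V. \<exists>c. v - (\<Sum>b\<in>B. scale (c b) b) \<in> W) \<and>
     (\<forall>c. (\<Sum>b\<in>B. scale (c b) b) \<in> W \<longrightarrow> (\<forall>b\<in>B. c b = 0))"

text \<open>The dimension of \<open>V / W\<close>; only meaningful for subspaces \<open>W \<subseteq> V\<close> with \<open>V / W\<close> of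
  finite dimension.\<close>

definition quotient_dim ::
    "('k::field \<Rightarrow> 'v::ab_group_add \<Rightarrow> 'v) \<Rightarrow> 'v set \<Rightarrow> 'v set \<Rightarrow> nat" where
  "quotient_dim scale V W = (THE n. \<exists>B. quotient_basis scale V W B \<and> card B = n)"

lemma quotient_dim_eq:
  fixes scale :: "'k::field \<Rightarrow> 'v::ab_group_add \<Rightarrow> 'v"
  assumes "vector_space scale" and "module.subspace scale V"
    and W: "module.subspace scale W" "W \<subseteq> V"
    and fin: "finite F" "V \<subseteq> module.span scale F"
  shows "quotient_dim scale V W = vector_space.dim scale V - vector_space.dim scale W"
proof -
  interpret vector_space scale by fact
  have card: "card B = dim V - dim W" if B: "quotient_basis scale V W B" for B
  proof -
    obtain C where C: "C \<subseteq> W" "independent C" "W \<subseteq> span C" "card C = dim W" using basis_exists by blast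
    have "finite C" using C fin W by (meson independent_span_bound order_trans)
    have fB: "finite B" and BV: "B \<subseteq> V" 
      and sp: "\<And>v. v \<in> V \<Longrightarrow> \<exists>c. v - (\<Sum>b\<in>B. scale (c b) b) \<in> W"
      and ind: "\<And>c. (\<Sum>b\<in>B. scale (c b) b) \<in> W \<Longrightarrow> (\<forall>b\<in>B. c b = 0)"
      using B unfolding quotient_basis_def by blast+
    have disj: "B \<inter> C = {}"
    proof (rule ccontr)
      assume "B \<inter> C \<noteq> {}"
      then obtain b where b: "b \<in> B" "b \<in> W" using C by blast
      have "(\<Sum>x\<in>B. scale (if x = b then 1 else 0) x) = b"
        using b fB by (simp add: if_distrib[where f="\<lambda>c. scale c _"] cong: if_cong)
      then show False using ind[of "\<lambda>x. if x = b then 1 else 0"] b by auto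
    qed
    have indep: "independent (B \<union> C)"
    proof (rule independent_if_scalars_zero)
      show "finite (B \<union> C)" using fB \<open>finite C\<close> by simp
      fix f x assume s: "(\<Sum>x\<in>B \<union> C. scale (f x) x) = 0" and x: "x \<in> B \<union> C"
      have s': "(\<Sum>x\<in>B. scale (f x) x) + (\<Sum>x\<in>C. scale (f x) x) = 0"
        using s disj fB \<open>finite C\<close> by (simp add: sum.union_disjoint)
      have w: "(\<Sum>x\<in>C. scale (f x) x) \<in> W" using C W by (intro subspace_sum subspace_scale) auto
      have "(\<Sum>x\<in>B. scale (f x) x) = - (\<Sum>x\<in>C. scale (f x) x)" using s' by (simp add: eq_neg_iff_add_eq_0)
      then have z: "\<forall>b\<in>B. f b = 0" using ind w W subspace_neg by metis
      then have "(\<Sum>x\<in>C. scale (f x) x) = 0" using s' by simp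
      then have "\<forall>b\<in>C. f b = 0" using C(2) \<open>finite C\<close> independentD[OF C(2) _ subset_refl] by blast
      then show "f x = 0" using z x by auto
    qed
    have "V \<subseteq> span (B \<union> C)"
    proof
      fix v assume "v \<in> V"
      then obtain c where "v - (\<Sum>b\<in>B. scale (c b) b) \<in> W" using sp by blast
      then have 1: "v - (\<Sum>b\<in>B. scale (c b) b) \<in> span (B \<union> C)" using C span_mono[of C "B \<union> C"] by blast
      have 2: "(\<Sum>b\<in>B. scale (c b) b) \<in> span (B \<union> C)" by (intro span_sum span_scale span_base) auto
      show "v \<in> span (B \<union> C)" using span_add[OF 1 2] by simp
    qed
    then have "card (B \<union> C) = dim V" using indep BV C W by (intro basis_card_eq_dim) auto
    then show ?thesis using C disj fB \<open>finite C\<close> by (simp add: card_Un_disjoint)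
  qed
  have ex: "\<exists>B. quotient_basis scale V W B"
  proof -
    obtain C where C: "C \<subseteq> W" "independent C" "W \<subseteq> span C" "card C = dim W" using basis_exists by blast
    obtain D where D: "C \<subseteq> D" "D \<subseteq> V" "independent D" "V \<subseteq> span D"
      using maximal_independent_subset_extend[of C V] C W by blast
    have fD: "finite D" using D fin by (meson independent_span_bound order_trans)
    have WC: "W = span C" using C W by (simp add: span_minimal subset_antisym)
    have "quotient_basis scale V W (D - C)" unfolding quotient_basis_def
    proof (intro conjI ballI allI impI)
      show "finite (D - C)" "D - C \<subseteq> V" using fD D by auto
    next
      fix v assume "v \<in> V"
      then obtain c where c: "v = (\<Sum>x\<in>D. scale (c x) x)" using D fD span_finite by blast
      have "(\<Sum>x\<in>D. scale (c x) x) = (\<Sum>x\<in>D-C. scale (c x) x) + (\<Sum>x\<in>C. scale (c x) x)"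
        using sum.subset_diff[OF D(1) fD] by auto
      then have "v - (\<Sum>x\<in>D-C. scale (c x) x) = (\<Sum>x\<in>C. scale (c x) x)" using c by simp
      also have "\<dots> \<in> W" unfolding WC by (intro span_sum span_scale span_base)
      finally show "\<exists>c. v - (\<Sum>x\<in>D-C. scale (c x) x) \<in> W" by blast
    next
      fix c b assume s: "(\<Sum>b\<in>D - C. scale (c b) b) \<in> W" and b: "b \<in> D - C"
      have fC: "finite C" using D fD finite_subset by blast
      then obtain e where e: "(\<Sum>b\<in>D - C. scale (c b) b) = (\<Sum>x\<in>C. scale (e x) x)"
        using s unfolding WC using span_finite by blast
      define g where "g x = (if x \<in> C then - e x else c x)" for x
      have "(\<Sum>x\<in>D. scale (g x) x) = (\<Sum>x\<in>D-C. scale (g x) x) + (\<Sum>x\<in>C. scale (g x) x)"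
        using sum.subset_diff[OF D(1) fD] by auto
      also have "(\<Sum>x\<in>D-C. scale (g x) x) = (\<Sum>x\<in>D-C. scale (c x) x)" by (rule sum.cong) (auto simp: g_def)
      also have "(\<Sum>x\<in>C. scale (g x) x) = - (\<Sum>x\<in>C. scale (e x) x)" by (simp add: g_def sum_negf)
      finally have "(\<Sum>x\<in>D. scale (g x) x) = 0" using e by simp
      then have "g b = 0" using fD b independentD[OF D(3) fD subset_refl, of g b] by blast
      then show "c b = 0" using b by (simp add: g_def)
    qed
    then show ?thesis ..
  qed
  then show ?thesis unfolding quotient_dim_def using card by blast
qed

definition full_rank ::
    "('k::field \<Rightarrow> 'v::ab_group_add \<Rightarrow> 'v) \<Rightarrow> ('k \<Rightarrow> 'w::ab_group_add \<Rightarrow> 'w) \<Rightarrow>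
      'v set \<Rightarrow> 'w set \<Rightarrow> ('v \<Rightarrow> 'w) \<Rightarrow> bool" where
  "full_rank s1 s2 V W \<phi> \<longleftrightarrow>
     vector_space.dim s2 (\<phi> ` V) = min (vector_space.dim s1 V) (vector_space.dim s2 W)"

section \<open>The Zariski topology on the affine space of \<open>'k\<close>-points with coordinates indexed by \<open>J\<close>\<close>

definition affine_space :: "'i set \<Rightarrow> ('i \<Rightarrow> 'k) set" where
  "affine_space J = J \<rightarrow>\<^sub>E UNIV"

definition poly_value :: "('i \<Rightarrow> 'k::field) \<Rightarrow> (('i \<Rightarrow>\<^sub>0 nat) \<Rightarrow>\<^sub>0 'k) \<Rightarrow> 'k" where
  "poly_value x p = (\<Sum>m\<in>Poly_Mapping.keys p. Poly_Mapping.lookup p m * (\<Prod>i\<in>Poly_Mapping.keys m. x i ^ Poly_Mapping.lookup m i))"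

definition zariski_closed :: "'i set \<Rightarrow> ('i \<Rightarrow> 'k::field) set \<Rightarrow> bool" where
  "zariski_closed J Z \<longleftrightarrow>
     (\<exists>P. (\<forall>p\<in>P. \<forall>m\<in>Poly_Mapping.keys p. Poly_Mapping.keys m \<subseteq> J) \<and>
          Z = {x \<in> affine_space J. \<forall>p\<in>P. poly_value x p = 0})"

definition zariski_open :: "'i set \<Rightarrow> ('i \<Rightarrow> 'k::field) set \<Rightarrow> bool" where
  "zariski_open J U \<longleftrightarrow> U \<subseteq> affine_space J \<and> zariski_closed J (affine_space J - U)"

section \<open>The bigraded ring \<open>R\<close>\<close>

text \<open>The exponent \<open>(i, j, k, l)\<close> stands for the monomial \<open>s\<^sup>i t\<^sup>j u\<^sup>k v\<^sup>l\<close>.\<close>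

type_synonym expo = "nat \<times> nat \<times> nat \<times> nat"
type_synonym 'k bipoly = "expo \<Rightarrow>\<^sub>0 'k"
type_synonym 'k triple = "'k bipoly \<times> 'k bipoly \<times> 'k bipoly"

definition var_s :: "'k::field bipoly" where "var_s = Poly_Mapping.single (1, 0, 0, 0) 1"
definition var_t :: "'k::field bipoly" where "var_t = Poly_Mapping.single (0, 1, 0, 0) 1"
definition var_u :: "'k::field bipoly" where "var_u = Poly_Mapping.single (0, 0, 1, 0) 1"
definition var_v :: "'k::field bipoly" where "var_v = Poly_Mapping.single (0, 0, 0, 1) 1"

definition scl :: "'k::field \<Rightarrow> 'k bipoly \<Rightarrow> 'k bipoly" where
  "scl c p = Poly_Mapping.single 0 c * p"

fun scl3 :: "'k::field \<Rightarrow> 'k triple \<Rightarrow> 'k triple" where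
  "scl3 c (x, y, z) = (scl c x, scl c y, scl c z)"

lemma vector_space_scl: "vector_space (scl :: 'k::field \<Rightarrow> _)"
  by unfold_locales
     (simp_all add: scl_def algebra_simps single_add mult_single flip: mult.assoc)

lemma vector_space_scl3: "vector_space (scl3 :: 'k::field \<Rightarrow> _)"
proof -
  interpret vector_space "scl :: 'k \<Rightarrow> _" by (rule vector_space_scl)
  show ?thesis
    by unfold_locales (auto simp: scale_right_distrib scale_left_distrib)
qed

fun bideg :: "expo \<Rightarrow> int \<times> int" where
  "bideg (i, j, k, l) = (int (i + j), int (k + l))"

text \<open>Bidegrees are integral; \<open>R\<^sub>(\<^sub>p\<^sub>,\<^sub>q\<^sub>)\<close> is zero if \<open>p\<close> or \<open>q\<close> is negative.\<close>

definition Rdeg :: "int \<Rightarrow> int \<Rightarrow> 'k::field bipoly set" where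
  "Rdeg p q = {g. \<forall>m\<in>Poly_Mapping.keys g. bideg m = (p, q)}"

definition Rdeg3 :: "int \<Rightarrow> int \<Rightarrow> 'k::field triple set" where
  "Rdeg3 p q = Rdeg p q \<times> Rdeg p q \<times> Rdeg p q"

definition gen_ideal :: "'r::comm_ring_1 set \<Rightarrow> 'r set" where
  "gen_ideal = module.span (*)"

definition radical :: "'r::comm_ring_1 set \<Rightarrow> 'r set" where
  "radical I = {p. \<exists>n. p ^ n \<in> I}"

definition irrelevant_ideal :: "'k::field bipoly set" where
  "irrelevant_ideal = gen_ideal {var_s, var_t} \<inter> gen_ideal {var_u, var_v}"

fun I_W :: "'k::field triple \<Rightarrow> 'k bipoly set" where
  "I_W (f0, f1, f2) = gen_ideal {f0, f1, f2}"

text \<open>The dimension of \<open>(R / I\<^sub>W)\<^sub>a\<close> (for a homogeneous ideal \<open>I\<^sub>W\<close>).\<close>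

definition dim_RI :: "'k::field triple \<Rightarrow> int \<Rightarrow> int \<Rightarrow> nat" where
  "dim_RI f a1 a2 = quotient_dim scl (Rdeg a1 a2) (Rdeg a1 a2 \<inter> I_W f)"

section \<open>Koszul homology\<close>

text \<open>\<open>koszul1 f\<close> sends the basis vector \<open>e\<^sub>i\<close> to \<open>f\<^sub>i\<close>, and \<open>koszul2 f\<close> sends
  \<open>e\<^sub>i \<and> e\<^sub>j\<close> to \<open>f\<^sub>i e\<^sub>j - f\<^sub>j e\<^sub>i\<close>, with respect to the basis
  \<open>e\<^sub>0 \<and> e\<^sub>1, e\<^sub>0 \<and> e\<^sub>2, e\<^sub>1 \<and> e\<^sub>2\<close>.\<close>

fun koszul1 :: "'k::field triple \<Rightarrow> 'k triple \<Rightarrow> 'k bipoly" where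
  "koszul1 (f0, f1, f2) (g0, g1, g2) = f0 * g0 + f1 * g1 + f2 * g2"

fun koszul2 :: "'k::field triple \<Rightarrow> 'k triple \<Rightarrow> 'k triple" where
  "koszul2 (f0, f1, f2) (h01, h02, h12) =
     (- (f1 * h01) - f2 * h02, f0 * h01 - f2 * h12, f0 * h02 + f1 * h12)"

definition dim_H1 :: "int \<Rightarrow> int \<Rightarrow> 'k::field triple \<Rightarrow> int \<Rightarrow> int \<Rightarrow> nat" where
  "dim_H1 d1 d2 f a1 a2 = quotient_dim scl3
     {g \<in> Rdeg3 (a1 - d1) (a2 - d2). koszul1 f g = 0}
     (koszul2 f ` Rdeg3 (a1 - 2 * d1) (a2 - 2 * d2))"

section \<open>The maps \<open>\<phi>\<^sub>1\<close> and \<open>\<phi>\<^sub>2\<close>, and genericity\<close>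

text \<open>Multiplication in \<open>s, t\<close> and contraction in \<open>u, v\<close>, and vice versa: first a term with
  coefficient \<open>c\<close>, then the bilinear extension.\<close>

fun contract_uv_term :: "expo \<Rightarrow> expo \<Rightarrow> 'k::field \<Rightarrow> 'k bipoly" where
  "contract_uv_term (\<alpha>, \<beta>, \<gamma>, \<epsilon>) (i, j, k, l) c =
     (if \<gamma> \<le> k \<and> \<epsilon> \<le> l then Poly_Mapping.single (i + \<alpha>, j + \<beta>, k - \<gamma>, l - \<epsilon>) c else 0)"

fun contract_st_term :: "expo \<Rightarrow> expo \<Rightarrow> 'k::field \<Rightarrow> 'k bipoly" where
  "contract_st_term (\<alpha>, \<beta>, \<gamma>, \<epsilon>) (i, j, k, l) c =
     (if \<alpha> \<le> i \<and> \<beta> \<le> j then Poly_Mapping.single (i - \<alpha>, j - \<beta>, k + \<gamma>, l + \<epsilon>) c else 0)"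

definition contract_uv :: "'k::field bipoly \<Rightarrow> 'k bipoly \<Rightarrow> 'k bipoly" where
  "contract_uv f h =
     (\<Sum>m\<in>Poly_Mapping.keys f. \<Sum>n\<in>Poly_Mapping.keys h. contract_uv_term m n (Poly_Mapping.lookup f m * Poly_Mapping.lookup h n))"

definition contract_st :: "'k::field bipoly \<Rightarrow> 'k bipoly \<Rightarrow> 'k bipoly" where
  "contract_st f h =
     (\<Sum>m\<in>Poly_Mapping.keys f. \<Sum>n\<in>Poly_Mapping.keys h. contract_st_term m n (Poly_Mapping.lookup f m * Poly_Mapping.lookup h n))"

text \<open>The components of these maps are only determined up to sign, which does not affect
  the rank; all signs are taken positive.\<close>

fun phi1 :: "'k::field triple \<Rightarrow> 'k bipoly \<Rightarrow> 'k triple" where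
  "phi1 (f0, f1, f2) h = (contract_uv f0 h, contract_uv f1 h, contract_uv f2 h)"

fun phi2 :: "'k::field triple \<Rightarrow> 'k bipoly \<Rightarrow> 'k triple" where
  "phi2 (f0, f1, f2) h = (contract_st f0 h, contract_st f1 h, contract_st f2 h)"

definition generic :: "int \<Rightarrow> int \<Rightarrow> 'k::field triple \<Rightarrow> bool" where
  "generic d1 d2 f \<longleftrightarrow>
     radical (I_W f) = irrelevant_ideal \<and>
     (\<forall>a1\<ge>0. \<forall>a2\<ge>0.
        full_rank scl scl3
          (Rdeg (- 3 * d1 + a1) (3 * d2 - a2 - 2)) (Rdeg3 (- 2 * d1 + a1) (2 * d2 - a2 - 2))
          (phi1 f) \<and>
        full_rank scl scl3
          (Rdeg (3 * d1 - a1 - 2) (- 3 * d2 + a2)) (Rdeg3 (2 * d1 - a1 - 2) (- 2 * d2 + a2))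
          (phi2 f))"

section \<open>Numerical functions\<close>

definition pos_part :: "int \<Rightarrow> int" where
  "pos_part c = max c 0"

definition dom_d :: "int \<Rightarrow> int \<Rightarrow> int \<Rightarrow> int \<Rightarrow> int" where
  "dom_d d1 d2 a1 a2 =
     pos_part (- 3 * d1 + a1 + 1) * pos_part (3 * d2 - a2 - 1) +
     pos_part (3 * d1 - a1 - 1) * pos_part (- 3 * d2 + a2 + 1)"

definition cod_d :: "int \<Rightarrow> int \<Rightarrow> int \<Rightarrow> int \<Rightarrow> int" where
  "cod_d d1 d2 a1 a2 =
     pos_part (- 2 * d1 + a1 + 1) * pos_part (2 * d2 - a2 - 1) +
     pos_part (2 * d1 - a1 - 1) * pos_part (- 2 * d2 + a2 + 1)"

definition n_d :: "int \<Rightarrow> int \<Rightarrow> int \<Rightarrow> int \<Rightarrow> int" where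
  "n_d d1 d2 a1 a2 = pos_part (dom_d d1 d2 a1 a2 - 3 * cod_d d1 d2 a1 a2)"

definition euler_char :: "'k::field itself \<Rightarrow> int \<Rightarrow> int \<Rightarrow> int \<Rightarrow> int \<Rightarrow> int" where
  "euler_char _ d1 d2 a1 a2 =
     (let dimR = (\<lambda>p q. int (vector_space.dim scl (Rdeg p q :: 'k bipoly set)))
      in dimR a1 a2 - 3 * dimR (a1 - d1) (a2 - d2)
         + 3 * dimR (a1 - 2 * d1) (a2 - 2 * d2) - dimR (a1 - 3 * d1) (a2 - 3 * d2))"

section \<open>The space of coefficients of triples of bidegree \<open>d\<close>\<close>

text \<open>The coordinate \<open>(r, m)\<close> is the coefficient of the monomial \<open>m\<close> in \<open>f\<^sub>r\<close>.\<close>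

definition coeff_index :: "int \<Rightarrow> int \<Rightarrow> (nat \<times> expo) set" where
  "coeff_index d1 d2 = {0, 1, 2} \<times> {m. bideg m = (d1, d2)}"

definition triple_of :: "int \<Rightarrow> int \<Rightarrow> (nat \<times> expo \<Rightarrow> 'k::field) \<Rightarrow> 'k triple" where
  "triple_of d1 d2 x =
     (let f = (\<lambda>r. \<Sum>m | bideg m = (d1, d2). Poly_Mapping.single m (x (r, m)))
      in (f 0, f 1, f 2))"

end

theory Submission
  imports Defs
begin

text \<open>
  Both assertions hold for a triple \<open>f\<close> of bidegree \<open>d\<close> under the same condition on \<open>f\<close>, so that the same
  open set serves for both.  What has to be shown is that \<open>f\<close> is generic if and only if
  \<open>dim (R/I\<^sub>W)\<^sub>a = \<chi>(a)\<^sub>+\<close> for all \<open>a \<ge> 0\<close> (\<open>generic_iff\<close>).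

  The heart is the case \<open>\<surd>I\<^sub>W = B\<close>.  Then \<open>H\<^sub>2 = H\<^sub>3 = 0\<close>, and \<open>(H\<^sub>1)\<^sub>a\<close> is the direct sum of the kernels of \<open>\<phi>\<^sub>1\<close>
  and \<open>\<phi>\<^sub>2\<close>.  Usually this is read off from the two spectral sequences that compare Koszul homology with
  local cohomology.  Here it is done by an explicit Cech argument inside the ring of Laurent
  polynomials.  Some power of each of \<open>su\<close>, \<open>sv\<close>, \<open>tu\<close>, \<open>tv\<close> lies in \<open>I\<^sub>W\<close>, so in the four localizations of \<open>R\<close> at these
  monomials the unit is a combination of \<open>f\<^sub>0\<close>, \<open>f\<^sub>1\<close>, \<open>f\<^sub>2\<close> with homogeneous coefficients, and contraction with the
  coefficients is a null-homotopy of the Koszul complex there (\<open>bezout_cover_of_radical\<close>, \<open>kos2_ctr2\<close>,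
  \<open>kos3_ctr3\<close>).  A cycle over \<open>R\<close> therefore has a primitive over each localization.  Any two primitives
  differ by the image of a Laurent polynomial, and comparing exponents monomial by monomial shows that
  the obstruction to gluing them is supported on monomials with \<open>s, t\<close>-exponents nonnegative and
  \<open>u, v\<close>-exponents negative, or the other way round.  These monomials form the standard bases of the two
  summands of \<open>H\<^sup>2\<^sub>B(R)\<close>, on which multiplication by \<open>f\<close> is dual to contraction, that is, given by \<open>\<phi>\<^sub>1\<close> and \<open>\<phi>\<^sub>2\<close>
  (\<open>conn_generate\<close>, \<open>conn_independent\<close>, \<open>push_contract_uv\<close>).

  Counting dimensions along the Koszul complex gives \<open>dim (R/I\<^sub>W)\<^sub>a = \<chi>(a) + dim (H\<^sub>1)\<^sub>a\<close> (\<open>koszul_dims\<close>).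
  The rest is numerical: for \<open>a \<ge> 0\<close> the number \<open>n\<^sub>d(a)\<close> is the negative part of \<open>\<chi>(a)\<close>
  (\<open>n_d_eq_neg_chi\<close>), and in each bidegree at most one of \<open>\<phi>\<^sub>1\<close>, \<open>\<phi>\<^sub>2\<close> has a nonzero domain, so the sum of the two
  nullities determines both ranks.  In the direction from dimensions to genericity, \<open>\<surd>I\<^sub>W = B\<close> holds because \<open>\<chi>\<close>
  vanishes in large bidegrees (\<open>radical_eq_irrelevant\<close>).
\<close>

section \<open>Dimensions of finitely spanned subspaces\<close>

definition fin_subspace ::
    "('k::field \<Rightarrow> 'v::ab_group_add \<Rightarrow> 'v) \<Rightarrow> 'v set \<Rightarrow> bool" where
  "fin_subspace s V \<longleftrightarrow> module.subspace s V \<and> (\<exists>F. finite F \<and> V \<subseteq> module.span s F)"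

definition prod_scale :: "('k \<Rightarrow> 'v \<Rightarrow> 'v) \<Rightarrow> ('k \<Rightarrow> 'w \<Rightarrow> 'w) \<Rightarrow> 'k \<Rightarrow> 'v \<times> 'w \<Rightarrow> 'v \<times> 'w" where
  "prod_scale s1 s2 c = map_prod (s1 c) (s2 c)"

lemma vector_space_prod_scale:
  assumes "vector_space s1" "vector_space s2"
  shows "vector_space (prod_scale s1 s2)"
proof -
  interpret a: vector_space s1 by fact
  interpret b: vector_space s2 by fact
  show ?thesis
    by unfold_locales
      (auto simp: prod_scale_def a.scale_right_distrib a.scale_left_distrib
        b.scale_right_distrib b.scale_left_distrib)
qed

lemma linear_of_add_scale:
  assumes "vector_space s1" "vector_space s2"
    and "\<And>x y. f (x + y) = f x + f y" and "\<And>c x. f (s1 c x) = s2 c (f x)"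
  shows "Vector_Spaces.linear s1 s2 f"
  using assms unfolding Vector_Spaces.linear_iff by blast

lemma fin_subspace_subset:
  assumes "vector_space s" "fin_subspace s V" "module.subspace s W" "W \<subseteq> V"
  shows "fin_subspace s W"
  using assms unfolding fin_subspace_def by blast

text \<open>The ambient spaces of polynomials are infinite-dimensional, so finite spanning is required of \<open>V\<close>
  only.  A basis \<open>C\<close> of the kernel is extended to a basis \<open>D\<close> of \<open>V\<close>; then \<open>f\<close> is injective on the span of
  \<open>D - C\<close> and maps \<open>D - C\<close> to a basis of the image.\<close>

lemma rank_nullity:
  assumes lin: "Vector_Spaces.linear s1 s2 f" and V: "fin_subspace s1 V"
  shows "fin_subspace s1 {v \<in> V. f v = 0}" and "fin_subspace s2 (f ` V)"
    and "vector_space.dim s1 V = vector_space.dim s1 {v \<in> V. f v = 0} + vector_space.dim s2 (f ` V)"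
proof -
  interpret Vector_Spaces.linear s1 s2 f by fact
  let ?N = "{v \<in> V. f v = 0}"
  have subV: "vs1.subspace V" and fin: "\<exists>F. finite F \<and> V \<subseteq> vs1.span F"
    using V unfolding fin_subspace_def by auto
  have subN: "vs1.subspace ?N"
    using subV by (auto simp: vs1.subspace_def add scale)
  show "fin_subspace s1 ?N" using fin subN unfolding fin_subspace_def by blast
  obtain F where F: "finite F" "V \<subseteq> vs1.span F" using fin by blast
  have "f ` V \<subseteq> vs2.span (f ` F)" using F(2) by (metis image_mono span_image)
  then show "fin_subspace s2 (f ` V)"
    using F(1) subspace_image[OF subV] unfolding fin_subspace_def by blast
  obtain C where C: "C \<subseteq> ?N" "vs1.independent C" "?N \<subseteq> vs1.span C" "card C = vs1.dim ?N"
    using vs1.basis_exists by blast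
  obtain D where D: "C \<subseteq> D" "D \<subseteq> V" "vs1.independent D" "V \<subseteq> vs1.span D"
    using vs1.maximal_independent_subset_extend[of C V] C by blast
  have fD: "finite D" using D F by (meson vs1.independent_span_bound order_trans)
  have fC: "finite C" using fD D(1) finite_subset by blast
  have indDC: "vs1.independent (D - C)" using D(3) vs1.independent_mono by blast
  have inj: "inj_on f (vs1.span (D - C))"
    unfolding inj_on_iff_eq_0[OF vs1.subspace_span]
  proof (intro ballI impI)
      fix x assume x: "x \<in> vs1.span (D - C)" and fx: "f x = 0"
      have "vs1.span (D - C) \<subseteq> V" using D(2) subV vs1.span_minimal by blast
      then have "x \<in> vs1.span C" using x fx C(3) by blast
      then obtain e where e: "x = (\<Sum>a\<in>C. s1 (e a) a)" using vs1.span_finite[OF fC] by auto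
      obtain c where c: "x = (\<Sum>a\<in>D-C. s1 (c a) a)"
        using x vs1.span_finite[of "D - C"] fD by auto
      define g where "g a = (if a \<in> C then - e a else c a)" for a
      have "(\<Sum>a\<in>D. s1 (g a) a) = (\<Sum>a\<in>D-C. s1 (g a) a) + (\<Sum>a\<in>C. s1 (g a) a)"
        using sum.subset_diff[OF D(1) fD] by auto
      also have "(\<Sum>a\<in>D-C. s1 (g a) a) = x" unfolding c by (rule sum.cong) (auto simp: g_def)
      also have "(\<Sum>a\<in>C. s1 (g a) a) = - x" unfolding e by (simp add: g_def sum_negf)
      finally have "(\<Sum>a\<in>D. s1 (g a) a) = 0" by simp
      then have g0: "g a = 0" if "a \<in> D" for a
        using fD vs1.independentD[OF D(3) fD subset_refl, of g a] that by blast
      have "(\<Sum>a\<in>D-C. s1 (c a) a) = 0"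
      proof (intro sum.neutral ballI)
        fix a assume "a \<in> D - C"
        then have "c a = 0" using g0[of a] by (simp add: g_def)
        then show "s1 (c a) a = 0" by simp
      qed
      then show "x = 0" using c by simp
  qed
  have ind: "vs2.independent (f ` (D - C))"
    using independent_injective_image[OF indDC inj] .
  have "f ` V \<subseteq> vs2.span (f ` (D - C))"
  proof
    fix y assume "y \<in> f ` V"
    then have "y \<in> f ` vs1.span D" using D(4) by blast
    then have "y \<in> vs2.span (f ` D)" by (simp add: span_image)
    moreover have "f ` D \<subseteq> insert 0 (f ` (D - C))" using C(1) by auto
    ultimately show "y \<in> vs2.span (f ` (D - C))" using vs2.span_mono vs2.span_insert_0 by blast
  qed
  then have "vs2.dim (f ` V) = card (f ` (D - C))"
    using ind D(2) vs2.basis_card_eq_dim[of "f ` (D - C)" "f ` V"] by (metis Diff_subset image_mono order_trans)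
  also have "\<dots> = card (D - C)"
    by (rule card_image[OF inj_on_subset[OF inj vs1.span_superset]])
  also have "\<dots> = card D - card C" using fC D(1) by (simp add: card_Diff_subset)
  finally have "vs2.dim (f ` V) = card D - card C" .
  moreover have "card D = vs1.dim V" using D vs1.basis_card_eq_dim by blast
  moreover have "card C \<le> card D" using D(1) fD by (rule card_mono[rotated])
  ultimately show "vs1.dim V = vs1.dim ?N + vs2.dim (f ` V)" using C(4) by simp
qed

lemma dim_zero_space: "vector_space s \<Longrightarrow> vector_space.dim s {0} = 0"
proof -
  assume "vector_space s"
  then interpret vector_space s .
  show "dim {0} = 0" using dim_span_eq_card_independent[of "{}"] independent_empty by simp
qed

lemma dim_inj_image:
  assumes lin: "Vector_Spaces.linear s1 s2 f" and V: "fin_subspace s1 V"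
    and inj: "\<And>v. v \<in> V \<Longrightarrow> f v = 0 \<Longrightarrow> v = 0"
  shows "vector_space.dim s2 (f ` V) = vector_space.dim s1 V"
proof -
  interpret Vector_Spaces.linear s1 s2 f by fact
  have "{v \<in> V. f v = 0} = {0}"
    using inj V vs1.subspace_0 by (auto simp: fin_subspace_def)
  then show ?thesis using rank_nullity(3)[OF lin V] dim_zero_space[OF vs1.vector_space_axioms] by simp
qed

text \<open>Rank-nullity for the first projection, whose kernel is a copy of \<open>W\<close>.\<close>

lemma fin_subspace_prod:
  assumes vs: "vector_space s1" "vector_space s2"
    and V: "fin_subspace s1 V" and W: "fin_subspace s2 W"
  shows "fin_subspace (prod_scale s1 s2) (V \<times> W)"
    and "vector_space.dim (prod_scale s1 s2) (V \<times> W) = vector_space.dim s1 V + vector_space.dim s2 W"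
proof -
  interpret a: vector_space s1 by fact
  interpret b: vector_space s2 by fact
  interpret p: vector_space "prod_scale s1 s2" using vs by (rule vector_space_prod_scale)
  interpret i1: Vector_Spaces.linear s1 "prod_scale s1 s2" "\<lambda>x. (x, 0)"
    by (rule linear_of_add_scale) (auto simp: prod_scale_def vs p.vector_space_axioms)
  interpret i2: Vector_Spaces.linear s2 "prod_scale s1 s2" "\<lambda>x. (0, x)"
    by (rule linear_of_add_scale) (auto simp: prod_scale_def vs p.vector_space_axioms)
  have linf: "Vector_Spaces.linear (prod_scale s1 s2) s1 fst"
    by (rule linear_of_add_scale) (auto simp: prod_scale_def vs p.vector_space_axioms)
  have V0: "a.subspace V" and W0: "b.subspace W" using V W by (auto simp: fin_subspace_def)
  obtain F where F: "finite F" "V \<subseteq> a.span F" using V by (auto simp: fin_subspace_def)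
  obtain G where G: "finite G" "W \<subseteq> b.span G" using W by (auto simp: fin_subspace_def)
  let ?H = "(\<lambda>x. (x, 0)) ` F \<union> (\<lambda>x. (0, x)) ` G"
  have "(x, y) \<in> p.span ?H" if "x \<in> V" "y \<in> W" for x y
  proof -
    have "(x, 0) \<in> p.span ((\<lambda>x. (x, 0)) ` F)" "(0, y) \<in> p.span ((\<lambda>x. (0, x)) ` G)"
      unfolding i1.span_image i2.span_image using that F G by blast+
    then have "(x, 0) \<in> p.span ?H" "(0, y) \<in> p.span ?H"
      by (meson in_mono p.span_mono sup_ge1 sup_ge2)+
    from p.span_add[OF this] show ?thesis by simp
  qed
  then have "V \<times> W \<subseteq> p.span ?H" by auto
  moreover have "p.subspace (V \<times> W)"
  proof (rule p.subspaceI)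
    have "(0, 0) \<in> V \<times> W" using a.subspace_0[OF V0] b.subspace_0[OF W0] by blast
    then show "0 \<in> V \<times> W" by (simp only: zero_prod_def)
    show "x + y \<in> V \<times> W" if "x \<in> V \<times> W" "y \<in> V \<times> W" for x y
    proof -
      obtain x1 x2 y1 y2 where xy: "x = (x1, x2)" "y = (y1, y2)" by (meson surj_pair)
      then show ?thesis
        using that a.subspace_add[OF V0, of x1 y1] b.subspace_add[OF W0, of x2 y2] by (simp only: xy add_Pair) blast
    qed
    show "prod_scale s1 s2 c x \<in> V \<times> W" if "x \<in> V \<times> W" for c x
    proof -
      obtain x1 x2 where x: "x = (x1, x2)" by (meson surj_pair)
      then show ?thesis
        using that a.subspace_scale[OF V0, of x1 c] b.subspace_scale[OF W0, of x2 c]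
        by (simp only: x prod_scale_def map_prod_simp) blast
    qed
  qed
  moreover have "finite ?H" using F(1) G(1) by simp
  ultimately show fp: "fin_subspace (prod_scale s1 s2) (V \<times> W)"
    unfolding fin_subspace_def by blast
  have "{v \<in> V \<times> W. fst v = 0} = (\<lambda>x. (0, x)) ` W"
    using a.subspace_0[OF V0] by auto
  moreover have "p.dim ((\<lambda>x. (0, x)) ` W) = b.dim W"
    by (rule dim_inj_image[OF i2.linear_axioms W]) (metis snd_conv snd_zero)
  moreover have "fst ` (V \<times> W) = V" using b.subspace_0[OF W0] by force
  ultimately show "p.dim (V \<times> W) = a.dim V + b.dim W" using rank_nullity(3)[OF linf fp] by simp
qed

lemma subspace_eq_of_dim_eq:
  assumes vs: "vector_space s" and V: "fin_subspace s V" and W: "module.subspace s W" "W \<subseteq> V"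
    and dim: "vector_space.dim s W = vector_space.dim s V"
  shows "W = V"
proof -
  interpret vector_space s by fact
  obtain F where F: "finite F" "V \<subseteq> span F" using V by (auto simp: fin_subspace_def)
  obtain C where C: "C \<subseteq> W" "independent C" "W \<subseteq> span C" "card C = dim W" using basis_exists by blast
  obtain D where D: "C \<subseteq> D" "D \<subseteq> V" "independent D" "V \<subseteq> span D"
    using maximal_independent_subset_extend[of C V] C W by blast
  have "finite D" using D F by (meson independent_span_bound order_trans)
  moreover have "card D = dim V" using D basis_card_eq_dim by blast
  ultimately have "C = D" using C(4) dim D(1) by (simp add: card_subset_eq)
  then have "V \<subseteq> span W" using D(4) C(1) span_mono by blast
  then show ?thesis using W span_eq_iff by blast
qed

lemma dim_mono_fin:
  assumes "vector_space s" "fin_subspace s V" "W \<subseteq> V" "module.subspace s W"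
  shows "vector_space.dim s W \<le> vector_space.dim s V"
proof -
  interpret vector_space s by fact
  obtain F where F: "finite F" "V \<subseteq> span F" using assms(2) by (auto simp: fin_subspace_def)
  obtain C where C: "C \<subseteq> W" "independent C" "W \<subseteq> span C" "card C = dim W" using basis_exists by blast
  obtain D where D: "C \<subseteq> D" "D \<subseteq> V" "independent D" "V \<subseteq> span D"
    using maximal_independent_subset_extend[of C V] C assms(3) by blast
  have "finite D" using D F by (meson independent_span_bound order_trans)
  then have "card C \<le> card D" using D(1) by (rule card_mono)
  moreover have "card D = dim V" using D basis_card_eq_dim by blast
  ultimately show ?thesis using C(4) by simp
qed

lemma quotient_dim_fin:
  assumes "vector_space s" "fin_subspace s V" "fin_subspace s W" "W \<subseteq> V"
  shows "quotient_dim s V W = vector_space.dim s V - vector_space.dim s W"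
  using assms quotient_dim_eq unfolding fin_subspace_def by blast

section \<open>Linear maps between spaces of finitely supported functions\<close>

definition pm_scale :: "'k::field \<Rightarrow> ('a::comm_monoid_add \<Rightarrow>\<^sub>0 'k) \<Rightarrow> ('a \<Rightarrow>\<^sub>0 'k)" where
  "pm_scale c p = Poly_Mapping.single 0 c * p"

lemma scl_eq_pm_scale: "scl = pm_scale"
  by (simp add: fun_eq_iff scl_def pm_scale_def)

lemma vector_space_pm_scale: "vector_space (pm_scale :: 'k::field \<Rightarrow> ('a::comm_monoid_add \<Rightarrow>\<^sub>0 'k) \<Rightarrow> _)"
  by unfold_locales
     (simp_all add: pm_scale_def algebra_simps single_add mult_single flip: mult.assoc)

lemma lookup_pm_scale: "Poly_Mapping.lookup (pm_scale c p) m = c * Poly_Mapping.lookup p m"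
  unfolding pm_scale_def mult_map_scale_conv_mult[symmetric]
  by (simp add: Poly_Mapping.map.rep_eq when_def)

text \<open>The maps between polynomial rings below, ring homomorphisms as well as mere linear maps, are
  given by their values on terms; \<open>\<phi> m c\<close> is the value on the term with exponent \<open>m\<close> and
  coefficient \<open>c\<close>.\<close>

definition lin_ext :: "('a \<Rightarrow> 'k::zero \<Rightarrow> 'b::comm_monoid_add) \<Rightarrow> ('a \<Rightarrow>\<^sub>0 'k) \<Rightarrow> 'b" where
  "lin_ext \<phi> p = (\<Sum>m\<in>Poly_Mapping.keys p. \<phi> m (Poly_Mapping.lookup p m))"

lemma lin_ext_superset:
  assumes "\<And>m. \<phi> m 0 = 0" "finite A" "Poly_Mapping.keys p \<subseteq> A"
  shows "lin_ext \<phi> p = (\<Sum>m\<in>A. \<phi> m (Poly_Mapping.lookup p m))"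
  unfolding lin_ext_def
  by (rule sum.mono_neutral_left) (use assms in \<open>auto simp: in_keys_iff\<close>)

lemma lin_ext_single: "(\<And>m. \<phi> m 0 = 0) \<Longrightarrow> lin_ext \<phi> (Poly_Mapping.single m c) = \<phi> m c"
  by (simp add: lin_ext_def)

lemma lin_ext_add:
  assumes "\<And>m. \<phi> m 0 = 0" "\<And>m c d. \<phi> m (c + d) = \<phi> m c + \<phi> m d"
  shows "lin_ext \<phi> (p + q) = lin_ext \<phi> p + lin_ext \<phi> q"
proof -
  let ?A = "Poly_Mapping.keys p \<union> Poly_Mapping.keys q"
  have "finite ?A" by simp
  then have "lin_ext \<phi> (p + q) = (\<Sum>m\<in>?A. \<phi> m (Poly_Mapping.lookup (p + q) m))"
    using assms(1) Poly_Mapping.keys_add by (intro lin_ext_superset)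
  also have "\<dots> = (\<Sum>m\<in>?A. \<phi> m (Poly_Mapping.lookup p m)) + (\<Sum>m\<in>?A. \<phi> m (Poly_Mapping.lookup q m))"
    by (simp add: lookup_add assms(2) sum.distrib)
  also have "\<dots> = lin_ext \<phi> p + lin_ext \<phi> q"
    using lin_ext_superset[of \<phi> ?A p] lin_ext_superset[of \<phi> ?A q] assms(1) by simp
  finally show ?thesis .
qed

lemma poly_mapping_eq_sum_single:
  "p = (\<Sum>m\<in>Poly_Mapping.keys p. Poly_Mapping.single m (Poly_Mapping.lookup p m))"
proof (rule poly_mapping_eqI)
  fix k
  have "(\<Sum>m\<in>Poly_Mapping.keys p. Poly_Mapping.lookup (Poly_Mapping.single m (Poly_Mapping.lookup p m)) k)
      = (\<Sum>m\<in>Poly_Mapping.keys p. if m = k then Poly_Mapping.lookup p m else 0)"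
    by (rule sum.cong) (auto simp: lookup_single when_def)
  also have "\<dots> = Poly_Mapping.lookup p k" by (simp add: in_keys_iff)
  finally show "Poly_Mapping.lookup p k =
      Poly_Mapping.lookup (\<Sum>m\<in>Poly_Mapping.keys p. Poly_Mapping.single m (Poly_Mapping.lookup p m)) k"
    by (simp add: lookup_sum)
qed

lemma poly_mapping_terms_induct [case_names single add]:
  fixes p :: "'a \<Rightarrow>\<^sub>0 'k::comm_monoid_add"
  assumes single: "\<And>m c. P (Poly_Mapping.single m c)"
    and add: "\<And>p q. P p \<Longrightarrow> P q \<Longrightarrow> P (p + q)"
  shows "P p"
proof -
  have "P (\<Sum>m\<in>A. Poly_Mapping.single m (Poly_Mapping.lookup p m))" if "finite A" for A
    using that
  proof induction
    case empty
    show ?case using single[of undefined 0] by simp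
  next
    case (insert m A)
    then show ?case by (simp add: single add)
  qed
  from this[OF finite_keys[of p]] show ?thesis using poly_mapping_eq_sum_single[of p] by simp
qed

lemma lin_ext_mult:
  fixes \<phi> :: "'a::monoid_add \<Rightarrow> 'k::semiring_0 \<Rightarrow> 'b::semiring_0"
  assumes "\<And>m. \<phi> m 0 = 0" "\<And>m c d. \<phi> m (c + d) = \<phi> m c + \<phi> m d"
    and "\<And>m n c d. \<phi> (m + n) (c * d) = \<phi> m c * \<phi> n d"
  shows "lin_ext \<phi> (p * q) = lin_ext \<phi> p * lin_ext \<phi> q"
proof (induction p rule: poly_mapping_terms_induct)
  case (single m c)
  show ?case
    by (induction q rule: poly_mapping_terms_induct)
      (simp_all add: mult_single lin_ext_single lin_ext_add distrib_left assms)
next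
  case (add p1 p2)
  then show ?case by (simp add: distrib_right lin_ext_add assms)
qed

definition push :: "('a \<Rightarrow> 'b) \<Rightarrow> ('a \<Rightarrow>\<^sub>0 'k::comm_monoid_add) \<Rightarrow> ('b \<Rightarrow>\<^sub>0 'k)" where
  "push \<iota> = lin_ext (\<lambda>m. Poly_Mapping.single (\<iota> m))"

lemma push_single [simp]: "push \<iota> (Poly_Mapping.single m c) = Poly_Mapping.single (\<iota> m) c"
  by (simp add: push_def lin_ext_single)

lemma push_add: "push \<iota> (p + q) = push \<iota> p + push \<iota> q"
  by (simp add: push_def lin_ext_add single_add)

lemma push_zero [simp]: "push \<iota> 0 = 0"
  by (simp add: push_def lin_ext_def)

lemma push_uminus: "push \<iota> (- p) = - push \<iota> (p :: _ \<Rightarrow>\<^sub>0 _::ab_group_add)"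
  by (metis add.right_inverse add_eq_0_iff push_add push_zero)

lemma push_mult:
  fixes p q :: "'a::monoid_add \<Rightarrow>\<^sub>0 'k::semiring_0" and \<iota> :: "'a \<Rightarrow> 'b::monoid_add"
  assumes "\<And>m n. \<iota> (m + n) = \<iota> m + \<iota> n"
  shows "push \<iota> (p * q) = push \<iota> p * push \<iota> q"
  unfolding push_def by (rule lin_ext_mult) (simp_all add: single_add mult_single assms)

lemma lookup_push:
  assumes "inj \<iota>"
  shows "Poly_Mapping.lookup (push \<iota> p) (\<iota> m) = Poly_Mapping.lookup p m"
  by (induction p rule: poly_mapping_terms_induct)
    (use assms in \<open>auto simp: push_add lookup_add lookup_single when_def inj_eq\<close>)

lemma lookup_push_notin:
  assumes "e \<notin> range \<iota>"
  shows "Poly_Mapping.lookup (push \<iota> p) e = 0"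
  by (induction p rule: poly_mapping_terms_induct)
    (use assms in \<open>auto simp: push_add lookup_add lookup_single when_def\<close>)

lemma keys_push: "inj \<iota> \<Longrightarrow> Poly_Mapping.keys (push \<iota> p) = \<iota> ` Poly_Mapping.keys p"
proof (intro set_eqI iffI)
  fix e assume inj: "inj \<iota>" and e: "e \<in> Poly_Mapping.keys (push \<iota> p)"
  then obtain m where "e = \<iota> m" using lookup_push_notin[of e \<iota> p] by (auto simp: in_keys_iff)
  then show "e \<in> \<iota> ` Poly_Mapping.keys p" using e lookup_push[OF inj, of p m] by (simp add: in_keys_iff)
next
  fix e assume "inj \<iota>" "e \<in> \<iota> ` Poly_Mapping.keys p"
  then show "e \<in> Poly_Mapping.keys (push \<iota> p)" by (auto simp: in_keys_iff lookup_push)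
qed

lemma push_eq_0_iff: "inj \<iota> \<Longrightarrow> push \<iota> (p :: _ \<Rightarrow>\<^sub>0 _::ab_group_add) = 0 \<longleftrightarrow> p = 0"
  using keys_push[of \<iota> p] keys_eq_empty[of "push \<iota> p"] keys_eq_empty[of p] by simp

lemma push_surj:
  assumes "inj \<iota>" "Poly_Mapping.keys w \<subseteq> range \<iota>"
  shows "\<exists>p. push \<iota> p = w"
proof
  let ?p = "\<Sum>e\<in>Poly_Mapping.keys w. Poly_Mapping.single (inv \<iota> e) (Poly_Mapping.lookup w e)"
  have sum: "push \<iota> (sum g A) = (\<Sum>x\<in>A. push \<iota> (g x))" for g :: "'b \<Rightarrow> _" and A
    by (induction A rule: infinite_finite_induct) (simp_all add: push_add)
  have "push \<iota> ?p = (\<Sum>e\<in>Poly_Mapping.keys w. Poly_Mapping.single (\<iota> (inv \<iota> e)) (Poly_Mapping.lookup w e))"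
    by (simp add: sum)
  also have "\<dots> = (\<Sum>e\<in>Poly_Mapping.keys w. Poly_Mapping.single e (Poly_Mapping.lookup w e))"
    using assms(2) by (intro sum.cong refl) (auto simp: f_inv_into_f subset_iff)
  finally show "push \<iota> ?p = w" using poly_mapping_eq_sum_single[of w] by simp
qed

lemma push_pm_scale: "push \<iota> (pm_scale c p) = pm_scale c (push \<iota> p)"
proof (induction p rule: poly_mapping_terms_induct)
  case (single m d) show ?case by (simp add: pm_scale_def mult_single)
next
  case (add p q) then show ?case by (simp add: pm_scale_def distrib_left push_add)
qed

lemma push_diff: "push \<iota> (p - q) = push \<iota> p - push \<iota> (q :: _ \<Rightarrow>\<^sub>0 _::ab_group_add)"
  using push_add[of \<iota> p "- q"] by (simp add: push_uminus)

lemma push_eq_iff: "inj \<iota> \<Longrightarrow> push \<iota> p = push \<iota> q \<longleftrightarrow> p = (q :: _ \<Rightarrow>\<^sub>0 _::ab_group_add)"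
  using push_eq_0_iff[of \<iota> "p - q"] by (simp add: push_diff)

lemma push_sum: "push \<iota> (sum g A) = (\<Sum>x\<in>A. push \<iota> (g x))"
  by (induction A rule: infinite_finite_induct) (simp_all add: push_add)

lemma linear_push: "Vector_Spaces.linear pm_scale pm_scale (push \<iota>)"
  by (intro linear_of_add_scale vector_space_pm_scale push_add push_pm_scale)

definition restr :: "'a set \<Rightarrow> ('a \<Rightarrow>\<^sub>0 'k::comm_monoid_add) \<Rightarrow> ('a \<Rightarrow>\<^sub>0 'k)" where
  "restr S = lin_ext (\<lambda>m c. if m \<in> S then Poly_Mapping.single m c else 0)"

lemma restr_add: "restr S (p + q) = restr S p + restr S q"
  by (simp add: restr_def lin_ext_add single_add)

lemma lookup_restr: "Poly_Mapping.lookup (restr S p) m = (if m \<in> S then Poly_Mapping.lookup p m else 0)"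
  by (induction p rule: poly_mapping_terms_induct)
    (auto simp: restr_add lookup_add, auto simp: restr_def lin_ext_single lookup_single when_def)

lemma keys_restr: "Poly_Mapping.keys (restr S p) = Poly_Mapping.keys p \<inter> S"
  by (auto simp: in_keys_iff lookup_restr split: if_splits)

lemma restr_pm_scale: "restr S (pm_scale c p) = pm_scale c (restr S p)"
  by (rule poly_mapping_eqI) (simp add: lookup_restr lookup_pm_scale)

lemma restr_id: "Poly_Mapping.keys p \<subseteq> S \<Longrightarrow> restr S p = p"
  by (rule poly_mapping_eqI) (auto simp: lookup_restr in_keys_iff)

lemma restr_eq_0: "Poly_Mapping.keys p \<inter> S = {} \<Longrightarrow> restr S p = 0"
  by (rule poly_mapping_eqI) (auto simp: lookup_restr in_keys_iff)

lemma restr_sum: "restr S (sum g A) = (\<Sum>x\<in>A. restr S (g x))"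
  by (rule poly_mapping_eqI) (simp add: lookup_sum lookup_restr)

lemma restr_single: "restr S (Poly_Mapping.single m c) = (if m \<in> S then Poly_Mapping.single m c else 0)"
  by (rule poly_mapping_eqI) (auto simp: lookup_restr lookup_single when_def)

definition Supp :: "'a set \<Rightarrow> ('a \<Rightarrow>\<^sub>0 'k::zero) set" where
  "Supp S = {p. Poly_Mapping.keys p \<subseteq> S}"

lemma Supp_iff_lookup: "p \<in> Supp S \<longleftrightarrow> (\<forall>m. m \<notin> S \<longrightarrow> Poly_Mapping.lookup p m = 0)"
  by (auto simp: Supp_def in_keys_iff)

lemma Supp_mono: "p \<in> Supp S \<Longrightarrow> S \<subseteq> S' \<Longrightarrow> p \<in> Supp S'"
  by (auto simp: Supp_def)

lemma Supp_zero [simp]: "0 \<in> Supp S"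
  and Supp_add: "p \<in> Supp S \<Longrightarrow> q \<in> Supp S \<Longrightarrow> p + q \<in> Supp S" for p q :: "_ \<Rightarrow>\<^sub>0 _::ab_group_add"
  by (auto simp: Supp_iff_lookup lookup_add)

lemma Supp_uminus: "p \<in> Supp S \<Longrightarrow> - p \<in> Supp S"
  and Supp_diff: "p \<in> Supp S \<Longrightarrow> q \<in> Supp S \<Longrightarrow> p - q \<in> Supp S"
  for p q :: "_ \<Rightarrow>\<^sub>0 _::ab_group_add"
  by (auto simp: Supp_iff_lookup lookup_minus)

lemma Supp_mult:
  assumes "p \<in> Supp S" "q \<in> Supp T" "\<And>m n. m \<in> S \<Longrightarrow> n \<in> T \<Longrightarrow> m + n \<in> U"
  shows "p * q \<in> Supp U"
  using keys_mult[of p q] assms unfolding Supp_def by blast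

lemma push_Supp:
  fixes S :: "'a set"
  assumes "inj \<iota>"
  shows "push \<iota> ` (Supp S :: ('a \<Rightarrow>\<^sub>0 'k::comm_monoid_add) set) = Supp (\<iota> ` S)"
proof (intro set_eqI iffI)
  fix w :: "'b \<Rightarrow>\<^sub>0 'k" assume "w \<in> push \<iota> ` Supp S"
  then show "w \<in> Supp (\<iota> ` S)" by (auto simp: Supp_def keys_push[OF assms] intro!: imageI)
next
  fix w :: "'b \<Rightarrow>\<^sub>0 'k" assume w: "w \<in> Supp (\<iota> ` S)"
  then have "Poly_Mapping.keys w \<subseteq> range \<iota>" unfolding Supp_def by blast
  then obtain p where p: "push \<iota> p = w" using push_surj[OF assms] by blast
  have "\<iota> ` Poly_Mapping.keys p \<subseteq> \<iota> ` S" using w by (simp add: Supp_def keys_push[OF assms] flip: p)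
  then have "p \<in> Supp S" using assms by (simp add: Supp_def inj_image_subset_iff)
  then show "w \<in> push \<iota> ` Supp S" using p by blast
qed

lemma restr_eq_0_iff: "restr S p = 0 \<longleftrightarrow> p \<in> Supp (- S)"
  by (auto simp: poly_mapping_eq_iff fun_eq_iff lookup_restr Supp_iff_lookup)

lemma Supp_uminus_iff: "- p \<in> Supp S \<longleftrightarrow> (p :: _ \<Rightarrow>\<^sub>0 _::ab_group_add) \<in> Supp S"
  by (simp add: Supp_iff_lookup)

lemma single_power_Supp:
  fixes r :: "'a::monoid_add \<Rightarrow>\<^sub>0 'k::comm_ring_1"
  assumes "r \<in> Supp S" "0 \<in> S" "\<And>m n. m \<in> S \<Longrightarrow> n \<in> S \<Longrightarrow> m + n \<in> S"
  shows "r ^ n \<in> Supp S"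
proof (induction n)
  case 0
  have "(1 :: 'a \<Rightarrow>\<^sub>0 'k) \<in> Supp S" using assms(2) by (simp add: Supp_def)
  then show ?case by simp
next
  case (Suc n)
  then show ?case using Supp_mult[OF assms(1) Suc.IH] assms(3) by simp
qed

lemma subspace_Supp: "module.subspace pm_scale (Supp S)"
proof -
  interpret vector_space pm_scale by (rule vector_space_pm_scale)
  show ?thesis by (rule subspaceI) (auto simp: Supp_add, auto simp: Supp_iff_lookup lookup_pm_scale)
qed

lemma dim_Supp:
  fixes S :: "'a::comm_monoid_add set"
  assumes fin: "finite S"
  shows "fin_subspace pm_scale (Supp S :: ('a \<Rightarrow>\<^sub>0 'k::field) set)"
    and "vector_space.dim pm_scale (Supp S :: ('a \<Rightarrow>\<^sub>0 'k::field) set) = card S"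
proof -
  interpret vector_space "pm_scale :: 'k::field \<Rightarrow> ('a::comm_monoid_add \<Rightarrow>\<^sub>0 'k) \<Rightarrow> _"
    by (rule vector_space_pm_scale)
  let ?e = "\<lambda>m::'a. Poly_Mapping.single m (1::'k)"
  have sc: "Poly_Mapping.single m c = pm_scale c (?e m)" for m c
    by (simp add: pm_scale_def mult_single)
  have inj: "inj_on ?e S" by (rule inj_onI) (metis keys_single singleton_inject zero_neq_one)
  have sp: "Supp S \<subseteq> span (?e ` S)"
  proof
    fix p :: "'a \<Rightarrow>\<^sub>0 'k" assume p: "p \<in> Supp S"
    have "(\<Sum>m\<in>Poly_Mapping.keys p. Poly_Mapping.single m (Poly_Mapping.lookup p m)) \<in> span (?e ` S)"
    proof (rule span_sum)
      fix m assume "m \<in> Poly_Mapping.keys p"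
      then have "?e m \<in> span (?e ` S)" using p by (auto simp: Supp_def intro: span_base)
      then show "Poly_Mapping.single m (Poly_Mapping.lookup p m) \<in> span (?e ` S)"
        by (subst sc) (rule span_scale)
    qed
    then show "p \<in> span (?e ` S)" using poly_mapping_eq_sum_single[of p] by simp
  qed
  have ind: "independent (?e ` S)"
  proof (rule independent_if_scalars_zero)
    show "finite (?e ` S)" using fin by simp
    fix g x assume s: "(\<Sum>x\<in>?e ` S. pm_scale (g x) x) = 0" and x: "x \<in> ?e ` S"
    obtain n where n: "n \<in> S" "x = ?e n" using x by blast
    have "0 = (\<Sum>m\<in>S. pm_scale (g (?e m)) (?e m))" using s inj by (simp add: sum.reindex)
    then have "0 = Poly_Mapping.lookup (\<Sum>m\<in>S. pm_scale (g (?e m)) (?e m)) n" by simp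
    also have "\<dots> = (\<Sum>m\<in>S. if m = n then g (?e m) else 0)"
      unfolding lookup_sum by (rule sum.cong) (auto simp: lookup_pm_scale lookup_single when_def)
    also have "\<dots> = g x" using n fin by simp
    finally show "g x = 0" by simp
  qed
  show "fin_subspace pm_scale (Supp S :: ('a \<Rightarrow>\<^sub>0 'k) set)"
    unfolding fin_subspace_def using fin sp by (intro conjI subspace_Supp exI[of _ "?e ` S"]) simp_all
  have "?e ` S \<subseteq> Supp S" by (auto simp: Supp_def)
  then show "dim (Supp S) = card S" using basis_card_eq_dim[OF _ sp ind] inj by (simp add: card_image)
qed

text \<open>Only the component of degree \<open>b\<close> of \<open>p\<close> can contribute to degree \<open>b + d\<close> of the product, since
  \<open>q\<close> is homogeneous of degree \<open>d\<close>.  This is what allows coefficients of a homogeneous relation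
  to be chosen homogeneous.\<close>

lemma restr_mult_homogeneous:
  fixes deg :: "'a::monoid_add \<Rightarrow> 'b::ab_group_add" and p q :: "'a \<Rightarrow>\<^sub>0 'k::ring"
  assumes deg: "\<And>m n. deg (m + n) = deg m + deg n"
    and q: "q \<in> Supp {m. deg m = d}"
  shows "restr {m. deg m = b + d} (p * q) = restr {m. deg m = b} p * q"
proof -
  let ?p1 = "restr {m. deg m = b} p" and ?p2 = "restr {m. deg m \<noteq> b} p"
  have p: "p = ?p1 + ?p2"
  proof (rule poly_mapping_eqI)
    show "Poly_Mapping.lookup p k = Poly_Mapping.lookup (?p1 + ?p2) k" for k
      unfolding lookup_add lookup_restr by (cases "deg k = b") simp_all
  qed
  have "?p1 * q \<in> Supp {m. deg m = b + d}"
    by (rule Supp_mult[OF _ q, of _ "{m. deg m = b}"]) (auto simp: Supp_def keys_restr deg)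
  then have 1: "restr {m. deg m = b + d} (?p1 * q) = ?p1 * q" by (intro restr_id) (simp add: Supp_def)
  have "?p2 * q \<in> Supp {m. deg m \<noteq> b + d}"
    by (rule Supp_mult[OF _ q, of _ "{m. deg m \<noteq> b}"]) (auto simp: Supp_def keys_restr deg)
  then have 2: "restr {m. deg m = b + d} (?p2 * q) = 0" by (intro restr_eq_0) (auto simp: Supp_def)
  show ?thesis using 1 2 by (subst p) (simp add: distrib_right restr_add)
qed

section \<open>The Koszul complex when the unit ideal is generated\<close>

text \<open>The differentials of the Koszul complex of three elements, over an arbitrary commutative ring so
  that they are available for polynomials and for Laurent polynomials alike.  The bases are those
  of \<open>koszul1\<close> and \<open>koszul2\<close>; \<open>kos3\<close> is the map from the top exterior power.\<close>

fun kos1 :: "'a::comm_ring_1 \<times> 'a \<times> 'a \<Rightarrow> 'a \<times> 'a \<times> 'a \<Rightarrow> 'a" where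
  "kos1 (f0, f1, f2) (g0, g1, g2) = f0 * g0 + f1 * g1 + f2 * g2"

fun kos2 :: "'a::comm_ring_1 \<times> 'a \<times> 'a \<Rightarrow> 'a \<times> 'a \<times> 'a \<Rightarrow> 'a \<times> 'a \<times> 'a" where
  "kos2 (f0, f1, f2) (h01, h02, h12) =
     (- (f1 * h01) - f2 * h02, f0 * h01 - f2 * h12, f0 * h02 + f1 * h12)"

fun kos3 :: "'a::comm_ring_1 \<times> 'a \<times> 'a \<Rightarrow> 'a \<Rightarrow> 'a \<times> 'a \<times> 'a" where
  "kos3 (f0, f1, f2) w = (f2 * w, - (f1 * w), f0 * w)"

text \<open>Contraction with a vector \<open>c\<close>.  It is a homotopy between multiplication by \<open>kos1 f c\<close> and zero on
  the Koszul complex of \<open>f\<close>; for \<open>kos1 f c = 1\<close> it contracts the complex.\<close>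

fun ctr2 :: "'a::comm_ring_1 \<times> 'a \<times> 'a \<Rightarrow> 'a \<times> 'a \<times> 'a \<Rightarrow> 'a \<times> 'a \<times> 'a" where
  "ctr2 (c0, c1, c2) (g0, g1, g2) = (c0 * g1 - c1 * g0, c0 * g2 - c2 * g0, c1 * g2 - c2 * g1)"

fun ctr3 :: "'a::comm_ring_1 \<times> 'a \<times> 'a \<Rightarrow> 'a \<times> 'a \<times> 'a \<Rightarrow> 'a" where
  "ctr3 (c0, c1, c2) (h01, h02, h12) = c2 * h01 - c1 * h02 + c0 * h12"

lemma kos_add:
  "kos1 f (x + y) = kos1 f x + kos1 f y" "kos2 f (x + y) = kos2 f x + kos2 f y"
  "kos3 f (v + w) = kos3 f v + kos3 f w"
  by (cases f; cases x; cases y; simp add: algebra_simps)+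

lemma kos_diff:
  "kos1 f (x - y) = kos1 f x - kos1 f y" "kos2 f (x - y) = kos2 f x - kos2 f y"
  "kos3 f (v - w) = kos3 f v - kos3 f w"
  by (cases f; cases x; cases y; simp add: algebra_simps)+

lemma kos_zero [simp]: "kos1 f 0 = 0" "kos2 f 0 = 0" "kos3 f 0 = 0"
  using kos_diff(1,2)[of f 0 0] kos_diff(3)[of f 0 0] by simp_all

lemma kos_kos [simp]: "kos1 f (kos2 f y) = 0" "kos2 f (kos3 f w) = 0"
proof -
  show "kos1 f (kos2 f y) = 0" by (cases f; cases y) (simp add: algebra_simps)
  have "kos2 f (kos3 f w) = (0, 0, 0)" by (cases f) (simp add: algebra_simps)
  then show "kos2 f (kos3 f w) = 0" by (simp only: zero_prod_def)
qed

text \<open>The homotopy identity reads \<open>kos2 f (ctr2 c z) = kos1 f c \<cdot> z - kos1 f z \<cdot> c\<close>, componentwise.\<close>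

lemma kos2_ctr2:
  assumes c: "kos1 f c = 1" and z: "kos1 f z = 0"
  shows "kos2 f (ctr2 c z) = z"
proof -
  obtain f0 f1 f2 c0 c1 c2 z0 z1 z2 where e: "f = (f0, f1, f2)" "c = (c0, c1, c2)" "z = (z0, z1, z2)"
    by (metis prod_cases3)
  have 1: "f0 * c0 + f1 * c1 + f2 * c2 = 1" and 2: "f0 * z0 + f1 * z1 + f2 * z2 = 0"
    using c z by (simp_all add: e)
  have "- (f1 * (c0 * z1 - c1 * z0)) - f2 * (c0 * z2 - c2 * z0)
      = z0 * (f0 * c0 + f1 * c1 + f2 * c2) - c0 * (f0 * z0 + f1 * z1 + f2 * z2)"
    "f0 * (c0 * z1 - c1 * z0) - f2 * (c1 * z2 - c2 * z1)
      = z1 * (f0 * c0 + f1 * c1 + f2 * c2) - c1 * (f0 * z0 + f1 * z1 + f2 * z2)"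
    "f0 * (c0 * z2 - c2 * z0) + f1 * (c1 * z2 - c2 * z1)
      = z2 * (f0 * c0 + f1 * c1 + f2 * c2) - c2 * (f0 * z0 + f1 * z1 + f2 * z2)"
    by (simp_all add: algebra_simps)
  then show ?thesis by (simp add: e 1 2)
qed

text \<open>The same identity one step to the left: the correction terms are multiples of \<open>kos2 f y\<close>.\<close>

lemma kos3_ctr3:
  assumes c: "kos1 f c = 1" and y: "kos2 f y = 0"
  shows "kos3 f (ctr3 c y) = y"
proof -
  obtain f0 f1 f2 c0 c1 c2 y0 y1 y2 where e: "f = (f0, f1, f2)" "c = (c0, c1, c2)" "y = (y0, y1, y2)"
    by (metis prod_cases3)
  have 1: "f0 * c0 + f1 * c1 + f2 * c2 = 1" using c by (simp add: e)
  have "kos2 f y = (0, 0, 0)" using y by (simp only: zero_prod_def)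
  then have 2: "- (f1 * y0) - f2 * y1 = 0" "f0 * y0 - f2 * y2 = 0" "f0 * y1 + f1 * y2 = 0"
    by (simp_all add: e)
  have "f2 * (c2 * y0 - c1 * y1 + c0 * y2) = y0 * (f0 * c0 + f1 * c1 + f2 * c2)
      + c1 * (- (f1 * y0) - f2 * y1) - c0 * (f0 * y0 - f2 * y2)"
    "- (f1 * (c2 * y0 - c1 * y1 + c0 * y2)) = y1 * (f0 * c0 + f1 * c1 + f2 * c2)
      + c2 * (- (f1 * y0) - f2 * y1) - c0 * (f0 * y1 + f1 * y2)"
    "f0 * (c2 * y0 - c1 * y1 + c0 * y2) = y2 * (f0 * c0 + f1 * c1 + f2 * c2)
      + c2 * (f0 * y0 - f2 * y2) - c1 * (f0 * y1 + f1 * y2)"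
    by (simp_all add: algebra_simps)
  then show ?thesis by (simp add: e 1 2)
qed

lemma ctr3_kos3:
  assumes c: "kos1 f c = 1"
  shows "ctr3 c (kos3 f w) = w"
proof -
  obtain f0 f1 f2 c0 c1 c2 where e: "f = (f0, f1, f2)" "c = (c0, c1, c2)"
    by (metis prod_cases3)
  have 1: "f0 * c0 + f1 * c1 + f2 * c2 = 1" using c by (simp add: e)
  have "ctr3 c (kos3 f w) = w * (f0 * c0 + f1 * c1 + f2 * c2)" by (simp add: e algebra_simps)
  then show ?thesis by (simp add: 1)
qed

section \<open>Bigraded Laurent polynomials with exponents in a region\<close>

abbreviation cube :: "'a set \<Rightarrow> ('a \<times> 'a \<times> 'a) set" where
  "cube S \<equiv> S \<times> S \<times> S"

definition map3 :: "('a \<Rightarrow> 'b) \<Rightarrow> 'a \<times> 'a \<times> 'a \<Rightarrow> 'b \<times> 'b \<times> 'b" where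
  "map3 g = map_prod g (map_prod g g)"

type_synonym zexpo = "int \<times> int \<times> int \<times> int"
type_synonym 'k laurent = "zexpo \<Rightarrow>\<^sub>0 'k"

fun zdeg :: "zexpo \<Rightarrow> int \<times> int" where
  "zdeg (i, j, k, l) = (i + j, k + l)"

lemma zdeg_add: "zdeg (m + n) = zdeg m + zdeg n"
  by (cases m; cases n) simp

text \<open>The homogeneous elements of bidegree \<open>b\<close> with exponents in \<open>T\<close>.  For a submonoid \<open>T\<close> of the lattice
  this is a graded piece of a subring of the Laurent ring, for instance of a localization of \<open>R\<close>.\<close>

definition Laur :: "zexpo set \<Rightarrow> int \<times> int \<Rightarrow> 'k::zero laurent set" where
  "Laur T b = Supp (T \<inter> {e. zdeg e = b})"

lemma Laur_iff: "x \<in> Laur T b \<longleftrightarrow> (\<forall>e. Poly_Mapping.lookup x e \<noteq> 0 \<longrightarrow> e \<in> T \<and> zdeg e = b)"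
  by (auto simp: Laur_def Supp_iff_lookup)

lemma Laur_mono: "x \<in> Laur T b \<Longrightarrow> T \<subseteq> T' \<Longrightarrow> x \<in> Laur T' b"
  by (auto simp: Laur_iff)

lemma Laur_closed:
  fixes x y :: "'k::ab_group_add laurent"
  shows "0 \<in> Laur T b" "x \<in> Laur T b \<Longrightarrow> y \<in> Laur T b \<Longrightarrow> x + y \<in> Laur T b"
    "x \<in> Laur T b \<Longrightarrow> - x \<in> Laur T b" "x \<in> Laur T b \<Longrightarrow> y \<in> Laur T b \<Longrightarrow> x - y \<in> Laur T b"
  unfolding Laur_def by (simp_all add: Supp_add Supp_uminus Supp_diff)

lemma cube_Laur_closed:
  fixes x y :: "'k::ab_group_add laurent \<times> 'k laurent \<times> 'k laurent"
  shows "x \<in> cube (Laur T b) \<Longrightarrow> y \<in> cube (Laur T b) \<Longrightarrow> x + y \<in> cube (Laur T b)"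
    "x \<in> cube (Laur T b) \<Longrightarrow> - x \<in> cube (Laur T b)"
    "x \<in> cube (Laur T b) \<Longrightarrow> y \<in> cube (Laur T b) \<Longrightarrow> x - y \<in> cube (Laur T b)"
  by (cases x; cases y; simp add: Laur_closed)+

lemma cube_Laur_mono: "x \<in> cube (Laur T b) \<Longrightarrow> T \<subseteq> T' \<Longrightarrow> x \<in> cube (Laur T' b)"
  by (auto intro: Laur_mono)

definition sums_into :: "zexpo set \<Rightarrow> zexpo set \<Rightarrow> zexpo set \<Rightarrow> bool" where
  "sums_into S T U \<longleftrightarrow> (\<forall>m\<in>S. \<forall>n\<in>T. m + n \<in> U)"

lemma Laur_mult:
  assumes "x \<in> Laur S a" "y \<in> Laur T b" "sums_into S T U" "c = a + b"
  shows "x * y \<in> Laur U c"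
  unfolding Laur_def
  by (rule Supp_mult[OF assms(1,2)[unfolded Laur_def]])
    (use assms(3,4) in \<open>auto simp: sums_into_def zdeg_add\<close>)

lemma kos_Laur:
  fixes f :: "'k::comm_ring_1 laurent \<times> 'k laurent \<times> 'k laurent"
  assumes f: "f \<in> cube (Laur S d)" and ST: "sums_into S T T"
  shows "x \<in> cube (Laur T b) \<Longrightarrow> kos1 f x \<in> Laur T (b + d)"
    and "x \<in> cube (Laur T b) \<Longrightarrow> kos2 f x \<in> cube (Laur T (b + d))"
    and "w \<in> Laur T b \<Longrightarrow> kos3 f w \<in> cube (Laur T (b + d))"
proof -
  have m: "g * y \<in> Laur T (b + d)" if "g \<in> Laur S d" "y \<in> Laur T b" for g y :: "'k laurent"
    using Laur_mult[OF that ST] by (simp add: add.commute)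
  show "x \<in> cube (Laur T b) \<Longrightarrow> kos1 f x \<in> Laur T (b + d)"
    using f by (cases f; cases x) (auto intro!: m Laur_closed)
  show "x \<in> cube (Laur T b) \<Longrightarrow> kos2 f x \<in> cube (Laur T (b + d))"
    using f by (cases f; cases x) (auto intro!: m Laur_closed)
  show "w \<in> Laur T b \<Longrightarrow> kos3 f w \<in> cube (Laur T (b + d))"
    using f by (cases f) (auto intro!: m Laur_closed)
qed

lemma ctr_Laur:
  fixes c :: "'k::comm_ring_1 laurent \<times> 'k laurent \<times> 'k laurent"
  assumes c: "c \<in> cube (Laur S (- d))" and ST: "sums_into S T T"
  shows "x \<in> cube (Laur T b) \<Longrightarrow> ctr2 c x \<in> cube (Laur T (b - d))"
    and "x \<in> cube (Laur T b) \<Longrightarrow> ctr3 c x \<in> Laur T (b - d)"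
proof -
  have m: "g * y \<in> Laur T (b - d)" if "g \<in> Laur S (- d)" "y \<in> Laur T b" for g y :: "'k laurent"
    using Laur_mult[OF that ST, of "b - d"] by simp
  show "x \<in> cube (Laur T b) \<Longrightarrow> ctr2 c x \<in> cube (Laur T (b - d))"
    using c by (cases c; cases x) (auto intro!: m Laur_closed)
  show "x \<in> cube (Laur T b) \<Longrightarrow> ctr3 c x \<in> Laur T (b - d)"
    using c by (cases c; cases x) (auto intro!: m Laur_closed)
qed

text \<open>\<open>NN\<close> gives \<open>R\<close> itself and \<open>C_us\<close>, \<open>C_vs\<close>, \<open>C_ut\<close>, \<open>C_vt\<close> give its localizations at the products
  \<open>su\<close>, \<open>sv\<close>, \<open>tu\<close>, \<open>tv\<close>.  The monomials with exponents in \<open>H_uv\<close> and \<open>H_st\<close> are the standard bases of the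
  two summands of the second local cohomology of \<open>R\<close> at the irrelevant ideal.\<close>

definition "NN = {(i::int, j::int, k::int, l::int). i \<ge> 0 \<and> j \<ge> 0 \<and> k \<ge> 0 \<and> l \<ge> 0}"
definition "C_us = {(i::int, j::int, k::int, l::int). j \<ge> 0 \<and> l \<ge> 0}"
definition "C_vs = {(i::int, j::int, k::int, l::int). j \<ge> 0 \<and> k \<ge> 0}"
definition "C_ut = {(i::int, j::int, k::int, l::int). i \<ge> 0 \<and> l \<ge> 0}"
definition "C_vt = {(i::int, j::int, k::int, l::int). i \<ge> 0 \<and> k \<ge> 0}"
definition "H_uv = {(i::int, j::int, k::int, l::int). i \<ge> 0 \<and> j \<ge> 0 \<and> k < 0 \<and> l < 0}"
definition "H_st = {(i::int, j::int, k::int, l::int). i < 0 \<and> j < 0 \<and> k \<ge> 0 \<and> l \<ge> 0}"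
definition "neg_uv = {(i::int, j::int, k::int, l::int). k < 0 \<and> l < 0}"
definition "neg_st = {(i::int, j::int, k::int, l::int). i < 0 \<and> j < 0}"
definition "neg_u = {(i::int, j::int, k::int, l::int). k < 0}"
definition "neg_s = {(i::int, j::int, k::int, l::int). i < 0}"

lemmas region_defs = NN_def C_us_def C_vs_def C_ut_def C_vt_def H_uv_def H_st_def
  neg_uv_def neg_st_def neg_u_def neg_s_def

section \<open>Koszul cycles through a cover by four localizations\<close>

text \<open>On each of the four open sets where one of \<open>su\<close>, \<open>sv\<close>, \<open>tu\<close>, \<open>tv\<close> is invertible, the three entries of \<open>f\<close>
  generate the unit ideal, with homogeneous coefficients.  This is the form in which the hypothesis
  that \<open>I\<^sub>W\<close> has the irrelevant ideal as its radical enters.\<close>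

locale bezout_cover =
  fixes f c_us c_vs c_ut c_vt :: "'k::field laurent \<times> 'k laurent \<times> 'k laurent"
    and d :: "int \<times> int"
  assumes f: "f \<in> cube (Laur NN d)"
    and us: "c_us \<in> cube (Laur C_us (- d))" "kos1 f c_us = 1"
    and vs: "c_vs \<in> cube (Laur C_vs (- d))" "kos1 f c_vs = 1"
    and ut: "c_ut \<in> cube (Laur C_ut (- d))" "kos1 f c_ut = 1"
    and vt: "c_vt \<in> cube (Laur C_vt (- d))" "kos1 f c_vt = 1"
begin

text \<open>The kernel of multiplication by the entries of \<open>f\<close> on the summand of local cohomology spanned by
  \<open>H_uv\<close>.  In that quotient of the Laurent polynomials a monomial vanishes unless both its \<open>u\<close>- and
  its \<open>v\<close>-exponent are negative, so only the monomials in \<open>neg_uv\<close> have to be tested.\<close>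

definition ker_uv :: "int \<times> int \<Rightarrow> 'k laurent set" where
  "ker_uv b = {w \<in> Laur H_uv b. kos3 f w \<in> cube (Supp (- neg_uv))}"

definition ker_st :: "int \<times> int \<Rightarrow> 'k laurent set" where
  "ker_st b = {w \<in> Laur H_st b. kos3 f w \<in> cube (Supp (- neg_st))}"

text \<open>The connecting homomorphism from \<open>ker_uv\<close> to Koszul cycles: \<open>kos3 f w\<close> is the sum of a part
  that is regular once \<open>u\<close> is inverted and a part that is regular once \<open>v\<close> is inverted, and the
  boundaries of the two parts are opposite, hence regular.\<close>

definition conn_uv :: "'k laurent \<Rightarrow> 'k laurent \<times> 'k laurent \<times> 'k laurent" where
  "conn_uv w = kos2 f (map3 (restr neg_u) (kos3 f w))"

definition conn_st :: "'k laurent \<Rightarrow> 'k laurent \<times> 'k laurent \<times> 'k laurent" where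
  "conn_st w = kos2 f (map3 (restr neg_s) (kos3 f w))"

text \<open>With no monomial in \<open>neg_uv\<close>, the terms with negative \<open>u\<close>-exponent have nonnegative \<open>v\<close>-exponent.\<close>

lemma split_uv:
  assumes "w \<in> ker_uv b"
  defines "D \<equiv> kos3 f w"
  shows "map3 (restr neg_u) D \<in> cube (Laur {(i, j, k, l). i \<ge> 0 \<and> j \<ge> 0 \<and> l \<ge> 0} (b + d))"
    and "D - map3 (restr neg_u) D \<in> cube (Laur {(i, j, k, l). i \<ge> 0 \<and> j \<ge> 0 \<and> k \<ge> 0} (b + d))"
proof -
  have "w \<in> Laur {(i, j, k, l). i \<ge> 0 \<and> j \<ge> 0} b"
    using assms(1) by (auto simp: ker_uv_def H_uv_def elim!: Laur_mono)
  then have D: "D \<in> cube (Laur {(i, j, k, l). i \<ge> 0 \<and> j \<ge> 0} (b + d))"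
    unfolding D_def by (intro kos_Laur(3)[OF f]) (auto simp: sums_into_def NN_def)
  have D': "D \<in> cube (Supp (- neg_uv))" using assms(1) by (simp add: ker_uv_def D_def)
  obtain D0 D1 D2 where DD: "D = (D0, D1, D2)" by (cases D)
  have *: "restr neg_u x \<in> Laur {(i, j, k, l). i \<ge> 0 \<and> j \<ge> 0 \<and> l \<ge> 0} (b + d) \<and>
      x - restr neg_u x \<in> Laur {(i, j, k, l). i \<ge> 0 \<and> j \<ge> 0 \<and> k \<ge> 0} (b + d)"
    if "x \<in> Laur {(i, j, k, l). i \<ge> 0 \<and> j \<ge> 0} (b + d)" "x \<in> Supp (- neg_uv)" for x :: "'k laurent"
    using that by (fastforce simp: Laur_iff Supp_iff_lookup lookup_restr lookup_minus neg_u_def neg_uv_def)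
  show "map3 (restr neg_u) D \<in> cube (Laur {(i, j, k, l). i \<ge> 0 \<and> j \<ge> 0 \<and> l \<ge> 0} (b + d))"
    and "D - map3 (restr neg_u) D \<in> cube (Laur {(i, j, k, l). i \<ge> 0 \<and> j \<ge> 0 \<and> k \<ge> 0} (b + d))"
    using D D' * by (simp_all add: DD map3_def)
qed

lemma split_st:
  assumes "w \<in> ker_st b"
  defines "D \<equiv> kos3 f w"
  shows "map3 (restr neg_s) D \<in> cube (Laur {(i, j, k, l). j \<ge> 0 \<and> k \<ge> 0 \<and> l \<ge> 0} (b + d))"
    and "D - map3 (restr neg_s) D \<in> cube (Laur {(i, j, k, l). i \<ge> 0 \<and> k \<ge> 0 \<and> l \<ge> 0} (b + d))"
proof -
  have "w \<in> Laur {(i, j, k, l). k \<ge> 0 \<and> l \<ge> 0} b"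
    using assms(1) by (auto simp: ker_st_def H_st_def elim!: Laur_mono)
  then have D: "D \<in> cube (Laur {(i, j, k, l). k \<ge> 0 \<and> l \<ge> 0} (b + d))"
    unfolding D_def by (intro kos_Laur(3)[OF f]) (auto simp: sums_into_def NN_def)
  have D': "D \<in> cube (Supp (- neg_st))" using assms(1) by (simp add: ker_st_def D_def)
  obtain D0 D1 D2 where DD: "D = (D0, D1, D2)" by (cases D)
  have *: "restr neg_s x \<in> Laur {(i, j, k, l). j \<ge> 0 \<and> k \<ge> 0 \<and> l \<ge> 0} (b + d) \<and>
      x - restr neg_s x \<in> Laur {(i, j, k, l). i \<ge> 0 \<and> k \<ge> 0 \<and> l \<ge> 0} (b + d)"
    if "x \<in> Laur {(i, j, k, l). k \<ge> 0 \<and> l \<ge> 0} (b + d)" "x \<in> Supp (- neg_st)" for x :: "'k laurent"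
    using that by (fastforce simp: Laur_iff Supp_iff_lookup lookup_restr lookup_minus neg_s_def neg_st_def)
  show "map3 (restr neg_s) D \<in> cube (Laur {(i, j, k, l). j \<ge> 0 \<and> k \<ge> 0 \<and> l \<ge> 0} (b + d))"
    and "D - map3 (restr neg_s) D \<in> cube (Laur {(i, j, k, l). i \<ge> 0 \<and> k \<ge> 0 \<and> l \<ge> 0} (b + d))"
    using D D' * by (simp_all add: DD map3_def)
qed

text \<open>The two parts of \<open>kos3 f w\<close> have opposite boundaries, of which one has no negative \<open>v\<close>-exponents and
  the other no negative \<open>u\<close>-exponents.\<close>

lemma conn_uv_cycle:
  assumes "w \<in> ker_uv b"
  shows "conn_uv w \<in> cube (Laur NN (b + d + d))" and "kos1 f (conn_uv w) = 0"
proof -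
  let ?D = "kos3 f w" and ?P = "map3 (restr neg_u) (kos3 f w)"
  have 1: "kos2 f ?P \<in> cube (Laur {(i, j, k, l). i \<ge> 0 \<and> j \<ge> 0 \<and> l \<ge> 0} (b + d + d))"
    by (rule kos_Laur(2)[OF f _ split_uv(1)[OF assms]]) (auto simp: sums_into_def NN_def)
  have "kos2 f (?D - ?P) \<in> cube (Laur {(i, j, k, l). i \<ge> 0 \<and> j \<ge> 0 \<and> k \<ge> 0} (b + d + d))"
    by (rule kos_Laur(2)[OF f _ split_uv(2)[OF assms]]) (auto simp: sums_into_def NN_def)
  from cube_Laur_closed(2)[OF this]
  have 2: "kos2 f ?P \<in> cube (Laur {(i, j, k, l). i \<ge> 0 \<and> j \<ge> 0 \<and> k \<ge> 0} (b + d + d))"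
    by (simp add: kos_diff)
  from 1 2 show "conn_uv w \<in> cube (Laur NN (b + d + d))"
    unfolding conn_uv_def by (cases "kos2 f ?P") (auto simp: Laur_iff NN_def)
  show "kos1 f (conn_uv w) = 0" by (simp add: conn_uv_def)
qed

lemma conn_st_cycle:
  assumes "w \<in> ker_st b"
  shows "conn_st w \<in> cube (Laur NN (b + d + d))" and "kos1 f (conn_st w) = 0"
proof -
  let ?D = "kos3 f w" and ?P = "map3 (restr neg_s) (kos3 f w)"
  have 1: "kos2 f ?P \<in> cube (Laur {(i, j, k, l). j \<ge> 0 \<and> k \<ge> 0 \<and> l \<ge> 0} (b + d + d))"
    by (rule kos_Laur(2)[OF f _ split_st(1)[OF assms]]) (auto simp: sums_into_def NN_def)
  have "kos2 f (?D - ?P) \<in> cube (Laur {(i, j, k, l). i \<ge> 0 \<and> k \<ge> 0 \<and> l \<ge> 0} (b + d + d))"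
    by (rule kos_Laur(2)[OF f _ split_st(2)[OF assms]]) (auto simp: sums_into_def NN_def)
  from cube_Laur_closed(2)[OF this]
  have 2: "kos2 f ?P \<in> cube (Laur {(i, j, k, l). i \<ge> 0 \<and> k \<ge> 0 \<and> l \<ge> 0} (b + d + d))"
    by (simp add: kos_diff)
  from 1 2 show "conn_st w \<in> cube (Laur NN (b + d + d))"
    unfolding conn_st_def by (cases "kos2 f ?P") (auto simp: Laur_iff NN_def)
  show "kos1 f (conn_st w) = 0" by (simp add: conn_st_def)
qed

lemma Laur_disjoint: "x \<in> Laur S b \<Longrightarrow> x \<in> Laur T b \<Longrightarrow> S \<inter> T = {} \<Longrightarrow> x = 0"
  unfolding Laur_iff by (rule poly_mapping_eqI) (metis disjoint_iff lookup_zero)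

text \<open>A relation gives 2-cycles \<open>y_us\<close>, \<open>y_vs\<close>, \<open>y_ut\<close> over three of the localizations, which differ by
  \<open>kos3 f w1\<close> and \<open>kos3 f w2\<close>.  Over each localization the cycle is \<open>kos3 f m\<close> for a unique \<open>m\<close>, so \<open>w1\<close>
  and \<open>w2\<close> are differences of such elements \<open>m\<close>.  But a monomial in \<open>H_uv\<close> occurs neither in the
  localization at \<open>su\<close> nor in that at \<open>sv\<close>, and likewise for \<open>H_st\<close>.\<close>

lemma conn_independent:
  assumes x: "x \<in> cube (Laur NN (b + d))" and w1: "w1 \<in> ker_uv b" and w2: "w2 \<in> ker_st b"
    and eq: "kos2 f x + conn_uv w1 + conn_st w2 = 0"
  shows "w1 = 0" "w2 = 0"
proof -
  \<comment> \<open>\<open>P\<close> is the half of \<open>kos3 f w\<close> used in the connecting homomorphism and \<open>Q\<close> the other half, with opposite boundary.\<close>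
  define P1 where "P1 = map3 (restr neg_u) (kos3 f w1)"
  define P2 where "P2 = map3 (restr neg_s) (kos3 f w2)"
  define Q1 where "Q1 = kos3 f w1 - P1"
  define Q2 where "Q2 = kos3 f w2 - P2"
  note P1 = split_uv(1)[OF w1, folded P1_def] and Q1 = split_uv(2)[OF w1, folded P1_def, folded Q1_def]
  note P2 = split_st(1)[OF w2, folded P2_def] and Q2 = split_st(2)[OF w2, folded P2_def, folded Q2_def]
  have k1: "kos2 f Q1 = - kos2 f P1" and k2: "kos2 f Q2 = - kos2 f P2"
    by (simp_all add: Q1_def Q2_def kos_diff)
  have eq': "kos2 f x + kos2 f P1 + kos2 f P2 = 0" using eq by (simp add: conn_uv_def conn_st_def P1_def P2_def)
  define y_us where "y_us = x + P1 + P2"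
  define y_vs where "y_vs = x - Q1 + P2"
  define y_ut where "y_ut = x + P1 - Q2"
  have k: "kos2 f y_us = 0" "kos2 f y_vs = 0" "kos2 f y_ut = 0"
    using eq' by (simp_all add: y_us_def y_vs_def y_ut_def kos_add kos_diff k1 k2)
  have "y_us \<in> cube (Laur C_us (b + d))" unfolding y_us_def
    by (intro cube_Laur_closed cube_Laur_mono[OF x] cube_Laur_mono[OF P1] cube_Laur_mono[OF P2])
      (auto simp: region_defs)
  from ctr_Laur(2)[OF us(1) _ this] have m_us: "ctr3 c_us y_us \<in> Laur C_us b"
    by (simp add: sums_into_def C_us_def split_beta)
  have "y_vs \<in> cube (Laur C_vs (b + d))" unfolding y_vs_def
    by (intro cube_Laur_closed cube_Laur_mono[OF x] cube_Laur_mono[OF Q1] cube_Laur_mono[OF P2])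
      (auto simp: region_defs)
  from ctr_Laur(2)[OF vs(1) _ this] have m_vs: "ctr3 c_vs y_vs \<in> Laur C_vs b"
    by (simp add: sums_into_def C_vs_def split_beta)
  have "y_ut \<in> cube (Laur C_ut (b + d))" unfolding y_ut_def
    by (intro cube_Laur_closed cube_Laur_mono[OF x] cube_Laur_mono[OF P1] cube_Laur_mono[OF Q2])
      (auto simp: region_defs)
  from ctr_Laur(2)[OF ut(1) _ this] have m_ut: "ctr3 c_ut y_ut \<in> Laur C_ut b"
    by (simp add: sums_into_def C_ut_def split_beta)
  have inj: "v = w" if "kos3 f v = kos3 f w" for v w using that ctr3_kos3[OF us(2)] by metis
  note kk = kos3_ctr3[OF us(2) k(1)] kos3_ctr3[OF vs(2) k(2)] kos3_ctr3[OF ut(2) k(3)]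
  have "w1 = ctr3 c_us y_us - ctr3 c_vs y_vs"
    by (rule inj) (unfold kos_diff kk, simp add: y_us_def y_vs_def Q1_def)
  moreover have "ctr3 c_us y_us - ctr3 c_vs y_vs \<in> Laur (C_us \<union> C_vs) b"
    by (intro Laur_closed Laur_mono[OF m_us] Laur_mono[OF m_vs]) auto
  moreover have "w1 \<in> Laur H_uv b" using w1 by (simp add: ker_uv_def)
  ultimately show "w1 = 0" by (intro Laur_disjoint[of w1 H_uv b "C_us \<union> C_vs"]) (auto simp: region_defs)
  have "w2 = ctr3 c_us y_us - ctr3 c_ut y_ut"
    by (rule inj) (unfold kos_diff kk, simp add: y_us_def y_ut_def Q2_def)
  moreover have "ctr3 c_us y_us - ctr3 c_ut y_ut \<in> Laur (C_us \<union> C_ut) b"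
    by (intro Laur_closed Laur_mono[OF m_us] Laur_mono[OF m_ut]) auto
  moreover have "w2 \<in> Laur H_st b" using w2 by (simp add: ker_st_def)
  ultimately show "w2 = 0" by (intro Laur_disjoint[of w2 H_st b "C_us \<union> C_ut"]) (auto simp: region_defs)
qed

text \<open>The preimage under \<open>kos3 f\<close> exists over the localizations at \<open>su\<close> and at \<open>tv\<close> and is unique in the
  Laurent ring; a Laurent polynomial that is regular on both open sets is a polynomial.\<close>

lemma second_homology_zero:
  assumes x: "x \<in> cube (Laur NN (b + d))" and k: "kos2 f x = 0"
  shows "\<exists>m\<in>Laur NN b. x = kos3 f m"
proof
  let ?m = "ctr3 c_us x"
  show xm: "x = kos3 f ?m" using kos3_ctr3[OF us(2) k] by simp
  have "?m = ctr3 c_vt x" using ctr3_kos3[OF vt(2)] xm by metis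
  moreover have "ctr3 c_us x \<in> Laur C_us (b + d - d)" 
    by (rule ctr_Laur(2)[OF us(1) _ cube_Laur_mono[OF x]]) (auto simp: sums_into_def region_defs)
  moreover have "ctr3 c_vt x \<in> Laur C_vt (b + d - d)" 
    by (rule ctr_Laur(2)[OF vt(1) _ cube_Laur_mono[OF x]]) (auto simp: sums_into_def region_defs)
  ultimately show "?m \<in> Laur NN b" by (auto simp: Laur_iff region_defs)
qed

text \<open>A cycle \<open>z\<close> has a primitive over each of the four localizations.  Take the one at \<open>tv\<close>, called \<open>Y\<close>,
  as reference; the others are \<open>Y + kos3 f M\<close> with Laurent polynomials \<open>M_us\<close>, \<open>M_vs\<close>, \<open>M_ut\<close> (and 0 for
  \<open>Y\<close> itself).  To obtain a polynomial primitive one needs a single \<open>M\<close> that agrees, for every open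
  set, with the corresponding one of these at all exponents that are not regular there.  Two of
  them agree at the exponents that are not regular on the intersection of the two open sets, which leaves
  exactly two obstructions: the part \<open>w1\<close> of \<open>M_us - M_vs\<close> in \<open>H_uv\<close> and the part \<open>w2\<close> of \<open>M_us - M_ut\<close> in
  \<open>H_st\<close>.  They are annihilated by \<open>f\<close> in local cohomology, and subtracting their connecting images
  removes them.\<close>

lemma conn_generate:
  assumes z: "z \<in> cube (Laur NN (b + d + d))" and z0: "kos1 f z = 0"
  shows "\<exists>x\<in>cube (Laur NN (b + d)). \<exists>w1\<in>ker_uv b. \<exists>w2\<in>ker_st b.
    z = kos2 f x + conn_uv w1 + conn_st w2"
proof -
  have loc: "ctr2 c z \<in> cube (Laur C (b + d))"
    if "c \<in> cube (Laur C (- d))" "sums_into C C C" "NN \<subseteq> C" for c C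
    using ctr_Laur(1)[OF that(1,2) cube_Laur_mono[OF z that(3)]] by simp
  define y_us where "y_us = ctr2 c_us z"
  define y_vs where "y_vs = ctr2 c_vs z"
  define y_ut where "y_ut = ctr2 c_ut z"
  define Y where "Y = ctr2 c_vt z"
  have y_us: "y_us \<in> cube (Laur C_us (b + d))" "kos2 f y_us = z"
    unfolding y_us_def by (rule loc[OF us(1)]; force simp: sums_into_def region_defs) (rule kos2_ctr2[OF us(2) z0])
  have y_vs: "y_vs \<in> cube (Laur C_vs (b + d))" "kos2 f y_vs = z"
    unfolding y_vs_def by (rule loc[OF vs(1)]; force simp: sums_into_def region_defs) (rule kos2_ctr2[OF vs(2) z0])
  have y_ut: "y_ut \<in> cube (Laur C_ut (b + d))" "kos2 f y_ut = z"
    unfolding y_ut_def by (rule loc[OF ut(1)]; force simp: sums_into_def region_defs) (rule kos2_ctr2[OF ut(2) z0])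
  have Y: "Y \<in> cube (Laur C_vt (b + d))" "kos2 f Y = z"
    unfolding Y_def by (rule loc[OF vt(1)]; force simp: sums_into_def region_defs) (rule kos2_ctr2[OF vt(2) z0])
  have ex: "\<exists>m. kos3 f m = y - Y" if "kos2 f y = z" for y
    using that Y(2) kos3_ctr3[OF us(2), of "y - Y"] by (auto simp: kos_diff)
  obtain M_us where M_us: "kos3 f M_us = y_us - Y" using ex y_us by blast
  obtain M_vs where M_vs: "kos3 f M_vs = y_vs - Y" using ex y_vs by blast
  obtain M_ut where M_ut: "kos3 f M_ut = y_ut - Y" using ex y_ut by blast
  have reg: "m \<in> Laur T b"
    if "kos1 f c = 1" "c \<in> cube (Laur C (- d))" "sums_into C T T" "kos3 f m \<in> cube (Laur T (b + d))" for m c C T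
    using ctr_Laur(2)[OF that(2,3,4)] ctr3_kos3[OF that(1)] by simp
  have "M_us - M_vs \<in> Laur {(i, j, k, l). j \<ge> 0} b"
  proof (rule reg[OF us(2,1)])
    show "kos3 f (M_us - M_vs) \<in> cube (Laur {(i, j, k, l). j \<ge> 0} (b + d))"
      unfolding kos_diff M_us M_vs diff_diff_eq2 diff_add_cancel
      by (intro cube_Laur_closed cube_Laur_mono[OF y_us(1)] cube_Laur_mono[OF y_vs(1)]) (auto simp: region_defs)
  qed (auto simp: sums_into_def region_defs)
  then have F1: "j < 0 \<Longrightarrow> Poly_Mapping.lookup M_us (i, j, k, l) = Poly_Mapping.lookup M_vs (i, j, k, l)"
    for i j k l by (force simp: Laur_iff lookup_minus)
  have "M_us - M_ut \<in> Laur {(i, j, k, l). l \<ge> 0} b"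
  proof (rule reg[OF us(2,1)])
    show "kos3 f (M_us - M_ut) \<in> cube (Laur {(i, j, k, l). l \<ge> 0} (b + d))"
      unfolding kos_diff M_us M_ut diff_diff_eq2 diff_add_cancel
      by (intro cube_Laur_closed cube_Laur_mono[OF y_us(1)] cube_Laur_mono[OF y_ut(1)]) (auto simp: region_defs)
  qed (auto simp: sums_into_def region_defs)
  then have F2: "l < 0 \<Longrightarrow> Poly_Mapping.lookup M_us (i, j, k, l) = Poly_Mapping.lookup M_ut (i, j, k, l)"
    for i j k l by (force simp: Laur_iff lookup_minus)
  have M_ut': "M_ut \<in> Laur {(i, j, k, l). i \<ge> 0} b"
  proof (rule reg[OF ut(2,1)])
    show "kos3 f M_ut \<in> cube (Laur {(i, j, k, l). i \<ge> 0} (b + d))"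
      unfolding M_ut
      by (intro cube_Laur_closed cube_Laur_mono[OF Y(1)] cube_Laur_mono[OF y_ut(1)]) (auto simp: region_defs)
  qed (auto simp: sums_into_def region_defs)
  then have F3: "i < 0 \<Longrightarrow> Poly_Mapping.lookup M_ut (i, j, k, l) = 0" for i j k l
    by (force simp: Laur_iff)
  have M_vs': "M_vs \<in> Laur {(i, j, k, l). k \<ge> 0} b"
  proof (rule reg[OF vs(2,1)])
    show "kos3 f M_vs \<in> cube (Laur {(i, j, k, l). k \<ge> 0} (b + d))"
      unfolding M_vs
      by (intro cube_Laur_closed cube_Laur_mono[OF Y(1)] cube_Laur_mono[OF y_vs(1)]) (auto simp: region_defs)
  qed (auto simp: sums_into_def region_defs)
  then have F4: "k < 0 \<Longrightarrow> Poly_Mapping.lookup M_vs (i, j, k, l) = 0" for i j k l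
    by (force simp: Laur_iff)
  have M_us': "M_us \<in> Laur UNIV b"
  proof (rule reg[OF us(2,1)])
    show "kos3 f M_us \<in> cube (Laur UNIV (b + d))"
      unfolding M_us
      by (intro cube_Laur_closed cube_Laur_mono[OF Y(1)] cube_Laur_mono[OF y_us(1)]) auto
  qed (auto simp: sums_into_def)
  have deg: "Poly_Mapping.lookup M_us e \<noteq> 0 \<Longrightarrow> zdeg e = b" "Poly_Mapping.lookup M_vs e \<noteq> 0 \<Longrightarrow> zdeg e = b"
    "Poly_Mapping.lookup M_ut e \<noteq> 0 \<Longrightarrow> zdeg e = b" for e
    using M_us' M_vs' M_ut' unfolding Laur_iff by blast+
  define w1 where "w1 = restr neg_uv (M_us - M_vs)"
  define w2 where "w2 = restr neg_st (M_us - M_ut)"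
  \<comment> \<open>Where \<open>M_us\<close> is irregular, \<open>M\<close> has to agree with it; elsewhere it takes the value 0 that belongs to \<open>Y\<close>.\<close>
  define M where "M = restr {(i, j, k, l). j < 0 \<or> l < 0} M_us"
  have degz: "Poly_Mapping.lookup M_us e = 0 \<and> Poly_Mapping.lookup M_vs e = 0 \<and> Poly_Mapping.lookup M_ut e = 0"
    if "zdeg e \<noteq> b" for e using that deg by blast
  have lw: "w1 \<in> Laur H_uv b" "w2 \<in> Laur H_st b"
    "M - M_us \<in> Laur C_us b" "M - M_vs - w1 \<in> Laur C_vs b"
    "M - M_ut - w2 \<in> Laur C_ut b" "M - w1 - w2 \<in> Laur C_vt b"
  proof -
    let ?l = Poly_Mapping.lookup
    have I: "p \<in> Laur T b" if "\<And>i j k l. (i, j, k, l) \<notin> T \<Longrightarrow>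
        j < 0 \<longrightarrow> ?l M_us (i, j, k, l) = ?l M_vs (i, j, k, l) \<Longrightarrow>
        l < 0 \<longrightarrow> ?l M_us (i, j, k, l) = ?l M_ut (i, j, k, l) \<Longrightarrow>
        i < 0 \<longrightarrow> ?l M_ut (i, j, k, l) = 0 \<Longrightarrow>
        k < 0 \<longrightarrow> ?l M_vs (i, j, k, l) = 0 \<Longrightarrow> ?l p (i, j, k, l) = 0"
      "\<And>e. zdeg e \<noteq> b \<Longrightarrow> ?l p e = 0" for p :: "'k laurent" and T
      unfolding Laur_iff using that F1 F2 F3 F4 by (metis surj_pair)
    note L = w1_def w2_def M_def lookup_restr lookup_minus
    show "w1 \<in> Laur H_uv b" by (rule I) (use degz in \<open>auto simp: L region_defs not_le\<close>)
    show "w2 \<in> Laur H_st b" by (rule I) (use degz in \<open>auto simp: L region_defs not_le\<close>)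
    show "M - M_us \<in> Laur C_us b" by (rule I) (use degz in \<open>auto simp: L region_defs not_le\<close>)
    show "M - M_vs - w1 \<in> Laur C_vs b" by (rule I) (use degz in \<open>auto simp: L region_defs not_le\<close>)
    show "M - M_ut - w2 \<in> Laur C_ut b" by (rule I) (use degz in \<open>auto simp: L region_defs not_le\<close>)
    show "M - w1 - w2 \<in> Laur C_vt b" by (rule I) (use degz in \<open>auto simp: L region_defs not_le\<close>)
  qed
  define D1 where "D1 = kos3 f w1"
  define D2 where "D2 = kos3 f w2"
  define X where "X = Y + kos3 f M"
  have kl: "kos3 f m \<in> cube (Laur C (b + d))" if "m \<in> Laur C b" "sums_into NN C C" for m C
    using kos_Laur(3)[OF f that(2,1)] .
  have X_us: "X \<in> cube (Laur C_us (b + d))"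
  proof -
    have "X = y_us + kos3 f (M - M_us)" by (simp add: X_def kos_diff M_us)
    then show ?thesis using y_us(1) kl[OF lw(3)] by (auto intro!: cube_Laur_closed simp: sums_into_def region_defs)
  qed
  have X_vs: "X - D1 \<in> cube (Laur C_vs (b + d))"
  proof -
    have "X - D1 = y_vs + kos3 f (M - M_vs - w1)" by (simp add: X_def kos_diff M_vs D1_def)
    then show ?thesis using y_vs(1) kl[OF lw(4)] by (auto intro!: cube_Laur_closed simp: sums_into_def region_defs)
  qed
  have X_ut: "X - D2 \<in> cube (Laur C_ut (b + d))"
  proof -
    have "X - D2 = y_ut + kos3 f (M - M_ut - w2)" by (simp add: X_def kos_diff M_ut D2_def)
    then show ?thesis using y_ut(1) kl[OF lw(5)] by (auto intro!: cube_Laur_closed simp: sums_into_def region_defs)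
  qed
  have X_vt: "X - D1 - D2 \<in> cube (Laur C_vt (b + d))"
  proof -
    have "X - D1 - D2 = Y + kos3 f (M - w1 - w2)" by (simp add: X_def kos_diff D1_def D2_def)
    then show ?thesis using Y(1) kl[OF lw(6)] by (auto intro!: cube_Laur_closed simp: sums_into_def region_defs)
  qed
  have D1: "D1 \<in> cube (Laur {(i, j, k, l). i \<ge> 0 \<and> j \<ge> 0} (b + d))"
    unfolding D1_def by (rule kl[OF Laur_mono[OF lw(1)]]) (auto simp: sums_into_def region_defs)
  have D2: "D2 \<in> cube (Laur {(i, j, k, l). k \<ge> 0 \<and> l \<ge> 0} (b + d))"
    unfolding D2_def by (rule kl[OF Laur_mono[OF lw(2)]]) (auto simp: sums_into_def region_defs)
  obtain x0 x1 x2 p0 p1 p2 q0 q1 q2 where XX: "X = (x0, x1, x2)" "D1 = (p0, p1, p2)" "D2 = (q0, q1, q2)"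
    by (metis prod_cases3)
  have key: "p \<in> Supp (- neg_uv) \<and> q \<in> Supp (- neg_st) \<and>
      x - restr neg_u p - restr neg_s q \<in> Laur NN (b + d)"
    if h: "x \<in> Laur C_us (b + d)" "x - p \<in> Laur C_vs (b + d)" "x - q \<in> Laur C_ut (b + d)"
      "x - p - q \<in> Laur C_vt (b + d)" "p \<in> Laur {(i, j, k, l). i \<ge> 0 \<and> j \<ge> 0} (b + d)"
      "q \<in> Laur {(i, j, k, l). k \<ge> 0 \<and> l \<ge> 0} (b + d)" for x p q :: "'k laurent"
  proof (intro conjI)
    let ?l = Poly_Mapping.lookup
    have x_us: "j < 0 \<or> l < 0 \<Longrightarrow> ?l x (i, j, k, l) = 0" for i j k l using h(1) by (force simp: Laur_iff C_us_def)
    have 2: "j < 0 \<or> k < 0 \<Longrightarrow> ?l x (i, j, k, l) = ?l p (i, j, k, l)" for i j k l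
      using h(2) by (force simp: Laur_iff C_vs_def lookup_minus)
    have 3: "i < 0 \<or> l < 0 \<Longrightarrow> ?l x (i, j, k, l) = ?l q (i, j, k, l)" for i j k l
      using h(3) by (force simp: Laur_iff C_ut_def lookup_minus)
    have 4: "i < 0 \<or> k < 0 \<Longrightarrow> ?l x (i, j, k, l) = ?l p (i, j, k, l) + ?l q (i, j, k, l)" for i j k l
    proof -
      assume "i < 0 \<or> k < 0"
      then have "?l (x - p - q) (i, j, k, l) = 0" using h(4) by (force simp: Laur_iff C_vt_def)
      then show ?thesis unfolding lookup_minus by (simp add: algebra_simps)
    qed
    have 5: "i < 0 \<or> j < 0 \<Longrightarrow> ?l p (i, j, k, l) = 0" for i j k l using h(5) by (force simp: Laur_iff)
    have 6: "k < 0 \<or> l < 0 \<Longrightarrow> ?l q (i, j, k, l) = 0" for i j k l using h(6) by (force simp: Laur_iff)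
    have 7: "zdeg e \<noteq> b + d \<Longrightarrow> ?l x e = 0 \<and> ?l p e = 0 \<and> ?l q e = 0" for e
      using h(1,5,6) unfolding Laur_iff by blast
    have p0: "?l p (i, j, k, l) = 0" if "k < 0" "l < 0" for i j k l
      using x_us[of j l i k] 2[of j k i l] that by simp
    have q0: "?l q (i, j, k, l) = 0" if "i < 0" "j < 0" for i j k l
      using x_us[of j l i k] 3[of i l j k] that by simp
    show "p \<in> Supp (- neg_uv)" using p0 by (auto simp: Supp_iff_lookup neg_uv_def)
    show "q \<in> Supp (- neg_st)" using q0 by (auto simp: Supp_iff_lookup neg_st_def)
    have "?l (x - restr neg_u p - restr neg_s q) (i, j, k, l) = 0" if notin: "(i, j, k, l) \<notin> NN" for i j k l
    proof -
      consider "j < 0" | "l < 0" | "j \<ge> 0" "l \<ge> 0" "k < 0 \<or> i < 0" using notin unfolding NN_def by force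
      then show ?thesis
      proof cases
        case 1
        then show ?thesis using x_us[of j l i k]
          5[of i j k l] q0[of i j k l] by (simp add: lookup_minus lookup_restr neg_u_def neg_s_def)
      next
        case 2
        then show ?thesis using x_us[of j l i k]
          6[of k l i j] p0[of k l i j] by (simp add: lookup_minus lookup_restr neg_u_def neg_s_def)
      next
        case 3
        then show ?thesis using 4[of i k j l] 5[of i j k l] 6[of k l i j]
          by (auto simp: lookup_minus lookup_restr neg_u_def neg_s_def)
      qed
    qed
    moreover have "?l (x - restr neg_u p - restr neg_s q) e = 0" if "zdeg e \<noteq> b + d" for e
      using 7[OF that] by (simp add: lookup_minus lookup_restr)
    ultimately show "x - restr neg_u p - restr neg_s q \<in> Laur NN (b + d)"
      unfolding Laur_iff by (metis surj_pair)
  qed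
  \<comment> \<open>\<open>X\<close>, \<open>X - D1\<close>, \<open>X - D2\<close>, \<open>X - D1 - D2\<close> are regular on one open set each; removing only the irregular halves of \<open>D1\<close> and \<open>D2\<close> makes \<open>X\<close> regular everywhere.\<close>
  define X' where "X' = X - map3 (restr neg_u) D1 - map3 (restr neg_s) D2"
  have all: "D1 \<in> cube (Supp (- neg_uv))" "D2 \<in> cube (Supp (- neg_st))" "X' \<in> cube (Laur NN (b + d))"
    using key[of x0 p0 q0] key[of x1 p1 q1] key[of x2 p2 q2] X_us X_vs X_ut X_vt D1 D2
    by (simp_all add: X'_def XX map3_def)
  have "w1 \<in> ker_uv b" "w2 \<in> ker_st b" using all lw by (simp_all add: ker_uv_def ker_st_def D1_def D2_def)
  moreover have "z = kos2 f X' + conn_uv w1 + conn_st w2"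
    using Y(2) by (simp add: X'_def X_def conn_uv_def conn_st_def D1_def D2_def kos_diff kos_add)
  ultimately show ?thesis using all(3) by blast
qed

end

section \<open>The bigraded ring inside the Laurent polynomials\<close>

text \<open>A monomial of bidegree \<open>(p, q)\<close> is determined by its exponents of \<open>s\<close> and \<open>u\<close>.\<close>

lemma card_bidegree: "card {m. bideg m = (p, q)} = nat (pos_part (p + 1) * pos_part (q + 1))"
  and finite_bidegree: "finite {m. bideg m = (p, q)}"
proof -
  let ?g = "\<lambda>(i, k). (i, nat p - i, k, nat q - k)"
  have "finite {m. bideg m = (p, q)} \<and> card {m. bideg m = (p, q)} = nat (pos_part (p + 1) * pos_part (q + 1))"
  proof (cases "p \<ge> 0 \<and> q \<ge> 0")
    case True
    have eq: "{m. bideg m = (p, q)} = ?g ` ({..nat p} \<times> {..nat q})"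
    proof (intro set_eqI iffI)
      fix m assume "m \<in> {m. bideg m = (p, q)}"
      moreover obtain i j k l where m: "m = (i, j, k, l)" by (metis prod_cases4)
      ultimately have "int (i + j) = p" "int (k + l) = q" by auto
      then show "m \<in> ?g ` ({..nat p} \<times> {..nat q})" unfolding m
        by (intro image_eqI[of _ _ "(i, k)"]) auto
    next
      fix m assume "m \<in> ?g ` ({..nat p} \<times> {..nat q})"
      then show "m \<in> {m. bideg m = (p, q)}" using True by (auto simp: of_nat_diff)
    qed
    have "inj_on ?g ({..nat p} \<times> {..nat q})" by (auto simp: inj_on_def)
    then have "card {m. bideg m = (p, q)} = Suc (nat p) * Suc (nat q)"
      unfolding eq by (simp add: card_image card_cartesian_product)
    also have "\<dots> = nat (pos_part (p + 1) * pos_part (q + 1))"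
      using True by (simp add: pos_part_def nat_mult_distrib nat_add_distrib)
    finally show ?thesis unfolding eq by simp
  next
    case False
    then have eq: "{m. bideg m = (p, q)} = {}" by auto
    have zero: "pos_part (p + 1) * pos_part (q + 1) = 0" using False by (auto simp: pos_part_def)
    show ?thesis unfolding eq zero by simp
  qed
  then show "card {m. bideg m = (p, q)} = nat (pos_part (p + 1) * pos_part (q + 1))"
    and "finite {m. bideg m = (p, q)}" by auto
qed

lemma Rdeg_eq_Supp: "Rdeg p q = Supp {m. bideg m = (p, q)}"
  by (auto simp: Rdeg_def Supp_def)

lemma fin_subspace_Rdeg: "fin_subspace scl (Rdeg p q)"
  and dim_Rdeg: "int (vector_space.dim scl (Rdeg p q :: 'k::field bipoly set)) = pos_part (p + 1) * pos_part (q + 1)"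
proof -
  show "fin_subspace scl (Rdeg p q)"
    unfolding Rdeg_eq_Supp scl_eq_pm_scale by (rule dim_Supp(1)[OF finite_bidegree])
  have "0 \<le> pos_part (p + 1) * pos_part (q + 1)" by (simp add: pos_part_def)
  then show "int (vector_space.dim scl (Rdeg p q :: 'k bipoly set)) = pos_part (p + 1) * pos_part (q + 1)"
    unfolding Rdeg_eq_Supp scl_eq_pm_scale dim_Supp(2)[OF finite_bidegree] card_bidegree by simp
qed

definition pm_scale3 ::
  "'k::field \<Rightarrow> ('a::comm_monoid_add \<Rightarrow>\<^sub>0 'k) \<times> ('a \<Rightarrow>\<^sub>0 'k) \<times> ('a \<Rightarrow>\<^sub>0 'k) \<Rightarrow> _" where
  "pm_scale3 = prod_scale pm_scale (prod_scale pm_scale pm_scale)"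

lemma pm_scale3_simp [simp]: "pm_scale3 c (x, y, z) = (pm_scale c x, pm_scale c y, pm_scale c z)"
  by (simp add: pm_scale3_def prod_scale_def)

lemma scl3_eq_pm_scale3: "scl3 = pm_scale3"
  by (intro ext) (auto simp: scl_eq_pm_scale)

lemma vector_space_pm_scale3: "vector_space pm_scale3"
  unfolding pm_scale3_def by (intro vector_space_prod_scale vector_space_pm_scale)

lemma fin_subspace_cube:
  assumes "fin_subspace pm_scale V"
  shows "fin_subspace pm_scale3 (cube V)"
    and "vector_space.dim pm_scale3 (cube V) = 3 * vector_space.dim pm_scale V"
  unfolding pm_scale3_def
  using fin_subspace_prod[OF vector_space_pm_scale vector_space_prod_scale[OF vector_space_pm_scale vector_space_pm_scale]
      assms fin_subspace_prod(1)[OF vector_space_pm_scale vector_space_pm_scale assms assms]]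
    fin_subspace_prod(2)[OF vector_space_pm_scale vector_space_pm_scale assms assms] by simp_all

lemma pm_scale_kos:
  "kos1 f (pm_scale3 c x) = pm_scale c (kos1 f x)" "kos2 f (pm_scale3 c x) = pm_scale3 c (kos2 f x)"
  "kos3 f (pm_scale c w) = pm_scale3 c (kos3 f w)"
  by (cases f; cases x; simp add: pm_scale_def algebra_simps)+

lemma linear_kos:
  shows "Vector_Spaces.linear pm_scale3 pm_scale (kos1 f)" "Vector_Spaces.linear pm_scale3 pm_scale3 (kos2 f)"
    "Vector_Spaces.linear pm_scale pm_scale3 (kos3 f)"
  by (intro linear_of_add_scale vector_space_pm_scale vector_space_pm_scale3 kos_add pm_scale_kos)+

lemma koszul_eq_kos: "koszul1 f g = kos1 f g" "koszul2 f h = kos2 f h"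
  by (cases f; cases g; simp) (cases f; cases h; simp)

definition zexp :: "expo \<Rightarrow> zexpo" where
  "zexp = (\<lambda>(i, j, k, l). (int i, int j, int k, int l))"

lemma inj_zexp: "inj zexp" by (auto simp: inj_def zexp_def)

lemma zexp_add: "zexp (m + n) = zexp m + zexp n" by (cases m; cases n) (simp add: zexp_def)

lemma zdeg_zexp: "zdeg (zexp m) = bideg m" by (cases m) (simp add: zexp_def)

lemma range_zexp: "range zexp = NN"
proof (intro set_eqI iffI)
  fix e assume "e \<in> NN"
  then obtain i j k l where "e = (i, j, k, l)" "i \<ge> 0" "j \<ge> 0" "k \<ge> 0" "l \<ge> 0" by (auto simp: NN_def)
  then show "e \<in> range zexp"
    by (intro image_eqI[of _ _ "(nat i, nat j, nat k, nat l)"]) (auto simp: zexp_def)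
qed (auto simp: zexp_def NN_def)

abbreviation emb :: "'k::field bipoly \<Rightarrow> 'k laurent" where "emb \<equiv> push zexp"
abbreviation emb3 :: "'k::field triple \<Rightarrow> 'k laurent \<times> 'k laurent \<times> 'k laurent" where "emb3 \<equiv> map3 emb"

lemma zexp_bidegree: "zexp ` {m. bideg m = b} = NN \<inter> {e. zdeg e = b}"
  unfolding range_zexp[symmetric] by (auto simp: zdeg_zexp)

lemma emb_Rdeg: "emb ` Rdeg p q = Laur NN (p, q)"
  by (simp add: Rdeg_eq_Supp push_Supp[OF inj_zexp] zexp_bidegree Laur_def)

lemma emb3_Rdeg3: "emb3 ` Rdeg3 p q = cube (Laur NN (p, q))"
  unfolding Rdeg3_def map3_def emb_Rdeg[symmetric] by (intro map_prod_surj_on refl)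

lemma emb3_kos:
  "kos1 (emb3 f) (emb3 g) = emb (kos1 f g)" "kos2 (emb3 f) (emb3 g) = emb3 (kos2 f g)"
proof -
  note e = push_add push_uminus push_diff push_mult[of zexp, OF zexp_add]
  obtain f0 f1 f2 g0 g1 g2 where fg: "f = (f0, f1, f2)" "g = (g0, g1, g2)"
    by (metis prod_cases3)
  show "kos1 (emb3 f) (emb3 g) = emb (kos1 f g)" by (simp add: fg map3_def e)
  show "kos2 (emb3 f) (emb3 g) = emb3 (kos2 f g)" by (simp add: fg map3_def e)
qed

lemma emb3_eq_iff: "emb3 g = emb3 h \<longleftrightarrow> g = h"
  by (cases g; cases h) (simp add: map3_def push_eq_iff inj_zexp)

lemma emb3_zero [simp]: "emb3 0 = 0"
proof -
  have "emb3 (0, 0, 0) = (0, 0, 0)" by (simp add: map3_def)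
  then show ?thesis by (simp only: zero_prod_def)
qed

lemma linear_emb3: "Vector_Spaces.linear pm_scale3 pm_scale3 emb3"
proof (intro linear_of_add_scale vector_space_pm_scale3)
  show "emb3 (x + y) = emb3 x + emb3 y" for x y by (cases x; cases y) (simp add: map3_def push_add)
  show "emb3 (pm_scale3 c x) = pm_scale3 c (emb3 x)" for c x by (cases x) (simp add: map3_def push_pm_scale)
qed

lemma dim_emb3:
  assumes "fin_subspace pm_scale3 V"
  shows "vector_space.dim pm_scale3 (emb3 ` V) = vector_space.dim pm_scale3 V"
  by (rule dim_inj_image[OF linear_emb3 assms]) (metis emb3_eq_iff emb3_zero)

lemma fin_subspace_Laur_NN: "fin_subspace pm_scale (Laur NN b)"
proof -
  have "finite (NN \<inter> {e. zdeg e = b})"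
    unfolding zexp_bidegree[symmetric] by (cases b) (simp add: finite_bidegree)
  then show ?thesis unfolding Laur_def by (rule dim_Supp)
qed

section \<open>Contraction as multiplication on second local cohomology\<close>

text \<open>The exponent \<open>-1 - k\<close> is dual to \<open>k\<close>: multiplying \<open>u\<^sup>-\<^sup>1\<^sup>-\<^sup>k\<close> by \<open>u\<^sup>\<gamma>\<close> lowers \<open>k\<close> by \<open>\<gamma>\<close>, and the exponent
  stays negative exactly if \<open>\<gamma> \<le> k\<close>.  So contraction turns into multiplication followed by
  dropping the monomials that have become regular.\<close>

definition exp_uv :: "expo \<Rightarrow> zexpo" where
  "exp_uv = (\<lambda>(i, j, k, l). (int i, int j, - 1 - int k, - 1 - int l))"

definition exp_st :: "expo \<Rightarrow> zexpo" where
  "exp_st = (\<lambda>(i, j, k, l). (- 1 - int i, - 1 - int j, int k, int l))"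

lemma inj_exp_uv: "inj exp_uv" and inj_exp_st: "inj exp_st"
  by (auto simp: inj_def exp_uv_def exp_st_def)

lemma range_exp_uv: "range exp_uv = H_uv"
proof (intro set_eqI iffI)
  fix e assume "e \<in> H_uv"
  then obtain i j k l where "e = (i, j, k, l)" "i \<ge> 0" "j \<ge> 0" "k < 0" "l < 0" by (auto simp: H_uv_def)
  then show "e \<in> range exp_uv"
    by (intro image_eqI[of _ _ "(nat i, nat j, nat (- 1 - k), nat (- 1 - l))"]) (auto simp: exp_uv_def)
qed (auto simp: exp_uv_def H_uv_def)

lemma range_exp_st: "range exp_st = H_st"
proof (intro set_eqI iffI)
  fix e assume "e \<in> H_st"
  then obtain i j k l where "e = (i, j, k, l)" "i < 0" "j < 0" "k \<ge> 0" "l \<ge> 0" by (auto simp: H_st_def)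
  then show "e \<in> range exp_st"
    by (intro image_eqI[of _ _ "(nat (- 1 - i), nat (- 1 - j), nat k, nat l)"]) (auto simp: exp_st_def)
qed (auto simp: exp_st_def H_st_def)

lemma zdeg_exp_uv: "zdeg (exp_uv m) = (p, - q - 2) \<longleftrightarrow> bideg m = (p, q)"
  and zdeg_exp_st: "zdeg (exp_st m) = (- p - 2, q) \<longleftrightarrow> bideg m = (p, q)"
  by (cases m, auto simp: exp_uv_def exp_st_def)+

lemma push_exp_uv_Rdeg: "push exp_uv ` Rdeg p q = Laur H_uv (p, - q - 2)"
proof -
  have "exp_uv ` {m. bideg m = (p, q)} = H_uv \<inter> {e. zdeg e = (p, - q - 2)}"
    unfolding range_exp_uv[symmetric] by (auto simp: zdeg_exp_uv)
  then show ?thesis by (simp add: Rdeg_eq_Supp push_Supp[OF inj_exp_uv] Laur_def)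
qed

lemma push_exp_st_Rdeg: "push exp_st ` Rdeg p q = Laur H_st (- p - 2, q)"
proof -
  have "exp_st ` {m. bideg m = (p, q)} = H_st \<inter> {e. zdeg e = (- p - 2, q)}"
    unfolding range_exp_st[symmetric] by (auto simp: zdeg_exp_st)
  then show ?thesis by (simp add: Rdeg_eq_Supp push_Supp[OF inj_exp_st] Laur_def)
qed

text \<open>The term map \<open>T\<close> stands for one of the two contractions of terms; bilinear extension preserves
  its description as a truncated product.\<close>

lemma push_contraction:
  fixes f h :: "'k::field bipoly"
  assumes "\<And>m n c. push \<iota> (T m n c) = restr S (Poly_Mapping.single (zexp m + \<iota> n) (c :: 'k))"
  shows "push \<iota> (\<Sum>m\<in>Poly_Mapping.keys f. \<Sum>n\<in>Poly_Mapping.keys h.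
      T m n (Poly_Mapping.lookup f m * Poly_Mapping.lookup h n)) = restr S (emb f * push \<iota> h)"
proof -
  have "push \<kappa> p = (\<Sum>m\<in>Poly_Mapping.keys p. Poly_Mapping.single (\<kappa> m) (Poly_Mapping.lookup p m))"
    for \<kappa> :: "expo \<Rightarrow> zexpo" and p :: "'k bipoly"
    by (simp add: push_def lin_ext_def)
  then have "emb f * push \<iota> h = (\<Sum>m\<in>Poly_Mapping.keys f. \<Sum>n\<in>Poly_Mapping.keys h.
      Poly_Mapping.single (zexp m + \<iota> n) (Poly_Mapping.lookup f m * Poly_Mapping.lookup h n))"
    by (simp add: sum_product mult_single)
  then show ?thesis by (simp add: push_sum restr_sum assms)
qed

lemma push_contract_uv: "push exp_uv (contract_uv f h) = restr neg_uv (emb f * push exp_uv h)"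
  unfolding contract_uv_def
proof (rule push_contraction)
  fix m n :: expo and c :: 'a
  obtain \<alpha> \<beta> \<gamma> \<epsilon> i j k l where mn: "m = (\<alpha>, \<beta>, \<gamma>, \<epsilon>)" "n = (i, j, k, l)" by (metis prod_cases4)
  have "zexp m + exp_uv n \<in> neg_uv \<longleftrightarrow> \<gamma> \<le> k \<and> \<epsilon> \<le> l" by (auto simp: mn zexp_def exp_uv_def neg_uv_def)
  moreover have "exp_uv (i + \<alpha>, j + \<beta>, k - \<gamma>, l - \<epsilon>) = zexp m + exp_uv n" if "\<gamma> \<le> k \<and> \<epsilon> \<le> l"
    using that by (simp add: mn zexp_def exp_uv_def of_nat_diff)
  ultimately show "push exp_uv (contract_uv_term m n c) = restr neg_uv (Poly_Mapping.single (zexp m + exp_uv n) c)"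
    unfolding restr_single by (simp add: mn)
qed

lemma push_contract_st: "push exp_st (contract_st f h) = restr neg_st (emb f * push exp_st h)"
  unfolding contract_st_def
proof (rule push_contraction)
  fix m n :: expo and c :: 'a
  obtain \<alpha> \<beta> \<gamma> \<epsilon> i j k l where mn: "m = (\<alpha>, \<beta>, \<gamma>, \<epsilon>)" "n = (i, j, k, l)" by (metis prod_cases4)
  have "zexp m + exp_st n \<in> neg_st \<longleftrightarrow> \<alpha> \<le> i \<and> \<beta> \<le> j" by (auto simp: mn zexp_def exp_st_def neg_st_def)
  moreover have "exp_st (i - \<alpha>, j - \<beta>, k + \<gamma>, l + \<epsilon>) = zexp m + exp_st n" if "\<alpha> \<le> i \<and> \<beta> \<le> j"
    using that by (simp add: mn zexp_def exp_st_def of_nat_diff)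
  ultimately show "push exp_st (contract_st_term m n c) = restr neg_st (Poly_Mapping.single (zexp m + exp_st n) c)"
    unfolding restr_single by (simp add: mn)
qed

text \<open>Linearity is inherited from the truncated product through the injective map \<open>push \<iota>\<close>.\<close>

lemma contraction_linear:
  fixes K :: "'k::field bipoly \<Rightarrow> 'k bipoly \<Rightarrow> 'k bipoly"
  assumes "inj \<iota>" and "\<And>f h. push \<iota> (K f h) = restr S (emb f * push \<iota> h)"
  shows "K f (x + y) = K f x + K f y" "K f (pm_scale c x) = pm_scale c (K f x)"
proof -
  have "push \<iota> (K f (x + y)) = push \<iota> (K f x + K f y)"
    by (simp add: assms(2) push_add distrib_left restr_add)
  then show "K f (x + y) = K f x + K f y" by (simp add: push_eq_iff[OF assms(1)])
  have "push \<iota> (K f (pm_scale c x)) = restr S (pm_scale c (emb f * push \<iota> x))"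
    unfolding assms(2) push_pm_scale by (simp add: pm_scale_def mult.left_commute)
  also have "\<dots> = push \<iota> (pm_scale c (K f x))" by (simp add: assms(2) restr_pm_scale push_pm_scale)
  finally show "K f (pm_scale c x) = pm_scale c (K f x)" by (simp add: push_eq_iff[OF assms(1)])
qed

lemma linear_phi1: "Vector_Spaces.linear pm_scale pm_scale3 (phi1 f)"
  and linear_phi2: "Vector_Spaces.linear pm_scale pm_scale3 (phi2 f)"
proof -
  note uv = contraction_linear[OF inj_exp_uv push_contract_uv]
  note st = contraction_linear[OF inj_exp_st push_contract_st]
  show "Vector_Spaces.linear pm_scale pm_scale3 (phi1 f)"
    by (cases f; intro linear_of_add_scale vector_space_pm_scale vector_space_pm_scale3) (simp_all add: uv)
  show "Vector_Spaces.linear pm_scale pm_scale3 (phi2 f)"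
    by (cases f; intro linear_of_add_scale vector_space_pm_scale vector_space_pm_scale3) (simp_all add: st)
qed

text \<open>Up to order and signs the components of \<open>kos3\<close> and \<open>phi1\<close> are products with the same three entries.\<close>

lemma phi1_eq_0_iff: "phi1 f h = 0 \<longleftrightarrow> kos3 (emb3 f) (push exp_uv h) \<in> cube (Supp (- neg_uv))"
proof -
  have "contract_uv g h = 0 \<longleftrightarrow> emb g * push exp_uv h \<in> Supp (- neg_uv)" for g
    using push_eq_0_iff[OF inj_exp_uv, of "contract_uv g h"] by (simp add: push_contract_uv restr_eq_0_iff)
  then have "phi1 f h = (0, 0, 0) \<longleftrightarrow> kos3 (emb3 f) (push exp_uv h) \<in> cube (Supp (- neg_uv))"
    by (cases f) (auto simp: map3_def Supp_uminus_iff)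
  then show ?thesis by (simp only: zero_prod_def)
qed

lemma phi2_eq_0_iff: "phi2 f h = 0 \<longleftrightarrow> kos3 (emb3 f) (push exp_st h) \<in> cube (Supp (- neg_st))"
proof -
  have "contract_st g h = 0 \<longleftrightarrow> emb g * push exp_st h \<in> Supp (- neg_st)" for g
    using push_eq_0_iff[OF inj_exp_st, of "contract_st g h"] by (simp add: push_contract_st restr_eq_0_iff)
  then have "phi2 f h = (0, 0, 0) \<longleftrightarrow> kos3 (emb3 f) (push exp_st h) \<in> cube (Supp (- neg_st))"
    by (cases f) (auto simp: map3_def Supp_uminus_iff)
  then show ?thesis by (simp only: zero_prod_def)
qed

section \<open>From the radical to the four localizations\<close>

lemma gen_ideal_insert: "gen_ideal (insert a S) = {a * x + y | x y. y \<in> gen_ideal S}"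
  and gen_ideal_empty: "gen_ideal {} = {0 :: 'r}"
  for a :: "'r::comm_ring_1"
proof -
  interpret module "(*) :: 'r \<Rightarrow> 'r \<Rightarrow> 'r" by unfold_locales (simp_all add: algebra_simps)
  show "gen_ideal {} = {0 :: 'r}" by (simp add: gen_ideal_def)
  show "gen_ideal (insert a S) = {a * x + y | x y. y \<in> gen_ideal S}"
  proof (intro set_eqI iffI)
    fix p assume "p \<in> gen_ideal (insert a S)"
    then obtain k where "p - k * a \<in> gen_ideal S" by (auto simp: gen_ideal_def span_insert)
    moreover have "p = a * k + (p - k * a)" by (simp add: mult.commute)
    ultimately show "p \<in> {a * x + y | x y. y \<in> gen_ideal S}" by blast
  next
    fix p assume "p \<in> {a * x + y | x y. y \<in> gen_ideal S}"
    then obtain x y where "p = a * x + y" "y \<in> gen_ideal S" by blast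
    then have "p - x * a \<in> gen_ideal S" by (simp add: mult.commute)
    then show "p \<in> gen_ideal (insert a S)" by (auto simp: gen_ideal_def span_insert)
  qed
qed

lemma I_W_eq: "I_W f = range (kos1 f)"
proof -
  obtain f0 f1 f2 where f: "f = (f0, f1, f2)" by (cases f)
  have "I_W f = {f0 * x + (f1 * y + f2 * z) | x y z. True}"
    unfolding f I_W.simps gen_ideal_insert gen_ideal_empty
    by (simp, blast)
  also have "\<dots> = range (kos1 f)"
    unfolding f by (auto simp: image_iff add.assoc; (intro exI, rule refl))
  finally show ?thesis .
qed

lemma emb_one: "emb 1 = 1"
proof -
  have "emb (Poly_Mapping.single 0 1) = Poly_Mapping.single 0 1"
    by (simp add: zexp_def zero_prod_def)
  then show ?thesis by simp
qed

lemma emb_power: "emb (p ^ n) = emb p ^ n"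
  by (induction n) (simp_all add: emb_one push_mult[of zexp, OF zexp_add])

text \<open>In the localization where the monomial is invertible, dividing the relation that expresses its
  power in terms of \<open>f\<close> by that power gives the unit.  As 1 and the entries of \<open>f\<close> are homogeneous, the
  coefficients can be replaced by their components of degree \<open>-d\<close>.\<close>

lemma bezout_at_monomial:
  fixes f :: "'k::field triple"
  assumes f: "f \<in> Rdeg3 d1 d2" and m: "Poly_Mapping.single m 1 ^ n \<in> I_W f"
    and C: "- zexp m \<in> C" "NN \<subseteq> C" "sums_into C C C"
  shows "\<exists>c\<in>cube (Laur C (- (d1, d2))). kos1 (emb3 f) c = 1"
proof -
  obtain g where g: "Poly_Mapping.single m 1 ^ n = kos1 f g" using m by (auto simp: I_W_eq)
  define r :: "'k laurent" where "r = Poly_Mapping.single (- zexp m) 1"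
  have "r * emb (Poly_Mapping.single m 1) = 1" by (simp add: r_def mult_single)
  then have 1: "r ^ n * emb (Poly_Mapping.single m 1 ^ n) = 1"
    by (simp add: emb_power flip: power_mult_distrib)
  obtain f0 f1 f2 g0 g1 g2 where fg: "f = (f0, f1, f2)" "g = (g0, g1, g2)" by (metis prod_cases3)
  define h where "h x = r ^ n * emb x" for x
  have sum: "h g0 * emb f0 + h g1 * emb f1 + h g2 * emb f2 = 1"
    using 1 unfolding g fg h_def
    by (simp add: push_add push_mult[of zexp, OF zexp_add] algebra_simps)
  have zero: "0 \<in> C"
    using C(2) by (auto simp: NN_def zero_prod_def)
  have "r \<in> Supp C" using C(1) by (auto simp: r_def Supp_def)
  then have "r ^ n \<in> Supp C"
    using zero C(3) by (intro single_power_Supp) (auto simp: sums_into_def)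
  moreover have "emb x \<in> Supp C" for x
    using C(2) keys_push[OF inj_zexp, of x] range_zexp by (auto simp: Supp_def)
  ultimately have hC: "h x \<in> Supp C" for x
    unfolding h_def by (rule Supp_mult) (use C(3) in \<open>auto simp: sums_into_def\<close>)
  \<comment> \<open>The homogeneous component of the degree in which the coefficients must live.\<close>
  define h' where "h' x = restr {e. zdeg e = - (d1, d2)} (h x)" for x
  have h'C: "h' x \<in> Laur C (- (d1, d2))" for x
    using hC[of x] by (auto simp: Laur_def Supp_def h'_def keys_restr)
  have Fd: "emb x \<in> Supp {e. zdeg e = (d1, d2)}" if "x \<in> Rdeg d1 d2" for x :: "'k bipoly"
    using imageI[OF that, of emb] unfolding emb_Rdeg Laur_def by (rule Supp_mono) auto
  have hom: "restr {e. zdeg e = - (d1, d2) + (d1, d2)} (h x * emb y) = h' x * emb y"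
    if "y \<in> Rdeg d1 d2" for x y
    unfolding h'_def by (rule restr_mult_homogeneous[of zdeg, OF zdeg_add Fd[OF that]])
  have "zdeg 0 = - (d1, d2) + (d1, d2)" by (simp add: zero_prod_def)
  then have "restr {e. zdeg e = - (d1, d2) + (d1, d2)} (1 :: 'k laurent) = 1"
    by (intro restr_id) (simp add: zero_prod_def)
  then have "h' g0 * emb f0 + h' g1 * emb f1 + h' g2 * emb f2 = 1"
    unfolding sum[symmetric] restr_add using hom f by (simp add: fg Rdeg3_def)
  then have "kos1 (emb3 f) (h' g0, h' g1, h' g2) = 1"
    by (simp add: fg map3_def mult.commute)
  then show ?thesis using h'C by blast
qed

lemma mem_irrelevant_monomial:
  assumes "a \<in> {var_s, var_t}" "b \<in> {var_u, var_v}"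
  shows "a * b \<in> irrelevant_ideal"
proof -
  interpret module "(*) :: 'a bipoly \<Rightarrow> 'a bipoly \<Rightarrow> 'a bipoly" by unfold_locales (simp_all add: algebra_simps)
  show ?thesis unfolding irrelevant_ideal_def gen_ideal_def
  proof
    show "a * b \<in> span {var_u, var_v}" using assms(2) by (intro span_scale span_base)
    have "b * a \<in> span {var_s, var_t}" using assms(1) by (intro span_scale span_base)
    then show "a * b \<in> span {var_s, var_t}" by (simp add: mult.commute)
  qed
qed

lemma bezout_cover_of_radical:
  fixes f :: "'k::field triple"
  assumes f: "f \<in> Rdeg3 d1 d2" and rad: "radical (I_W f) = irrelevant_ideal"
  shows "\<exists>c_us c_vs c_ut c_vt. bezout_cover (emb3 f) c_us c_vs c_ut c_vt (d1, d2)"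
proof -
  have pow: "\<exists>n. (a * b) ^ n \<in> I_W f" if "a \<in> {var_s, var_t}" "b \<in> {var_u, var_v}" for a b
    using mem_irrelevant_monomial[OF that] unfolding rad[symmetric] by (simp add: radical_def)
  note vars = var_s_def var_t_def var_u_def var_v_def mult_single
  obtain n where "Poly_Mapping.single (1, 0, 1, 0) 1 ^ n \<in> I_W f"
    using pow[of var_s var_u] by (auto simp: vars)
  from bezout_at_monomial[OF f this, of C_us]
  obtain c_us where us: "c_us \<in> cube (Laur C_us (- (d1, d2)))" "kos1 (emb3 f) c_us = 1"
    by (auto simp: zexp_def region_defs sums_into_def)
  obtain n where "Poly_Mapping.single (1, 0, 0, 1) 1 ^ n \<in> I_W f"
    using pow[of var_s var_v] by (auto simp: vars)
  from bezout_at_monomial[OF f this, of C_vs]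
  obtain c_vs where vs: "c_vs \<in> cube (Laur C_vs (- (d1, d2)))" "kos1 (emb3 f) c_vs = 1"
    by (auto simp: zexp_def region_defs sums_into_def)
  obtain n where "Poly_Mapping.single (0, 1, 1, 0) 1 ^ n \<in> I_W f"
    using pow[of var_t var_u] by (auto simp: vars)
  from bezout_at_monomial[OF f this, of C_ut]
  obtain c_ut where ut: "c_ut \<in> cube (Laur C_ut (- (d1, d2)))" "kos1 (emb3 f) c_ut = 1"
    by (auto simp: zexp_def region_defs sums_into_def)
  obtain n where "Poly_Mapping.single (0, 1, 0, 1) 1 ^ n \<in> I_W f"
    using pow[of var_t var_v] by (auto simp: vars)
  from bezout_at_monomial[OF f this, of C_vt]
  obtain c_vt where vt: "c_vt \<in> cube (Laur C_vt (- (d1, d2)))" "kos1 (emb3 f) c_vt = 1"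
    by (auto simp: zexp_def region_defs sums_into_def)
  have F: "emb3 f \<in> cube (Laur NN (d1, d2))" using f emb3_Rdeg3 by blast
  show ?thesis by (intro exI) (rule bezout_cover.intro[OF F us vs ut vt])
qed

section \<open>Dimension count for Koszul cycles\<close>

context bezout_cover begin

lemma fin_subspace_ker_uv: "fin_subspace pm_scale (ker_uv b)"
proof (rule fin_subspace_subset[OF vector_space_pm_scale])
  interpret vector_space "pm_scale :: 'k \<Rightarrow> 'k laurent \<Rightarrow> _" by (rule vector_space_pm_scale)
  obtain p q where b: "b = (p, q)" by (cases b)
  have img: "push exp_uv ` (Rdeg p (- q - 2) :: 'k bipoly set) = Laur H_uv b"
    unfolding b push_exp_uv_Rdeg by simp
  show "fin_subspace pm_scale (Laur H_uv b :: 'k laurent set)"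
    unfolding img[symmetric] by (rule rank_nullity(2)[OF linear_push fin_subspace_Rdeg[unfolded scl_eq_pm_scale]])
  have sub: "subspace (Supp S :: 'k laurent set)" for S by (rule subspace_Supp)
  have "subspace {w. kos3 f w \<in> cube (Supp (- neg_uv))}"
  proof (rule subspaceI)
    show "0 \<in> {w. kos3 f w \<in> cube (Supp (- neg_uv))}" by (cases f) simp
    show "x + y \<in> {w. kos3 f w \<in> cube (Supp (- neg_uv))}"
      if "x \<in> {w. kos3 f w \<in> cube (Supp (- neg_uv))}" "y \<in> {w. kos3 f w \<in> cube (Supp (- neg_uv))}" for x y
      using that by (cases "kos3 f x"; cases "kos3 f y") (simp add: kos_add Supp_add)
    show "pm_scale c x \<in> {w. kos3 f w \<in> cube (Supp (- neg_uv))}"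
      if "x \<in> {w. kos3 f w \<in> cube (Supp (- neg_uv))}" for c x
      using that subspace_scale[OF sub] by (cases "kos3 f x") (simp add: pm_scale_kos)
  qed
  then show "subspace (ker_uv b)"
    unfolding ker_uv_def Laur_def Collect_conj_eq Collect_mem_eq by (intro subspace_inter sub)
qed (auto simp: ker_uv_def)

lemma fin_subspace_ker_st: "fin_subspace pm_scale (ker_st b)"
proof (rule fin_subspace_subset[OF vector_space_pm_scale])
  interpret vector_space "pm_scale :: 'k \<Rightarrow> 'k laurent \<Rightarrow> _" by (rule vector_space_pm_scale)
  obtain p q where b: "b = (p, q)" by (cases b)
  have img: "push exp_st ` (Rdeg (- p - 2) q :: 'k bipoly set) = Laur H_st b"
    unfolding b push_exp_st_Rdeg by simp
  show "fin_subspace pm_scale (Laur H_st b :: 'k laurent set)"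
    unfolding img[symmetric] by (rule rank_nullity(2)[OF linear_push fin_subspace_Rdeg[unfolded scl_eq_pm_scale]])
  have sub: "subspace (Supp S :: 'k laurent set)" for S by (rule subspace_Supp)
  have "subspace {w. kos3 f w \<in> cube (Supp (- neg_st))}"
  proof (rule subspaceI)
    show "0 \<in> {w. kos3 f w \<in> cube (Supp (- neg_st))}" by (cases f) simp
    show "x + y \<in> {w. kos3 f w \<in> cube (Supp (- neg_st))}"
      if "x \<in> {w. kos3 f w \<in> cube (Supp (- neg_st))}" "y \<in> {w. kos3 f w \<in> cube (Supp (- neg_st))}" for x y
      using that by (cases "kos3 f x"; cases "kos3 f y") (simp add: kos_add Supp_add)
    show "pm_scale c x \<in> {w. kos3 f w \<in> cube (Supp (- neg_st))}"
      if "x \<in> {w. kos3 f w \<in> cube (Supp (- neg_st))}" for c x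
      using that subspace_scale[OF sub] by (cases "kos3 f x") (simp add: pm_scale_kos)
  qed
  then show "subspace (ker_st b)"
    unfolding ker_st_def Laur_def Collect_conj_eq Collect_mem_eq by (intro subspace_inter sub)
qed (auto simp: ker_st_def)

lemma conn_linear:
  "conn_uv (v + w) = conn_uv v + conn_uv w" "conn_uv (pm_scale c w) = pm_scale3 c (conn_uv w)"
  "conn_st (v + w) = conn_st v + conn_st w" "conn_st (pm_scale c w) = pm_scale3 c (conn_st w)"
proof -
  have a: "map3 (restr S) (x + y) = map3 (restr S) x + map3 (restr S) y" for S and x y :: "'k laurent \<times> 'k laurent \<times> 'k laurent"
    by (cases x; cases y) (simp add: map3_def restr_add)
  have s: "map3 (restr S) (pm_scale3 c x) = pm_scale3 c (map3 (restr S) x)" for S and x :: "'k laurent \<times> 'k laurent \<times> 'k laurent"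
    by (cases x) (simp add: map3_def restr_pm_scale)
  show "conn_uv (v + w) = conn_uv v + conn_uv w" "conn_uv (pm_scale c w) = pm_scale3 c (conn_uv w)"
    "conn_st (v + w) = conn_st v + conn_st w" "conn_st (pm_scale c w) = pm_scale3 c (conn_st w)"
    by (simp_all add: conn_uv_def conn_st_def kos_add a s pm_scale_kos)
qed

lemma kos3_eq_0: "kos3 f w = 0 \<Longrightarrow> w = 0"
  using ctr3_kos3[OF us(2), of w] ctr3_kos3[OF us(2), of 0] by simp

text \<open>The 2-cycles are the 2-boundaries, and \<open>kos3 f\<close> is injective.\<close>

lemma dim_second_cycles:
  "vector_space.dim pm_scale3 {y \<in> cube (Laur NN (b + d)). kos2 f y = 0} = vector_space.dim pm_scale (Laur NN b :: 'k laurent set)"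
proof -
  have "{y \<in> cube (Laur NN (b + d)). kos2 f y = 0} = kos3 f ` Laur NN b"
  proof (intro set_eqI iffI)
    fix y assume "y \<in> kos3 f ` Laur NN b"
    then obtain w where w: "w \<in> Laur NN b" "y = kos3 f w" by blast
    have "kos3 f w \<in> cube (Laur NN (b + d))"
      by (rule kos_Laur(3)[OF f _ w(1)]) (auto simp: sums_into_def NN_def)
    then show "y \<in> {y \<in> cube (Laur NN (b + d)). kos2 f y = 0}" using w by simp
  next
    fix y assume "y \<in> {y \<in> cube (Laur NN (b + d)). kos2 f y = 0}"
    then show "y \<in> kos3 f ` Laur NN b" using second_homology_zero[of y b] by blast
  qed
  then show ?thesis
    using dim_inj_image[OF linear_kos(3) fin_subspace_Laur_NN kos3_eq_0] by simp
qed

text \<open>Rank-nullity for the map that sends \<open>(x, w1, w2)\<close> to \<open>kos2 f x + conn_uv w1 + conn_st w2\<close>: its image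
  is the space of cycles by \<open>conn_generate\<close>, and by \<open>conn_independent\<close> its kernel consists of the
  2-cycles alone.  In other words, the first homology is the direct sum of the two kernels.\<close>

lemma dim_first_cycles:
  "vector_space.dim pm_scale3 {z \<in> cube (Laur NN (b + d + d)). kos1 f z = 0} + vector_space.dim pm_scale (Laur NN b :: 'k laurent set)
    = vector_space.dim pm_scale3 (cube (Laur NN (b + d)) :: ('k laurent \<times> 'k laurent \<times> 'k laurent) set)
      + (vector_space.dim pm_scale (ker_uv b) + vector_space.dim pm_scale (ker_st b))"
proof -
  let ?s2 = "prod_scale pm_scale pm_scale :: 'k \<Rightarrow> 'k laurent \<times> 'k laurent \<Rightarrow> _"
  let ?s = "prod_scale pm_scale3 ?s2"
  let ?V = "cube (Laur NN (b + d)) \<times> (ker_uv b \<times> ker_st b)"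
  let ?Z = "{z \<in> cube (Laur NN (b + d + d)). kos1 f z = 0}"
  define G where "G = (\<lambda>(x, w1, w2). kos2 f x + conn_uv w1 + conn_st w2)"
  have vs2: "vector_space ?s2" by (intro vector_space_prod_scale vector_space_pm_scale)
  have vs: "vector_space ?s" by (intro vector_space_prod_scale vector_space_pm_scale3 vs2)
  have cube: "fin_subspace pm_scale3 (cube (Laur NN (b + d)) :: ('k laurent \<times> 'k laurent \<times> 'k laurent) set)"
    by (rule fin_subspace_cube(1)[OF fin_subspace_Laur_NN])
  note ker = fin_subspace_prod[OF vector_space_pm_scale vector_space_pm_scale fin_subspace_ker_uv[of b] fin_subspace_ker_st[of b]]
  note V = fin_subspace_prod[OF vector_space_pm_scale3 vs2 cube ker(1)]
  have scale3: "pm_scale3 c (x + y) = pm_scale3 c x + pm_scale3 c y" for c and x y :: "'k laurent \<times> 'k laurent \<times> 'k laurent"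
    by (cases x; cases y) (simp add: pm_scale_def distrib_left)
  have linG: "Vector_Spaces.linear ?s pm_scale3 G"
  proof (rule linear_of_add_scale[OF vs vector_space_pm_scale3])
    show "G (x + y) = G x + G y" for x y
      by (cases x; cases y) (simp add: G_def kos_add conn_linear)
    show "G (?s c x) = pm_scale3 c (G x)" for c x
      by (cases x) (simp add: G_def prod_scale_def pm_scale_kos conn_linear scale3)
  qed
  have img: "G ` ?V = ?Z"
  proof (intro set_eqI iffI)
    fix z assume "z \<in> G ` ?V"
    then obtain x w1 w2 where x: "x \<in> cube (Laur NN (b + d))" and w: "w1 \<in> ker_uv b" "w2 \<in> ker_st b"
      and z: "z = kos2 f x + conn_uv w1 + conn_st w2" by (auto simp: G_def)
    have "kos2 f x \<in> cube (Laur NN (b + d + d))"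
      by (rule kos_Laur(2)[OF f _ x]) (auto simp: sums_into_def NN_def)
    then have "z \<in> cube (Laur NN (b + d + d))"
      unfolding z by (intro cube_Laur_closed conn_uv_cycle[OF w(1)] conn_st_cycle[OF w(2)])
    then show "z \<in> ?Z" by (simp add: z kos_add conn_uv_cycle[OF w(1)] conn_st_cycle[OF w(2)])
  next
    fix z assume "z \<in> ?Z"
    then obtain x w1 w2 where "x \<in> cube (Laur NN (b + d))" "w1 \<in> ker_uv b" "w2 \<in> ker_st b"
      "z = kos2 f x + conn_uv w1 + conn_st w2" using conn_generate[of z b] by blast
    then show "z \<in> G ` ?V" by (intro image_eqI[of _ _ "(x, w1, w2)"]) (auto simp: G_def)
  qed
  have conn0: "conn_uv 0 = 0" "conn_st 0 = 0" using conn_linear(1,3)[of 0 0] by simp_all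
  have 0: "0 \<in> ker_uv b" "0 \<in> ker_st b"
    using fin_subspace_ker_uv[of b] fin_subspace_ker_st[of b] module.subspace_0[of pm_scale]
      vector_space_pm_scale by (auto simp: fin_subspace_def module_iff_vector_space)
  let ?K = "{y \<in> cube (Laur NN (b + d)). kos2 f y = 0}"
  have ker_eq: "{v \<in> ?V. G v = 0} = (\<lambda>y. (y, 0 :: 'k laurent, 0 :: 'k laurent)) ` ?K"
  proof (intro set_eqI iffI)
    fix v assume v: "v \<in> {v \<in> ?V. G v = 0}"
    obtain x w1 w2 where e: "v = (x, w1, w2)" by (metis prod_cases3)
    have x: "x \<in> cube (Laur NN (b + d))" and w: "w1 \<in> ker_uv b" "w2 \<in> ker_st b"
      and eq: "kos2 f x + conn_uv w1 + conn_st w2 = 0" using v by (auto simp: e G_def)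
    have "w1 = 0" "w2 = 0" using conn_independent[OF x w eq] by auto
    then show "v \<in> (\<lambda>y. (y, 0 :: 'k laurent, 0 :: 'k laurent)) ` ?K" using x eq by (simp add: e conn0)
  next
    fix v assume "v \<in> (\<lambda>y. (y, 0 :: 'k laurent, 0 :: 'k laurent)) ` ?K"
    then show "v \<in> {v \<in> ?V. G v = 0}" using 0 by (auto simp: G_def conn0)
  qed
  have K: "fin_subspace pm_scale3 ?K" by (rule rank_nullity(1)[OF linear_kos(2) cube])
  have "vector_space.dim ?s {v \<in> ?V. G v = 0} = vector_space.dim pm_scale3 ?K"
    unfolding ker_eq
  proof (rule dim_inj_image[OF _ K])
    show "Vector_Spaces.linear pm_scale3 ?s (\<lambda>y. (y, 0, 0))"
      by (rule linear_of_add_scale[OF vector_space_pm_scale3 vs]) (simp_all add: prod_scale_def pm_scale_def)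
    show "v = 0" if "(v, 0 :: 'k laurent, 0 :: 'k laurent) = 0" for v :: "'k laurent \<times> 'k laurent \<times> 'k laurent" using that by (metis fst_conv fst_zero)
  qed
  then show ?thesis
    using rank_nullity(3)[OF linG V(1)] V(2) ker(2) unfolding img dim_second_cycles by simp
qed

end

section \<open>Betti numbers of the Koszul complex in one bidegree\<close>

text \<open>The coefficients in an expression of a homogeneous element by the entries of \<open>f\<close> may be replaced by
  their homogeneous components.\<close>

lemma graded_ideal:
  fixes f :: "'k::field triple"
  assumes f: "f \<in> Rdeg3 d1 d2"
  shows "Rdeg a1 a2 \<inter> I_W f = kos1 f ` Rdeg3 (a1 - d1) (a2 - d2)"
proof -
  obtain f0 f1 f2 where e: "f = (f0, f1, f2)" by (metis prod_cases3)
  have bideg_add: "bideg (m + n) = bideg m + bideg n" for m n by (cases m; cases n) simp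
  let ?r = "restr {m. bideg m = (a1 - d1, a2 - d2)} :: 'k bipoly \<Rightarrow> _"
  have hom: "restr {m. bideg m = (a1, a2)} (y * x) = y * ?r x" if "y \<in> Rdeg d1 d2" for x y :: "'k bipoly"
    using restr_mult_homogeneous[of bideg, OF bideg_add that[unfolded Rdeg_eq_Supp], of "(a1 - d1, a2 - d2)" x]
    by (simp add: mult.commute)
  show ?thesis
  proof (intro set_eqI iffI)
    fix p assume p: "p \<in> Rdeg a1 a2 \<inter> I_W f"
    then obtain g0 g1 g2 where g: "p = kos1 f (g0, g1, g2)" by (auto simp: I_W_eq)
    have "p = restr {m. bideg m = (a1, a2)} p" using p by (simp add: restr_id Rdeg_eq_Supp Supp_def)
    also have "\<dots> = restr {m. bideg m = (a1, a2)} (f0 * g0 + f1 * g1 + f2 * g2)" by (simp add: g e)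
    also have "\<dots> = kos1 f (?r g0, ?r g1, ?r g2)"
      using f by (simp add: restr_add hom e Rdeg3_def)
    finally have "p = kos1 f (?r g0, ?r g1, ?r g2)" .
    moreover have "(?r g0, ?r g1, ?r g2) \<in> Rdeg3 (a1 - d1) (a2 - d2)"
      by (simp add: Rdeg3_def Rdeg_eq_Supp Supp_def keys_restr)
    ultimately show "p \<in> kos1 f ` Rdeg3 (a1 - d1) (a2 - d2)" by blast
  next
    fix p assume "p \<in> kos1 f ` Rdeg3 (a1 - d1) (a2 - d2)"
    then obtain g where g: "g \<in> Rdeg3 (a1 - d1) (a2 - d2)" "p = kos1 f g" by blast
    have m: "x * y \<in> Supp {m. bideg m = (a1, a2)}" if "x \<in> Rdeg d1 d2" "y \<in> Rdeg (a1 - d1) (a2 - d2)" for x y :: "'k bipoly"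
      by (rule Supp_mult[OF that[unfolded Rdeg_eq_Supp]]) (simp add: bideg_add)
    have "p \<in> Rdeg a1 a2" using g f
      unfolding Rdeg_eq_Supp[of a1] by (cases g) (auto simp: e Rdeg3_def intro!: m Supp_add)
    then show "p \<in> Rdeg a1 a2 \<inter> I_W f" using g(2) by (simp add: I_W_eq)
  qed
qed

lemma fin_subspace_Rdeg3: "fin_subspace scl3 (Rdeg3 p q)"
  and dim_Rdeg3: "vector_space.dim scl3 (Rdeg3 p q :: 'k::field triple set) = 3 * vector_space.dim scl (Rdeg p q :: 'k bipoly set)"
  unfolding Rdeg3_def scl3_eq_pm_scale3 scl_eq_pm_scale
  by (intro fin_subspace_cube fin_subspace_Rdeg[unfolded scl_eq_pm_scale])+

lemma linear_kos_R: "Vector_Spaces.linear scl3 scl (kos1 f)" "Vector_Spaces.linear scl3 scl3 (kos2 f)"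
  unfolding scl3_eq_pm_scale3 scl_eq_pm_scale by (rule linear_kos)+

lemma dim_RI_eq:
  fixes f :: "'k::field triple" and a1 a2 :: int
  assumes f: "f \<in> Rdeg3 d1 d2"
  defines "W \<equiv> kos1 f ` Rdeg3 (a1 - d1) (a2 - d2)"
  shows "int (dim_RI f a1 a2) = int (vector_space.dim scl (Rdeg a1 a2 :: 'k bipoly set)) - int (vector_space.dim scl W)"
    and "fin_subspace scl W" "W \<subseteq> Rdeg a1 a2"
proof -
  show W: "fin_subspace scl W" unfolding W_def by (rule rank_nullity(2)[OF linear_kos_R(1) fin_subspace_Rdeg3])
  show WR: "W \<subseteq> Rdeg a1 a2" unfolding W_def graded_ideal[OF f, symmetric] by blast
  have "vector_space.dim scl W \<le> vector_space.dim scl (Rdeg a1 a2 :: 'k bipoly set)"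
    using W by (intro dim_mono_fin vector_space_scl fin_subspace_Rdeg WR) (simp add: fin_subspace_def)
  moreover have "dim_RI f a1 a2 = vector_space.dim scl (Rdeg a1 a2 :: 'k bipoly set) - vector_space.dim scl W"
    unfolding dim_RI_def graded_ideal[OF f] W_def[symmetric]
    by (rule quotient_dim_fin[OF vector_space_scl fin_subspace_Rdeg W WR])
  ultimately show "int (dim_RI f a1 a2) = int (vector_space.dim scl (Rdeg a1 a2 :: 'k bipoly set)) - int (vector_space.dim scl W)"
    by simp
qed

lemma image_Collect_mem: "h ` {x \<in> A. P (h x)} = {w \<in> h ` A. P w}"
  by blast

definition nullity1 :: "int \<Rightarrow> int \<Rightarrow> 'k::field triple \<Rightarrow> int \<Rightarrow> int \<Rightarrow> nat" where
  "nullity1 d1 d2 f a1 a2 = vector_space.dim scl {h \<in> Rdeg (- 3 * d1 + a1) (3 * d2 - a2 - 2). phi1 f h = 0}"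

definition nullity2 :: "int \<Rightarrow> int \<Rightarrow> 'k::field triple \<Rightarrow> int \<Rightarrow> int \<Rightarrow> nat" where
  "nullity2 d1 d2 f a1 a2 = vector_space.dim scl {h \<in> Rdeg (3 * d1 - a1 - 2) (- 3 * d2 + a2). phi2 f h = 0}"

context bezout_cover begin

lemma nullity_eq_dim_ker:
  assumes F: "f = emb3 g" and d: "d = (d1, d2)"
  shows "nullity1 d1 d2 g a1 a2 = vector_space.dim pm_scale (ker_uv (a1 - 3 * d1, a2 - 3 * d2))"
    and "nullity2 d1 d2 g a1 a2 = vector_space.dim pm_scale (ker_st (a1 - 3 * d1, a2 - 3 * d2))"
proof -
  have "push exp_uv ` {h \<in> Rdeg (- 3 * d1 + a1) (3 * d2 - a2 - 2). phi1 g h = 0} = ker_uv (a1 - 3 * d1, a2 - 3 * d2)"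
  proof -
    have L: "Laur H_uv (a1 - 3 * d1, a2 - 3 * d2) = push exp_uv ` (Rdeg (- 3 * d1 + a1) (3 * d2 - a2 - 2) :: 'k bipoly set)"
      by (simp add: push_exp_uv_Rdeg algebra_simps)
    show ?thesis unfolding ker_uv_def phi1_eq_0_iff F[symmetric] L
      by (rule image_Collect_mem[where P = "\<lambda>w. kos3 f w \<in> cube (Supp (- neg_uv))"])
  qed
  moreover have "fin_subspace pm_scale {h \<in> Rdeg (- 3 * d1 + a1) (3 * d2 - a2 - 2). phi1 g h = 0}"
    by (rule rank_nullity(1)[OF linear_phi1 fin_subspace_Rdeg[unfolded scl_eq_pm_scale]])
  ultimately show "nullity1 d1 d2 g a1 a2 = vector_space.dim pm_scale (ker_uv (a1 - 3 * d1, a2 - 3 * d2))"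
    unfolding nullity1_def scl_eq_pm_scale
    using dim_inj_image[OF linear_push, of "{h \<in> Rdeg (- 3 * d1 + a1) (3 * d2 - a2 - 2). phi1 g h = 0}" exp_uv]
    by (simp only: push_eq_0_iff[OF inj_exp_uv])
  have "push exp_st ` {h \<in> Rdeg (3 * d1 - a1 - 2) (- 3 * d2 + a2). phi2 g h = 0} = ker_st (a1 - 3 * d1, a2 - 3 * d2)"
  proof -
    have L: "Laur H_st (a1 - 3 * d1, a2 - 3 * d2) = push exp_st ` (Rdeg (3 * d1 - a1 - 2) (- 3 * d2 + a2) :: 'k bipoly set)"
      by (simp add: push_exp_st_Rdeg algebra_simps)
    show ?thesis unfolding ker_st_def phi2_eq_0_iff F[symmetric] L
      by (rule image_Collect_mem[where P = "\<lambda>w. kos3 f w \<in> cube (Supp (- neg_st))"])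
  qed
  moreover have "fin_subspace pm_scale {h \<in> Rdeg (3 * d1 - a1 - 2) (- 3 * d2 + a2). phi2 g h = 0}"
    by (rule rank_nullity(1)[OF linear_phi2 fin_subspace_Rdeg[unfolded scl_eq_pm_scale]])
  ultimately show "nullity2 d1 d2 g a1 a2 = vector_space.dim pm_scale (ker_st (a1 - 3 * d1, a2 - 3 * d2))"
    unfolding nullity2_def scl_eq_pm_scale
    using dim_inj_image[OF linear_push, of "{h \<in> Rdeg (3 * d1 - a1 - 2) (- 3 * d2 + a2). phi2 g h = 0}" exp_st]
    by (simp only: push_eq_0_iff[OF inj_exp_st])
qed

text \<open>Both equations come from the same count.  The cycles in \<open>R\<close> are the cycles in the Laurent ring with
  exponents in \<open>NN\<close>, whose dimension exceeds that of the boundaries by the two nullities; the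
  alternating sum of dimensions along the Koszul complex then gives the Euler characteristic, as the
  second and third homology vanish.\<close>

lemma koszul_dims:
  assumes F: "f = emb3 g" and d: "d = (d1, d2)" and g: "g \<in> Rdeg3 d1 d2"
  shows "dim_H1 d1 d2 g a1 a2 = nullity1 d1 d2 g a1 a2 + nullity2 d1 d2 g a1 a2"
    and "int (dim_RI g a1 a2) = euler_char TYPE('k) d1 d2 a1 a2 + int (dim_H1 d1 d2 g a1 a2)"
proof -
  let ?b = "(a1 - 3 * d1, a2 - 3 * d2)"
  have bd: "?b + d = (a1 - 2 * d1, a2 - 2 * d2)" and bdd: "?b + d + d = (a1 - d1, a2 - d2)" by (simp_all add: d)
  let ?Z = "{z \<in> Rdeg3 (a1 - d1) (a2 - d2). kos1 g z = 0}"
  let ?K = "{y \<in> Rdeg3 (a1 - 2 * d1) (a2 - 2 * d2). kos2 g y = 0}"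
  let ?B = "kos2 g ` Rdeg3 (a1 - 2 * d1) (a2 - 2 * d2)"
  have Z: "fin_subspace scl3 ?Z" by (rule rank_nullity(1)[OF linear_kos_R(1) fin_subspace_Rdeg3])
  have K: "fin_subspace scl3 ?K" by (rule rank_nullity(1)[OF linear_kos_R(2) fin_subspace_Rdeg3])
  have B: "fin_subspace scl3 ?B" by (rule rank_nullity(2)[OF linear_kos_R(2) fin_subspace_Rdeg3])
  have emb0: "emb p = 0 \<longleftrightarrow> p = 0" for p :: "'k bipoly" by (rule push_eq_0_iff[OF inj_zexp])
  have emb30: "emb3 p = 0 \<longleftrightarrow> p = 0" for p :: "'k triple" by (metis emb3_eq_iff emb3_zero)
  have "emb3 ` ?Z = {z \<in> cube (Laur NN (?b + d + d)). kos1 f z = 0}"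
    unfolding bdd emb3_Rdeg3[symmetric] F by (auto simp: emb3_kos emb0)
  then have dZ: "vector_space.dim pm_scale3 {z \<in> cube (Laur NN (?b + d + d)). kos1 f z = 0} = vector_space.dim scl3 ?Z"
    using dim_emb3[OF Z[unfolded scl3_eq_pm_scale3]] by (simp add: scl3_eq_pm_scale3)
  have "emb3 ` ?K = {y \<in> cube (Laur NN (?b + d)). kos2 f y = 0}"
    unfolding bd emb3_Rdeg3[symmetric] F by (auto simp: emb3_kos emb30)
  then have dK: "vector_space.dim pm_scale (Laur NN ?b :: 'k laurent set) = vector_space.dim scl3 ?K"
    unfolding dim_second_cycles[symmetric]
    using dim_emb3[OF K[unfolded scl3_eq_pm_scale3]] by (simp add: scl3_eq_pm_scale3)
  have dL: "vector_space.dim pm_scale (Laur NN ?b :: 'k laurent set) = vector_space.dim scl (Rdeg (a1 - 3 * d1) (a2 - 3 * d2) :: 'k bipoly set)"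
    unfolding emb_Rdeg[symmetric] scl_eq_pm_scale
    by (rule dim_inj_image[OF linear_push fin_subspace_Rdeg[unfolded scl_eq_pm_scale]]) (simp add: emb0)
  have dC: "vector_space.dim pm_scale3 (cube (Laur NN (?b + d)) :: ('k laurent \<times> 'k laurent \<times> 'k laurent) set)
      = vector_space.dim scl3 (Rdeg3 (a1 - 2 * d1) (a2 - 2 * d2) :: 'k triple set)"
    unfolding bd emb3_Rdeg3[symmetric] scl3_eq_pm_scale3
    by (rule dim_emb3[OF fin_subspace_Rdeg3[unfolded scl3_eq_pm_scale3]])
  have rB: "vector_space.dim scl3 (Rdeg3 (a1 - 2 * d1) (a2 - 2 * d2) :: 'k triple set)
      = vector_space.dim scl3 ?K + vector_space.dim scl3 ?B"
    by (rule rank_nullity(3)[OF linear_kos_R(2) fin_subspace_Rdeg3])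
  have rW: "vector_space.dim scl3 (Rdeg3 (a1 - d1) (a2 - d2) :: 'k triple set)
      = vector_space.dim scl3 ?Z + vector_space.dim scl (kos1 g ` Rdeg3 (a1 - d1) (a2 - d2))"
    by (rule rank_nullity(3)[OF linear_kos_R(1) fin_subspace_Rdeg3])
  have main: "vector_space.dim scl3 ?Z = vector_space.dim scl3 ?B + (nullity1 d1 d2 g a1 a2 + nullity2 d1 d2 g a1 a2)"
    using dim_first_cycles[of ?b] unfolding dZ dC rB dK nullity_eq_dim_ker[OF F d] by simp
  have "?B \<subseteq> ?Z"
  proof
    fix z assume "z \<in> ?B"
    then obtain y where y: "y \<in> Rdeg3 (a1 - 2 * d1) (a2 - 2 * d2)" "z = kos2 g y" by blast
    have "emb3 y \<in> cube (Laur NN (?b + d))" using y(1) unfolding bd emb3_Rdeg3[symmetric] by blast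
    then have "kos2 f (emb3 y) \<in> cube (Laur NN (?b + d + d))"
      by (rule kos_Laur(2)[OF f, rotated]) (auto simp: sums_into_def NN_def)
    then have "emb3 z \<in> emb3 ` Rdeg3 (a1 - d1) (a2 - d2)"
      unfolding bdd emb3_Rdeg3[symmetric] y(2) F emb3_kos .
    then show "z \<in> ?Z" using y(2) by (auto simp: emb3_eq_iff)
  qed
  then have H1: "dim_H1 d1 d2 g a1 a2 = vector_space.dim scl3 ?Z - vector_space.dim scl3 ?B"
    unfolding dim_H1_def koszul_eq_kos by (rule quotient_dim_fin[OF vector_space_scl3 Z B])
  then show H: "dim_H1 d1 d2 g a1 a2 = nullity1 d1 d2 g a1 a2 + nullity2 d1 d2 g a1 a2" using main by simp
  show "int (dim_RI g a1 a2) = euler_char TYPE('k) d1 d2 a1 a2 + int (dim_H1 d1 d2 g a1 a2)"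
    using dim_RI_eq(1)[OF g, of a1 a2] rW rB main dK dL
    unfolding euler_char_def Let_def dim_Rdeg3 H by linarith
qed

end

lemma koszul_dims_of_radical:
  fixes f :: "'k::field triple"
  assumes "f \<in> Rdeg3 d1 d2" "radical (I_W f) = irrelevant_ideal"
  shows "dim_H1 d1 d2 f a1 a2 = nullity1 d1 d2 f a1 a2 + nullity2 d1 d2 f a1 a2"
    and "int (dim_RI f a1 a2) = euler_char TYPE('k) d1 d2 a1 a2 + int (dim_H1 d1 d2 f a1 a2)"
  using bezout_cover_of_radical[OF assms] bezout_cover.koszul_dims[OF _ refl refl assms(1)] by blast+

section \<open>Recognizing the irrelevant ideal as a radical\<close>

text \<open>For \<open>a\<close> and \<open>b\<close> reading off the exponents of two complementary pairs of variables, this sets the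
  variables of \<open>a\<close> to zero.  The target is a polynomial ring in two nested single variables because
  exponents that are linearly ordered compatibly with addition make it an integral domain.\<close>

definition set_zero :: "(expo \<Rightarrow> nat \<times> nat) \<Rightarrow> (expo \<Rightarrow> nat \<times> nat) \<Rightarrow> 'k::field bipoly \<Rightarrow> nat \<Rightarrow>\<^sub>0 (nat \<Rightarrow>\<^sub>0 'k)" where
  "set_zero a b = lin_ext (\<lambda>m c. if a m = (0, 0)
     then Poly_Mapping.single (fst (b m)) (Poly_Mapping.single (snd (b m)) c) else 0)"

text \<open>The ideal generated by one of the pairs \<open>s, t\<close> and \<open>u, v\<close> is the kernel of a homomorphism to an
  integral domain.\<close>

lemma root_in_prime:
  fixes p :: "'k::field bipoly" and a b :: "expo \<Rightarrow> nat \<times> nat"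
  assumes a: "\<And>m n. a (m + n) = a m + a n" and b: "\<And>m n. b (m + n) = b m + b n"
    and ab: "\<And>m n. a m = a n \<Longrightarrow> b m = b n \<Longrightarrow> m = n"
    and p: "p ^ n \<in> Supp {m. a m \<noteq> (0, 0)}"
  shows "p \<in> Supp {m. a m \<noteq> (0, 0)}"
proof -
  let ?\<phi> = "\<lambda>m c. if a m = (0, 0)
     then Poly_Mapping.single (fst (b m)) (Poly_Mapping.single (snd (b m)) (c :: 'k)) else 0"
  have a0: "a (m + n) = (0, 0) \<longleftrightarrow> a m = (0, 0) \<and> a n = (0, 0)" for m n
    by (cases "a m"; cases "a n") (auto simp: a)
  have add: "set_zero a b (x + y) = set_zero a b x + set_zero a b y" for x y :: "'k bipoly"
    unfolding set_zero_def by (rule lin_ext_add) (simp_all add: single_add)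
  have mult: "set_zero a b (x * y) = set_zero a b x * set_zero a b y" for x y :: "'k bipoly"
    unfolding set_zero_def by (rule lin_ext_mult) (simp_all add: single_add mult_single a0 b)
  have single: "set_zero a b (Poly_Mapping.single m c) = ?\<phi> m c" for m c
    unfolding set_zero_def by (rule lin_ext_single) simp
  have a00: "a 0 = (0, 0)" "b 0 = (0, 0)" using a[of 0 0] b[of 0 0] by (cases "a 0"; cases "b 0"; simp)+
  have "set_zero a b (Poly_Mapping.single 0 1 :: 'k bipoly) = 1" unfolding single by (simp add: a00)
  then have one: "set_zero a b (1 :: 'k bipoly) = 1" by simp
  have pow: "set_zero a b (x ^ k) = set_zero a b x ^ k" for x :: "'k bipoly" and k
    by (induction k) (simp_all add: one mult)
  have lk: "Poly_Mapping.lookup (Poly_Mapping.lookup (set_zero a b x) (fst (b m))) (snd (b m)) = Poly_Mapping.lookup x m"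
    if "a m = (0, 0)" for m and x :: "'k bipoly"
  proof (induction x rule: poly_mapping_terms_induct)
    case (single m' c)
    have "fst (b m') = fst (b m) \<and> snd (b m') = snd (b m) \<longleftrightarrow> m' = m" if "a m' = (0, 0)"
      using ab[of m' m] that \<open>a m = (0, 0)\<close> by (metis prod_eqI)
    then show ?case
      unfolding \<open>\<And>m c. set_zero a b (Poly_Mapping.single m c) = ?\<phi> m c\<close>
      using \<open>a m = (0, 0)\<close> by (auto simp: lookup_single when_def)
  next
    case (add x y)
    then show ?case
      by (simp add: \<open>\<And>x y. set_zero a b (x + y) = set_zero a b x + set_zero a b y\<close> lookup_add)
  qed
  have "set_zero a b (p ^ n) = 0"
    unfolding set_zero_def lin_ext_def using p by (intro sum.neutral) (auto simp: Supp_def)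
  then have "set_zero a b p = 0" unfolding pow by simp
  then show ?thesis unfolding Supp_iff_lookup using lk[of _ p] by simp
qed

lemma gen_ideal_subspace:
  fixes x :: "'r::comm_ring_1"
  shows "0 \<in> gen_ideal A" "x \<in> gen_ideal A \<Longrightarrow> y \<in> gen_ideal A \<Longrightarrow> x + y \<in> gen_ideal A"
    "x \<in> gen_ideal A \<Longrightarrow> x * c \<in> gen_ideal A" "a \<in> A \<Longrightarrow> a \<in> gen_ideal A"
proof -
  interpret module "(*) :: 'r \<Rightarrow> 'r \<Rightarrow> 'r" by unfold_locales (simp_all add: algebra_simps)
  show "0 \<in> gen_ideal A" "x \<in> gen_ideal A \<Longrightarrow> y \<in> gen_ideal A \<Longrightarrow> x + y \<in> gen_ideal A"
    "x \<in> gen_ideal A \<Longrightarrow> x * c \<in> gen_ideal A" "a \<in> A \<Longrightarrow> a \<in> gen_ideal A"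
    using span_scale[of x A c] by (simp_all add: gen_ideal_def span_zero span_add span_base mult.commute)
qed

lemma mem_gen_ideal_of_terms:
  assumes "\<And>m. m \<in> Poly_Mapping.keys p \<Longrightarrow> \<exists>m1 m2. m = m1 + m2 \<and> Poly_Mapping.single m1 1 \<in> gen_ideal A"
  shows "p \<in> gen_ideal (A :: 'k::field bipoly set)"
proof -
  have "(\<Sum>m\<in>M. Poly_Mapping.single m (Poly_Mapping.lookup p m)) \<in> gen_ideal A"
    if "finite M" "M \<subseteq> Poly_Mapping.keys p" for M
    using that
  proof (induction M)
    case empty show ?case by (simp add: gen_ideal_subspace)
  next
    case (insert m M)
    obtain m1 m2 where m: "m = m1 + m2" "Poly_Mapping.single m1 1 \<in> gen_ideal A"
      using assms[of m] insert.prems by blast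
    have "Poly_Mapping.single m (Poly_Mapping.lookup p m)
        = Poly_Mapping.single m1 1 * Poly_Mapping.single m2 (Poly_Mapping.lookup p m)"
      by (simp add: mult_single m(1))
    then have "Poly_Mapping.single m (Poly_Mapping.lookup p m) \<in> gen_ideal A"
      using gen_ideal_subspace(3)[OF m(2)] by simp
    then show ?case using insert by (simp add: gen_ideal_subspace)
  qed
  from this[OF finite_keys[of p] subset_refl] show ?thesis using poly_mapping_eq_sum_single[of p] by simp
qed

definition st_part :: "expo \<Rightarrow> nat \<times> nat" where "st_part = (\<lambda>(i, j, k, l). (i, j))"
definition uv_part :: "expo \<Rightarrow> nat \<times> nat" where "uv_part = (\<lambda>(i, j, k, l). (k, l))"

lemma gen_ideal_st: "gen_ideal {var_s, var_t} = Supp {m. st_part m \<noteq> (0, 0)}"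
proof (intro set_eqI iffI)
  fix p :: "'k::field bipoly" assume "p \<in> gen_ideal {var_s, var_t}"
  then obtain x y where p: "p = var_s * x + var_t * y" by (auto simp: gen_ideal_insert gen_ideal_empty)
  have "var_s * x \<in> Supp {m. st_part m \<noteq> (0, 0)}" "var_t * y \<in> Supp {m. st_part m \<noteq> (0, 0)}"
    by (rule Supp_mult[of _ "{(1, 0, 0, 0)}" _ UNIV] Supp_mult[of _ "{(0, 1, 0, 0)}" _ UNIV];
        auto simp: Supp_def var_s_def var_t_def st_part_def)+
  then show "p \<in> Supp {m. st_part m \<noteq> (0, 0)}" unfolding p by (rule Supp_add)
next
  fix p :: "'k::field bipoly" assume p: "p \<in> Supp {m. st_part m \<noteq> (0, 0)}"
  show "p \<in> gen_ideal {var_s, var_t}"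
  proof (rule mem_gen_ideal_of_terms)
    fix m assume "m \<in> Poly_Mapping.keys p"
    moreover obtain i j k l where m: "m = (i, j, k, l)" by (metis prod_cases4)
    ultimately have "(i, j) \<noteq> (0, 0)" using p by (auto simp: Supp_def st_part_def)
    then consider "i > 0" | "j > 0" by auto
    then show "\<exists>m1 m2. m = m1 + m2 \<and> Poly_Mapping.single m1 1 \<in> gen_ideal {var_s, var_t}"
    proof cases
      case 1
      then have "m = (1, 0, 0, 0) + (i - 1, j, k, l)" by (simp add: m)
      then show ?thesis using gen_ideal_subspace(4)[of var_s "{var_s, var_t}"] unfolding var_s_def by blast
    next
      case 2
      then have "m = (0, 1, 0, 0) + (i, j - 1, k, l)" by (simp add: m)
      then show ?thesis using gen_ideal_subspace(4)[of var_t "{var_s, var_t}"] unfolding var_t_def by blast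
    qed
  qed
qed

lemma gen_ideal_uv: "gen_ideal {var_u, var_v} = Supp {m. uv_part m \<noteq> (0, 0)}"
proof (intro set_eqI iffI)
  fix p :: "'k::field bipoly" assume "p \<in> gen_ideal {var_u, var_v}"
  then obtain x y where p: "p = var_u * x + var_v * y" by (auto simp: gen_ideal_insert gen_ideal_empty)
  have "var_u * x \<in> Supp {m. uv_part m \<noteq> (0, 0)}" "var_v * y \<in> Supp {m. uv_part m \<noteq> (0, 0)}"
    by (rule Supp_mult[of _ "{(0, 0, 1, 0)}" _ UNIV] Supp_mult[of _ "{(0, 0, 0, 1)}" _ UNIV];
        auto simp: Supp_def var_u_def var_v_def uv_part_def)+
  then show "p \<in> Supp {m. uv_part m \<noteq> (0, 0)}" unfolding p by (rule Supp_add)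
next
  fix p :: "'k::field bipoly" assume p: "p \<in> Supp {m. uv_part m \<noteq> (0, 0)}"
  show "p \<in> gen_ideal {var_u, var_v}"
  proof (rule mem_gen_ideal_of_terms)
    fix m assume "m \<in> Poly_Mapping.keys p"
    moreover obtain i j k l where m: "m = (i, j, k, l)" by (metis prod_cases4)
    ultimately have "(k, l) \<noteq> (0, 0)" using p by (auto simp: Supp_def uv_part_def)
    then consider "k > 0" | "l > 0" by auto
    then show "\<exists>m1 m2. m = m1 + m2 \<and> Poly_Mapping.single m1 1 \<in> gen_ideal {var_u, var_v}"
    proof cases
      case 1
      then have "m = (0, 0, 1, 0) + (i, j, k - 1, l)" by (simp add: m)
      then show ?thesis using gen_ideal_subspace(4)[of var_u "{var_u, var_v}"] unfolding var_u_def by blast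
    next
      case 2
      then have "m = (0, 0, 0, 1) + (i, j, k, l - 1)" by (simp add: m)
      then show ?thesis using gen_ideal_subspace(4)[of var_v "{var_u, var_v}"] unfolding var_v_def by blast
    qed
  qed
qed

text \<open>If \<open>p\<close> lies in the irrelevant ideal, all monomials of \<open>p\<^sup>n\<close> have bidegree at least \<open>(n, n)\<close> and are
  multiples of monomials of bidegree \<open>(n, n)\<close>, which lie in \<open>I\<^sub>W\<close>.  Conversely \<open>I\<^sub>W\<close> is contained in the
  irrelevant ideal because both degrees of \<open>f\<close> are positive, and the irrelevant ideal is an
  intersection of two primes.\<close>

lemma radical_eq_irrelevant:
  fixes f :: "'k::field triple"
  assumes f: "f \<in> Rdeg3 d1 d2" and d: "d1 > 0" "d2 > 0" and n: "Rdeg (int n) (int n) \<subseteq> I_W f"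
  shows "radical (I_W f) = irrelevant_ideal"
proof (intro set_eqI iffI)
  obtain f0 f1 f2 where e: "f = (f0, f1, f2)" by (metis prod_cases3)
  have I: "I_W f = gen_ideal {f0, f1, f2}" by (simp add: e)
  {
    fix p assume "p \<in> radical (I_W f)"
    then obtain k g where k: "p ^ k = kos1 f g" by (auto simp: radical_def I_W_eq)
    have st: "st_part (m + m') = st_part m + st_part m'" and uv: "uv_part (m + m') = uv_part m + uv_part m'"
      for m m' by (cases m; cases m'; simp add: st_part_def uv_part_def)+
    have inj: "m = m'" if "st_part m = st_part m'" "uv_part m = uv_part m'" for m m'
      using that by (cases m; cases m') (simp add: st_part_def uv_part_def)
    have "x * y \<in> Supp {m. st_part m \<noteq> (0, 0)} \<and> x * y \<in> Supp {m. uv_part m \<noteq> (0, 0)}"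
      if "x \<in> Rdeg d1 d2" for x y :: "'k bipoly"
      using d by (intro conjI Supp_mult[OF that[unfolded Rdeg_eq_Supp], of y UNIV])
        (auto simp: Supp_def st_part_def uv_part_def)
    then have "kos1 f g \<in> Supp {m. st_part m \<noteq> (0, 0)}" "kos1 f g \<in> Supp {m. uv_part m \<noteq> (0, 0)}"
      using f by (cases g; auto simp: e Rdeg3_def intro!: Supp_add)+
    then have "p \<in> Supp {m. st_part m \<noteq> (0, 0)}" "p \<in> Supp {m. uv_part m \<noteq> (0, 0)}"
      using root_in_prime[of st_part uv_part p k] root_in_prime[of uv_part st_part p k] st uv inj
      unfolding k by blast+
    then show "p \<in> irrelevant_ideal" by (simp add: irrelevant_ideal_def gen_ideal_st gen_ideal_uv)
  next
    fix p :: "'k bipoly" assume "p \<in> irrelevant_ideal"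
    then have p: "p \<in> Supp {(i, j, k, l). 1 \<le> i + j \<and> 1 \<le> k + l}"
      unfolding irrelevant_ideal_def gen_ideal_st gen_ideal_uv
      by (force simp: Supp_def st_part_def uv_part_def)
    have pow: "p ^ t \<in> Supp {(i, j, k, l). t \<le> i + j \<and> t \<le> k + l}" for t
    proof (induction t)
      case 0 show ?case by (auto simp: Supp_def)
    next
      case (Suc t)
      show ?case unfolding power_Suc by (rule Supp_mult[OF p Suc.IH]) auto
    qed
    have "p ^ n \<in> gen_ideal {f0, f1, f2}"
    proof (rule mem_gen_ideal_of_terms)
      fix m assume "m \<in> Poly_Mapping.keys (p ^ n)"
      moreover obtain i j k l where m: "m = (i, j, k, l)" by (metis prod_cases4)
      ultimately have le: "n \<le> i + j" "n \<le> k + l" using pow[of n] by (auto simp: Supp_def)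
      let ?m1 = "(min i n, n - min i n, min k n, n - min k n)"
      have "m = ?m1 + (i - min i n, j - (n - min i n), k - min k n, l - (n - min k n))"
        using le by (auto simp: m min_def)
      moreover have "Poly_Mapping.single ?m1 1 \<in> gen_ideal {f0, f1, f2}"
        using n unfolding I by (auto simp: Rdeg_def subset_iff of_nat_diff)
      ultimately show "\<exists>m1 m2. m = m1 + m2 \<and> Poly_Mapping.single m1 1 \<in> gen_ideal {f0, f1, f2}" by blast
    qed
    then show "p \<in> radical (I_W f)" unfolding radical_def I by blast
  }
qed

section \<open>The sign of the Euler characteristic\<close>

definition dim_R :: "int \<Rightarrow> int \<Rightarrow> int" where
  "dim_R p q = pos_part (p + 1) * pos_part (q + 1)"

definition chi_d :: "int \<Rightarrow> int \<Rightarrow> int \<Rightarrow> int \<Rightarrow> int" where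
  "chi_d d1 d2 a1 a2 = dim_R a1 a2 - 3 * dim_R (a1 - d1) (a2 - d2)
     + 3 * dim_R (a1 - 2 * d1) (a2 - 2 * d2) - dim_R (a1 - 3 * d1) (a2 - 3 * d2)"

lemma euler_char_eq: "euler_char TYPE('k::field) d1 d2 a1 a2 = chi_d d1 d2 a1 a2"
  by (simp add: euler_char_def chi_d_def dim_R_def dim_Rdeg)

lemma pos_part_simps: "c \<ge> 0 \<Longrightarrow> pos_part c = c" "c \<le> 0 \<Longrightarrow> pos_part c = 0"
  by (simp_all add: pos_part_def)

text \<open>Here \<open>a - 3d\<close> has a negative second entry, and all first factors are linear in \<open>a1\<close>.
  Where \<open>a2 \<ge> d2 - 1\<close>, the third difference of the bilinear function
  \<open>(a1 + 1) (a2 + 1)\<close> vanishes, and the terms in which it differs from the true dimension add up to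
  \<open>dom - 3 cod\<close>.  Below that, \<open>\<chi>\<close> is the dimension of \<open>R\<^sub>a\<close>, and \<open>dom \<le> 3 cod\<close>.\<close>

lemma n_d_eq_neg_chi_strip:
  assumes d: "d1 > 0" "d2 > 0" and a: "a1 \<ge> 3 * d1" "a2 \<ge> 0" "a2 \<le> 3 * d2 - 2"
  shows "n_d d1 d2 a1 a2 = pos_part (- chi_d d1 d2 a1 a2)"
proof -
  have dom: "dom_d d1 d2 a1 a2 = (a1 - 3 * d1 + 1) * (3 * d2 - a2 - 1)"
    and cod: "cod_d d1 d2 a1 a2 = (a1 - 2 * d1 + 1) * pos_part (2 * d2 - a2 - 1)"
    using assms by (simp_all add: dom_d_def cod_d_def pos_part_def max_def)
  have h0: "dim_R a1 a2 = (a1 + 1) * (a2 + 1)" and h3: "dim_R (a1 - 3 * d1) (a2 - 3 * d2) = 0"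
    and h1: "dim_R (a1 - d1) (a2 - d2) = (a1 - d1 + 1) * pos_part (a2 - d2 + 1)"
    and h2: "dim_R (a1 - 2 * d1) (a2 - 2 * d2) = (a1 - 2 * d1 + 1) * pos_part (a2 - 2 * d2 + 1)"
    using assms by (simp_all add: dim_R_def pos_part_def max_def)
  consider "a2 \<ge> 2 * d2 - 1" | "d2 - 1 \<le> a2" "a2 < 2 * d2 - 1" | "a2 < d2 - 1" by linarith
  then show ?thesis
  proof cases
    case 1
    then have p: "pos_part (2 * d2 - a2 - 1) = 0" "pos_part (a2 - d2 + 1) = a2 - d2 + 1"
      "pos_part (a2 - 2 * d2 + 1) = a2 - 2 * d2 + 1" using d by (simp_all add: pos_part_simps)
    then show ?thesis unfolding n_d_def chi_d_def dom cod h0 h1 h2 h3 p by (simp add: algebra_simps)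
  next
    case 2
    then have p: "pos_part (2 * d2 - a2 - 1) = 2 * d2 - a2 - 1" "pos_part (a2 - d2 + 1) = a2 - d2 + 1"
      "pos_part (a2 - 2 * d2 + 1) = 0" using d by (simp_all add: pos_part_simps)
    then show ?thesis unfolding n_d_def chi_d_def dom cod h0 h1 h2 h3 p by (simp add: algebra_simps)
  next
    case 3
    then have p: "pos_part (2 * d2 - a2 - 1) = 2 * d2 - a2 - 1" "pos_part (a2 - d2 + 1) = 0"
      "pos_part (a2 - 2 * d2 + 1) = 0" using d by (simp_all add: pos_part_simps)
    have "a1 - 3 * d1 + 1 \<le> a1 - 2 * d1 + 1" "3 * d2 - a2 - 1 \<le> 3 * (2 * d2 - a2 - 1)"
      "0 \<le> a1 - 2 * d1 + 1" "0 \<le> 3 * d2 - a2 - 1" using 3 d a by simp_all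
    then have "(a1 - 3 * d1 + 1) * (3 * d2 - a2 - 1) \<le> (a1 - 2 * d1 + 1) * (3 * (2 * d2 - a2 - 1))"
      by (rule mult_mono)
    then have "n_d d1 d2 a1 a2 = 0"
      unfolding n_d_def dom cod p by (intro pos_part_simps) (simp only: mult.left_commute[of 3] diff_le_0_iff_le)
    moreover have "0 \<le> (a1 + 1) * (a2 + 1)" using d a by simp
    ultimately show ?thesis unfolding chi_d_def h0 h1 h2 h3 p by (simp add: pos_part_simps)
  qed
qed

lemma n_d_swap: "n_d d1 d2 a1 a2 = n_d d2 d1 a2 a1"
  by (simp add: n_d_def dom_d_def cod_d_def algebra_simps)

lemma chi_d_swap: "chi_d d1 d2 a1 a2 = chi_d d2 d1 a2 a1"
  by (simp add: chi_d_def dim_R_def mult.commute)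

text \<open>A bilinear function on a rectangle is a positive combination of its values at the corners; here
  these values, in units of \<open>d1 d2\<close>, are 1, 3, 2 and 0.\<close>

lemma chi_d_nonneg_half:
  fixes x y d1 d2 :: int
  assumes "d1 \<le> x" "x \<le> 3 * d1" "d2 \<le> y" "y \<le> 2 * d2"
  shows "0 \<le> x * y - 3 * ((x - d1) * (y - d2))"
proof -
  have "0 \<le> (3 * d1 - x) * (2 * d2 - y)" "0 \<le> (x - d1) * (2 * d2 - y)" "0 \<le> (3 * d1 - x) * (y - d2)"
    using assms by simp_all
  then have "0 \<le> (3 * d1 - x) * (2 * d2 - y) + 3 * ((x - d1) * (2 * d2 - y)) + 2 * ((3 * d1 - x) * (y - d2))"
    by (intro add_nonneg_nonneg mult_nonneg_nonneg[of 3] mult_nonneg_nonneg[of 2]) simp_all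
  also have "\<dots> = 2 * (x * y - 3 * ((x - d1) * (y - d2)))" by (simp add: algebra_simps)
  finally show ?thesis by (simp only: zero_le_mult_iff) simp
qed

text \<open>Where the first three terms are all nonzero, the Euler characteristic factors as
  \<open>(3 d1 - x) (3 d2 - y)\<close>; elsewhere the third term vanishes.\<close>

lemma chi_d_nonneg:
  assumes d: "d1 > 0" "d2 > 0" and a: "0 \<le> a1" "0 \<le> a2" "a1 \<le> 3 * d1 - 1" "a2 \<le> 3 * d2 - 1"
  shows "0 \<le> chi_d d1 d2 a1 a2"
proof -
  define x y where "x = a1 + 1" and "y = a2 + 1"
  have xy: "1 \<le> x" "1 \<le> y" "x \<le> 3 * d1" "y \<le> 3 * d2" using a by (simp_all add: x_def y_def)
  have "dim_R a1 a2 = x * y" "dim_R (a1 - 3 * d1) (a2 - 3 * d2) = 0"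
    using a by (simp_all add: dim_R_def x_def y_def pos_part_simps)
  moreover have "dim_R (a1 - d1) (a2 - d2) = pos_part (x - d1) * pos_part (y - d2)"
    "dim_R (a1 - 2 * d1) (a2 - 2 * d2) = pos_part (x - 2 * d1) * pos_part (y - 2 * d2)"
    by (simp_all add: dim_R_def x_def y_def algebra_simps)
  ultimately have chi: "chi_d d1 d2 a1 a2 = x * y - 3 * (pos_part (x - d1) * pos_part (y - d2))
      + 3 * (pos_part (x - 2 * d1) * pos_part (y - 2 * d2))" by (simp add: chi_d_def)
  have ge0: "0 \<le> pos_part (x - 2 * d1) * pos_part (y - 2 * d2)" "0 \<le> x * y" using xy by (simp_all add: pos_part_def)
  consider "x \<le> d1 \<or> y \<le> d2" | "x > d1" "y > d2" "y \<le> 2 * d2" | "x > d1" "y > d2" "x \<le> 2 * d1"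
    | "x > 2 * d1" "y > 2 * d2" by linarith
  then show ?thesis
  proof cases
    case 1
    then have zero: "pos_part (x - d1) * pos_part (y - d2) = 0" by (auto simp: pos_part_simps)
    show ?thesis unfolding chi zero using ge0 by simp
  next
    case 2
    then show ?thesis unfolding chi using ge0 chi_d_nonneg_half[of d1 x d2 y] xy by (simp add: pos_part_simps)
  next
    case 3
    then show ?thesis unfolding chi using ge0 chi_d_nonneg_half[of d2 y d1 x] xy
      by (simp add: pos_part_simps mult.commute)
  next
    case 4
    then have "chi_d d1 d2 a1 a2 = x * y - 3 * ((x - d1) * (y - d2)) + 3 * ((x - 2 * d1) * (y - 2 * d2))"
      unfolding chi using d by (simp add: pos_part_simps)
    also have "\<dots> = (3 * d1 - x) * (3 * d2 - y)" by (simp add: algebra_simps)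
    also have "\<dots> \<ge> 0" using xy by simp
    finally show ?thesis .
  qed
qed

text \<open>Here every dimension is given by the bilinear function, whose third difference vanishes.\<close>

lemma chi_d_zero:
  assumes d: "d1 > 0" "d2 > 0" and a: "a1 \<ge> 3 * d1 - 1" "a2 \<ge> 3 * d2 - 1"
  shows "chi_d d1 d2 a1 a2 = 0"
proof -
  have "dim_R (a1 - c * d1) (a2 - c * d2) = (a1 - c * d1 + 1) * (a2 - c * d2 + 1)" if "c \<le> 3" for c
  proof -
    have "c * d1 \<le> 3 * d1" "c * d2 \<le> 3 * d2" using that d by simp_all
    then show ?thesis unfolding dim_R_def using a by (simp add: pos_part_simps)
  qed
  from this[of 0] this[of 1] this[of 2] this[of 3] show ?thesis
    by (simp add: chi_d_def algebra_simps)
qed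

lemma n_d_eq_neg_chi:
  assumes d: "d1 > 0" "d2 > 0" and a: "0 \<le> a1" "0 \<le> a2"
  shows "n_d d1 d2 a1 a2 = pos_part (- chi_d d1 d2 a1 a2)"
proof -
  consider "a1 \<ge> 3 * d1" "a2 \<le> 3 * d2 - 2" | "a2 \<ge> 3 * d2" "a1 \<le> 3 * d1 - 2"
    | "a1 \<ge> 3 * d1 - 1" "a2 \<ge> 3 * d2 - 1" | "a1 \<le> 3 * d1 - 1" "a2 \<le> 3 * d2 - 1" by linarith
  then show ?thesis
  proof cases
    case 1 then show ?thesis using n_d_eq_neg_chi_strip[OF d] a by simp
  next
    case 2 then show ?thesis
      using n_d_eq_neg_chi_strip[OF d(2,1)] a by (subst n_d_swap, subst chi_d_swap) simp
  next
    case 3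
    then have "dom_d d1 d2 a1 a2 = 0" by (auto simp: dom_d_def pos_part_def max_def)
    moreover have "cod_d d1 d2 a1 a2 \<ge> 0" by (simp add: cod_d_def pos_part_def)
    ultimately show ?thesis using chi_d_zero[OF d 3] by (simp add: n_d_def pos_part_def)
  next
    case 4
    then have "dom_d d1 d2 a1 a2 = 0" by (auto simp: dom_d_def pos_part_def max_def)
    moreover have "cod_d d1 d2 a1 a2 \<ge> 0" by (simp add: cod_d_def pos_part_def)
    ultimately show ?thesis using chi_d_nonneg[OF d a 4] by (simp add: n_d_def pos_part_def)
  qed
qed

section \<open>Genericity\<close>

text \<open>The contributions of \<open>\<phi>\<^sub>1\<close> and of \<open>\<phi>\<^sub>2\<close> to \<open>dom\<^sub>d\<close> and \<open>cod\<^sub>d\<close>.\<close>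

definition dom1 :: "int \<Rightarrow> int \<Rightarrow> int \<Rightarrow> int \<Rightarrow> int" where
  "dom1 d1 d2 a1 a2 = pos_part (- 3 * d1 + a1 + 1) * pos_part (3 * d2 - a2 - 1)"
definition cod1 :: "int \<Rightarrow> int \<Rightarrow> int \<Rightarrow> int \<Rightarrow> int" where
  "cod1 d1 d2 a1 a2 = pos_part (- 2 * d1 + a1 + 1) * pos_part (2 * d2 - a2 - 1)"
definition dom2 :: "int \<Rightarrow> int \<Rightarrow> int \<Rightarrow> int \<Rightarrow> int" where
  "dom2 d1 d2 a1 a2 = pos_part (3 * d1 - a1 - 1) * pos_part (- 3 * d2 + a2 + 1)"
definition cod2 :: "int \<Rightarrow> int \<Rightarrow> int \<Rightarrow> int \<Rightarrow> int" where
  "cod2 d1 d2 a1 a2 = pos_part (2 * d1 - a1 - 1) * pos_part (- 2 * d2 + a2 + 1)"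

lemma full_rank_iff_kernel:
  assumes lin: "Vector_Spaces.linear scl scl3 \<phi>" and V: "fin_subspace scl V"
    and dom: "int (vector_space.dim scl V) = m" and cod: "int (vector_space.dim scl3 W) = c"
  shows "full_rank scl scl3 V W \<phi> \<longleftrightarrow> int (vector_space.dim scl {v \<in> V. \<phi> v = 0}) = pos_part (m - c)"
  using rank_nullity(3)[OF lin V] dom cod unfolding full_rank_def pos_part_def by linarith

lemma full_rank_phi:
  fixes f :: "'k::field triple"
  shows "full_rank scl scl3 (Rdeg (- 3 * d1 + a1) (3 * d2 - a2 - 2)) (Rdeg3 (- 2 * d1 + a1) (2 * d2 - a2 - 2)) (phi1 f)
      \<longleftrightarrow> int (nullity1 d1 d2 f a1 a2) = pos_part (dom1 d1 d2 a1 a2 - 3 * cod1 d1 d2 a1 a2)"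
    and "full_rank scl scl3 (Rdeg (3 * d1 - a1 - 2) (- 3 * d2 + a2)) (Rdeg3 (2 * d1 - a1 - 2) (- 2 * d2 + a2)) (phi2 f)
      \<longleftrightarrow> int (nullity2 d1 d2 f a1 a2) = pos_part (dom2 d1 d2 a1 a2 - 3 * cod2 d1 d2 a1 a2)"
  unfolding nullity1_def nullity2_def
  by (rule full_rank_iff_kernel[OF linear_phi1[folded scl_eq_pm_scale scl3_eq_pm_scale3] fin_subspace_Rdeg],
      simp_all add: dim_Rdeg dim_Rdeg3 dom1_def cod1_def)
    (rule full_rank_iff_kernel[OF linear_phi2[folded scl_eq_pm_scale scl3_eq_pm_scale3] fin_subspace_Rdeg],
      simp_all add: dim_Rdeg dim_Rdeg3 dom2_def cod2_def)

lemma nullity_le_dom: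
  fixes f :: "'k::field triple"
  shows "int (nullity1 d1 d2 f a1 a2) \<le> dom1 d1 d2 a1 a2" "int (nullity2 d1 d2 f a1 a2) \<le> dom2 d1 d2 a1 a2"
proof -
  note l = linear_phi1[folded scl_eq_pm_scale scl3_eq_pm_scale3] linear_phi2[folded scl_eq_pm_scale scl3_eq_pm_scale3]
  have "nullity1 d1 d2 f a1 a2 \<le> vector_space.dim scl (Rdeg (- 3 * d1 + a1) (3 * d2 - a2 - 2) :: 'k bipoly set)"
    unfolding nullity1_def by (subst rank_nullity(3)[OF l(1)[of f] fin_subspace_Rdeg]) (rule le_add1)
  then show "int (nullity1 d1 d2 f a1 a2) \<le> dom1 d1 d2 a1 a2"
    using dim_Rdeg[where 'k='k, of "- 3 * d1 + a1" "3 * d2 - a2 - 2"] by (simp add: dom1_def)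
  have "nullity2 d1 d2 f a1 a2 \<le> vector_space.dim scl (Rdeg (3 * d1 - a1 - 2) (- 3 * d2 + a2) :: 'k bipoly set)"
    unfolding nullity2_def by (subst rank_nullity(3)[OF l(2)[of f] fin_subspace_Rdeg]) (rule le_add1)
  then show "int (nullity2 d1 d2 f a1 a2) \<le> dom2 d1 d2 a1 a2"
    using dim_Rdeg[where 'k='k, of "3 * d1 - a1 - 2" "- 3 * d2 + a2"] by (simp add: dom2_def)
qed

text \<open>If the domain of one of the two maps is nonzero, then domain and codomain of the other are zero, so
  the positive part of the sum is the sum of the positive parts.\<close>

lemma n_d_split:
  assumes "d1 > 0" "d2 > 0"
  shows "n_d d1 d2 a1 a2 = pos_part (dom1 d1 d2 a1 a2 - 3 * cod1 d1 d2 a1 a2)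
      + pos_part (dom2 d1 d2 a1 a2 - 3 * cod2 d1 d2 a1 a2)"
    and "dom1 d1 d2 a1 a2 = 0 \<or> dom2 d1 d2 a1 a2 = 0"
proof -
  have nn: "cod1 d1 d2 a1 a2 \<ge> 0" "cod2 d1 d2 a1 a2 \<ge> 0" by (simp_all add: cod1_def cod2_def pos_part_def)
  have 1: "dom2 d1 d2 a1 a2 = 0 \<and> cod2 d1 d2 a1 a2 = 0" if "dom1 d1 d2 a1 a2 \<noteq> 0"
    using that assms by (auto simp: dom1_def dom2_def cod2_def pos_part_def max_def split: if_splits)
  have 2: "cod1 d1 d2 a1 a2 = 0" if "dom2 d1 d2 a1 a2 \<noteq> 0"
    using that assms by (auto simp: cod1_def dom2_def pos_part_def max_def split: if_splits)
  show "dom1 d1 d2 a1 a2 = 0 \<or> dom2 d1 d2 a1 a2 = 0" using 1 by blast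
  have "n_d d1 d2 a1 a2 = pos_part (dom1 d1 d2 a1 a2 + dom2 d1 d2 a1 a2 - 3 * (cod1 d1 d2 a1 a2 + cod2 d1 d2 a1 a2))"
    by (simp add: n_d_def dom_d_def cod_d_def dom1_def dom2_def cod1_def cod2_def)
  then show "n_d d1 d2 a1 a2 = pos_part (dom1 d1 d2 a1 a2 - 3 * cod1 d1 d2 a1 a2)
      + pos_part (dom2 d1 d2 a1 a2 - 3 * cod2 d1 d2 a1 a2)"
    using 1 2 nn by (cases "dom1 d1 d2 a1 a2 = 0"; cases "dom2 d1 d2 a1 a2 = 0") (auto simp: pos_part_def max_def)
qed

text \<open>If \<open>f\<close> is generic, the nullities add up to \<open>n\<^sub>d\<close>, the negative part of \<open>\<chi>\<close>, so the quotient ring has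
  dimension \<open>\<chi>\<^sub>+\<close>.  Conversely, \<open>\<chi>\<close> vanishes in large bidegrees, so \<open>I\<^sub>W\<close> contains a full graded piece of \<open>R\<close> and
  its radical is the irrelevant ideal; then the sum of the nullities is \<open>n\<^sub>d\<close>, and since one of the
  two domains is zero in each bidegree, each nullity has the value that full rank prescribes.\<close>

lemma generic_iff:
  fixes f :: "'k::field triple"
  assumes d: "d1 > 0" "d2 > 0" and f: "f \<in> Rdeg3 d1 d2"
  shows "generic d1 d2 f \<longleftrightarrow>
      (\<forall>a1\<ge>0. \<forall>a2\<ge>0. int (dim_RI f a1 a2) = pos_part (euler_char TYPE('k) d1 d2 a1 a2))"
    and "generic d1 d2 f \<Longrightarrow> a1 \<ge> 0 \<Longrightarrow> a2 \<ge> 0 \<Longrightarrow> int (dim_H1 d1 d2 f a1 a2) = n_d d1 d2 a1 a2"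
proof -
  let ?k1 = "\<lambda>a1 a2. int (nullity1 d1 d2 f a1 a2)" and ?k2 = "\<lambda>a1 a2. int (nullity2 d1 d2 f a1 a2)"
  let ?m1 = "\<lambda>a1 a2. pos_part (dom1 d1 d2 a1 a2 - 3 * cod1 d1 d2 a1 a2)"
  let ?m2 = "\<lambda>a1 a2. pos_part (dom2 d1 d2 a1 a2 - 3 * cod2 d1 d2 a1 a2)"
  have gen: "generic d1 d2 f \<longleftrightarrow> radical (I_W f) = irrelevant_ideal \<and>
      (\<forall>a1\<ge>0. \<forall>a2\<ge>0. ?k1 a1 a2 = ?m1 a1 a2 \<and> ?k2 a1 a2 = ?m2 a1 a2)"
    unfolding generic_def full_rank_phi ..
  show H1: "int (dim_H1 d1 d2 f a1 a2) = n_d d1 d2 a1 a2"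
    if g: "generic d1 d2 f" and a: "a1 \<ge> 0" "a2 \<ge> 0" for a1 a2
    using koszul_dims_of_radical(1)[OF f, of a1 a2] g a n_d_split(1)[OF d, of a1 a2] unfolding gen by simp
  show "generic d1 d2 f \<longleftrightarrow>
      (\<forall>a1\<ge>0. \<forall>a2\<ge>0. int (dim_RI f a1 a2) = pos_part (euler_char TYPE('k) d1 d2 a1 a2))"
  proof (intro iffI allI impI)
    fix a1 a2 :: int assume g: "generic d1 d2 f" and a: "0 \<le> a1" "0 \<le> a2"
    have "int (dim_RI f a1 a2) = chi_d d1 d2 a1 a2 + pos_part (- chi_d d1 d2 a1 a2)"
      using koszul_dims_of_radical(2)[OF f, of a1 a2] g H1[OF g a] n_d_eq_neg_chi[OF d a]
      unfolding gen euler_char_eq by simp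
    then show "int (dim_RI f a1 a2) = pos_part (euler_char TYPE('k) d1 d2 a1 a2)"
      unfolding euler_char_eq pos_part_def by linarith
  next
    assume dim: "\<forall>a1\<ge>0. \<forall>a2\<ge>0. int (dim_RI f a1 a2) = pos_part (euler_char TYPE('k) d1 d2 a1 a2)"
    \<comment> \<open>Any \<open>n\<close> with \<open>n \<ge> 3 d1 - 1\<close> and \<open>n \<ge> 3 d2 - 1\<close> would do.\<close>
    define n where "n = nat (3 * (d1 + d2))"
    have n: "int n = 3 * (d1 + d2)" using d by (simp add: n_def)
    have "int (dim_RI f (int n) (int n)) = pos_part (chi_d d1 d2 (int n) (int n))"
      using dim by (simp add: euler_char_eq)
    also have "chi_d d1 d2 (int n) (int n) = 0" using d n by (intro chi_d_zero) simp_all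
    finally have z: "dim_RI f (int n) (int n) = 0" by (simp add: pos_part_def)
    let ?W = "kos1 f ` Rdeg3 (int n - d1) (int n - d2)"
    have "?W = Rdeg (int n) (int n)"
      using dim_RI_eq[OF f, of "int n" "int n"] z
      by (intro subspace_eq_of_dim_eq[OF vector_space_scl fin_subspace_Rdeg]) (auto simp: fin_subspace_def)
    then have "Rdeg (int n) (int n) \<subseteq> I_W f" by (auto simp: I_W_eq)
    then have rad: "radical (I_W f) = irrelevant_ideal" by (rule radical_eq_irrelevant[OF f d])
    have "?k1 a1 a2 = ?m1 a1 a2 \<and> ?k2 a1 a2 = ?m2 a1 a2" if a: "a1 \<ge> 0" "a2 \<ge> 0" for a1 a2
    proof -
      have "?k1 a1 a2 + ?k2 a1 a2 = pos_part (chi_d d1 d2 a1 a2) - chi_d d1 d2 a1 a2"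
        using koszul_dims_of_radical[OF f rad, of a1 a2] dim a by (simp add: euler_char_eq)
      also have "\<dots> = n_d d1 d2 a1 a2" unfolding n_d_eq_neg_chi[OF d a] pos_part_def by linarith
      finally have sum: "?k1 a1 a2 + ?k2 a1 a2 = ?m1 a1 a2 + ?m2 a1 a2" unfolding n_d_split(1)[OF d] .
      have c: "cod1 d1 d2 a1 a2 \<ge> 0" "cod2 d1 d2 a1 a2 \<ge> 0" by (simp_all add: cod1_def cod2_def pos_part_def)
      from n_d_split(2)[OF d, of a1 a2] show ?thesis
      proof
        assume 0: "dom1 d1 d2 a1 a2 = 0"
        then have "?k1 a1 a2 = 0" "?m1 a1 a2 = 0" using nullity_le_dom(1)[of d1 d2 f a1 a2] c by (simp_all add: pos_part_def)
        then show ?thesis using sum by simp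
      next
        assume 0: "dom2 d1 d2 a1 a2 = 0"
        then have "?k2 a1 a2 = 0" "?m2 a1 a2 = 0" using nullity_le_dom(2)[of d1 d2 f a1 a2] c by (simp_all add: pos_part_def)
        then show ?thesis using sum by simp
      qed
    qed
    then show "generic d1 d2 f" unfolding gen using rad by blast
  qed
qed

lemma triple_of_mem: "triple_of d1 d2 x \<in> Rdeg3 d1 d2"
proof -
  have "(\<Sum>m | bideg m = (d1, d2). Poly_Mapping.single m (x (r, m))) \<in> Rdeg d1 d2" for r
    using keys_sum[of "\<lambda>m. Poly_Mapping.single m (x (r, m))" "{m. bideg m = (d1, d2)}"]
    by (force simp: Rdeg_def split: if_splits)
  then show ?thesis by (simp add: triple_of_def Let_def Rdeg3_def)
qed

theorem proposition2p17:
  fixes d1 d2 :: int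
  assumes "d1 > 0" and "d2 > 0"
  shows "((\<exists>U :: (nat \<times> expo \<Rightarrow> 'k::field) set.
             zariski_open (coeff_index d1 d2) U \<and> U \<noteq> {} \<and>
             (\<forall>x\<in>U. generic d1 d2 (triple_of d1 d2 x) \<and>
                (\<forall>a1\<ge>0. \<forall>a2\<ge>0.
                   int (dim_H1 d1 d2 (triple_of d1 d2 x) a1 a2) = n_d d1 d2 a1 a2)))
          \<longleftrightarrow>
          (\<exists>U :: (nat \<times> expo \<Rightarrow> 'k::field) set.
             zariski_open (coeff_index d1 d2) U \<and> U \<noteq> {} \<and>
             (\<forall>x\<in>U. \<forall>a1\<ge>0. \<forall>a2\<ge>0.
                int (dim_RI (triple_of d1 d2 x) a1 a2) =
                  pos_part (euler_char TYPE('k) d1 d2 a1 a2))))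
         \<and>
         (\<forall>x \<in> (affine_space (coeff_index d1 d2) :: (nat \<times> expo \<Rightarrow> 'k) set).
             generic d1 d2 (triple_of d1 d2 x) \<longrightarrow>
             (\<forall>a1\<ge>0. \<forall>a2\<ge>0.
                int (dim_H1 d1 d2 (triple_of d1 d2 x) a1 a2) = n_d d1 d2 a1 a2))"
proof -
  note iff = generic_iff(1)[OF assms triple_of_mem] and H1 = generic_iff(2)[OF assms triple_of_mem]
  have eq: "generic d1 d2 (triple_of d1 d2 x) \<and>
      (\<forall>a1\<ge>0. \<forall>a2\<ge>0. int (dim_H1 d1 d2 (triple_of d1 d2 x) a1 a2) = n_d d1 d2 a1 a2)
    \<longleftrightarrow> (\<forall>a1\<ge>0. \<forall>a2\<ge>0. int (dim_RI (triple_of d1 d2 x) a1 a2) = pos_part (euler_char TYPE('k) d1 d2 a1 a2))"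
    for x :: "nat \<times> expo \<Rightarrow> 'k"
    using iff[of x] H1[of x] by blast
  show ?thesis unfolding eq using H1 by blast
qed

end
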